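(* Let $(g_{ij})_{i,j\ge1}$ be a single infinite array of i.i.d. standard complex Gaussian random variables, and set $G_n=(g_{ij})_{1\le i,j\le n}$ and $Y_n=n^{-1/2}G_n$. Then, for every fixed integer $k\ge1$, $$\|Y_n^k\|\to\gamma_k\quad\text{almost surely as } n\to\infty,\qquad\text{where }\gamma_k=\sqrt{\frac{(k+1)^{k+1}}{k^k}}.$$
   Context: $\|\cdot\|$ denotes the operator norm. A standard complex Gaussian $g$ is $g=(x+iy)/\sqrt2$ with $x,y$ independent real standard Gaussians, so $\mathbb E g=0$ and $\mathbb E|g|^2=1$. *)

theory Defs
  imports "HOL-Probability.Probability" "Jordan_Normal_Form.Matrix"
begin

hide_const (open) Finite_Cartesian_Product.mat Finite_Cartesian_Product.vec
no_notation Finite_Cartesian_Product.vec_nth (infixl \<open>$\<close> 90)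

definition (in prob_space) std_complex_gaussian :: "('a \<Rightarrow> complex) \<Rightarrow> bool" where
  "std_complex_gaussian g \<longleftrightarrow>
     (\<exists>x y. distributed M lborel x std_normal_density
          \<and> distributed M lborel y std_normal_density
          \<and> indep_var borel x borel y
          \<and> (\<forall>\<omega>\<in>space M. g \<omega> = (of_real (x \<omega>) + \<i> * of_real (y \<omega>)) / of_real (sqrt 2)))"

text \<open>Matrix entries are indexed from 0, whereas the array is indexed from 1.\<close>
definition corner_mat :: "(nat \<Rightarrow> nat \<Rightarrow> complex) \<Rightarrow> nat \<Rightarrow> complex mat" where
  "corner_mat a n = mat n n (\<lambda>(i, j). a (i + 1) (j + 1))"

definition normalized_mat :: "(nat \<Rightarrow> nat \<Rightarrow> complex) \<Rightarrow> nat \<Rightarrow> complex mat" where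
  "normalized_mat a n = of_real (real n powr (-1/2)) \<cdot>\<^sub>m corner_mat a n"

definition euclidean_norm_vec :: "complex vec \<Rightarrow> real" where
  "euclidean_norm_vec v = L2_set (\<lambda>i. cmod (v $ i)) {..<dim_vec v}"

text \<open>The closed unit ball replaces the unit sphere because it is nonempty also in
  dimension 0, where the supremum is then 0.\<close>
definition operator_norm_mat :: "complex mat \<Rightarrow> real" where
  "operator_norm_mat A =
     (SUP v\<in>{v \<in> carrier_vec (dim_col A). euclidean_norm_vec v \<le> 1}. euclidean_norm_vec (A *\<^sub>v v))"

lemma bdd_above_operator_norm_mat:
  "bdd_above ((\<lambda>v. euclidean_norm_vec (A *\<^sub>v v)) `
     {v \<in> carrier_vec (dim_col A). euclidean_norm_vec v \<le> 1})"
proof (rule bdd_aboveI2)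
  fix v assume "v \<in> {v \<in> carrier_vec (dim_col A). euclidean_norm_vec v \<le> 1}"
  then have dim: "dim_vec v = dim_col A" and le1: "euclidean_norm_vec v \<le> 1" by auto
  have comp: "cmod (v $ j) \<le> 1" if "j < dim_col A" for j
  proof -
    have "cmod (v $ j) \<le> euclidean_norm_vec v"
      unfolding euclidean_norm_vec_def using that dim
      by (intro member_le_L2_set) auto
    then show ?thesis using le1 by linarith
  qed
  have entry: "cmod ((A *\<^sub>v v) $ i) \<le> (\<Sum>j<dim_col A. cmod (A $$ (i, j)))" if "i < dim_row A" for i
  proof -
    have "(A *\<^sub>v v) $ i = (\<Sum>j<dim_col A. A $$ (i, j) * v $ j)"
      using that dim by (simp add: scalar_prod_def atLeast0LessThan)
    also have "cmod \<dots> \<le> (\<Sum>j<dim_col A. cmod (A $$ (i, j)))"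
      by (intro sum_norm_le) (simp add: norm_mult comp mult_left_le)
    finally show ?thesis .
  qed
  have "euclidean_norm_vec (A *\<^sub>v v) \<le> (\<Sum>i<dim_row A. cmod ((A *\<^sub>v v) $ i))"
    unfolding euclidean_norm_vec_def dim_mult_mat_vec by (rule L2_set_le_sum) simp
  also have "\<dots> \<le> (\<Sum>i<dim_row A. \<Sum>j<dim_col A. cmod (A $$ (i, j)))"
    by (intro sum_mono entry) auto
  finally show "euclidean_norm_vec (A *\<^sub>v v) \<le> (\<Sum>i<dim_row A. \<Sum>j<dim_col A. cmod (A $$ (i, j)))" .
qed

end

theory Submission
  imports Defs "HOL-Real_Asymp.Real_Asymp"
begin

text \<open>
  Write \<open>Y = Y\<^sub>n\<close> and \<open>\<gamma> = \<gamma>\<^sub>k\<close>. For every \<open>m \<ge> 1\<close>, the norm satisfies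
  \<open>\<parallel>Y^k\<parallel>^(2 m) \<le> Tr ((Y*^k Y^k)^m) \<le> n \<parallel>Y^k\<parallel>^(2 m)\<close>, so the theorem follows from control of
  \<open>T(w) = E (1/n) Tr w(Y, Y*)\<close> for words \<open>w\<close> whose length may grow with \<open>n\<close>.

  Gaussian integration by parts on the first letter gives
  \<open>T(Y u) = \<Sum> E [(1/n) Tr u1 (1/n) Tr u2]\<close>, summed over the factorizations \<open>u = u1 Y* u2\<close>
  (lemma \<open>wick_trace_Cons\<close>). The covariance of two such normalized traces is nonnegative, and it is
  at most \<open>n^(-2)\<close> times the sum of \<open>T\<close> over the words that arise when one letter of \<open>u1\<close> is
  contracted with an adjoint letter of \<open>u2\<close> (lemmas \<open>wick_trace2_ge\<close> and \<open>wick_trace2_le\<close>); each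
  contraction joins the two cyclic words into a single one. If the covariance is dropped, the
  recursion closes on the words \<open>Y^j (Y*^k Y^k)^a Y*^j\<close>, and for generating functions it reads
  \<open>F_0 = 1 + x F_k\<close> and \<open>F_j = F_(j-1) F_0\<close>. Hence \<open>F_0 = 1 + x F_0^(k+1)\<close>: the values are the
  Fuss-Catalan numbers. For \<open>x > 0\<close>, a positive solution of \<open>z = 1 + x z^(k+1)\<close> exists
  exactly if \<open>x \<le> k^k / (k+1)^(k+1) = \<gamma>^(-2)\<close>, which is where the constant comes from.

  Upper bound. A contracted word coming from \<open>Y^j (Y*^k Y^k)^a Y*^j\<close> is a concatenation of at most
  \<open>2 a\<close> full blocks \<open>Y^k\<close> or \<open>Y*^k\<close> and at most eight shorter powers, so its normalized trace is at
  most \<open>R^(8(k-1)) B^(2a)\<close>, where \<open>R = max 1 \<parallel>Y\<parallel>\<close> and \<open>B = max 1 \<parallel>Y^k\<parallel>\<close>. Going back from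
  \<open>B^(2a)\<close> to the trace costs only one
  factor \<open>n\<close>, against the gain \<open>n^(-2)\<close>. The factor \<open>R\<close> is cut off at \<open>8\<close>, by means of the moment
  bound for \<open>k = 1\<close>, whose recursion involves no \<open>R\<close> because its short blocks are empty. The covariance
  therefore changes the recursion by a relative amount of order \<open>(m+1)^3 / n\<close>. For
  \<open>x < \<gamma>^(-2)\<close> the inequality \<open>1 + x z^(k+1) < z\<close> has room to absorb this, and
  \<open>T((Y*^k Y^k)^m) \<le> z x^(-m)\<close> results as soon as \<open>n \<ge> D (m+1)^3\<close> (lemma
  \<open>trace_moment_periods_le\<close>). With \<open>m\<close> of order \<open>n^(1/4)\<close>, Markov's inequality and the
  Borel-Cantelli lemma give \<open>limsup \<parallel>Y^k\<parallel> \<le> \<gamma>\<close>.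

  Lower bound. Since covariances are nonnegative, the Fuss-Catalan numbers bound \<open>T((Y*^k Y^k)^m)\<close>
  from below for every \<open>n\<close>. For fixed \<open>m\<close> the variance of the normalized trace is \<open>O(n^(-3/2))\<close>,
  which is summable, so almost surely \<open>\<parallel>Y^k\<parallel>^(2m)\<close> is eventually above any number smaller than the
  \<open>m\<close>-th Fuss-Catalan number, and these numbers grow like \<open>\<gamma>^(2m)\<close> (lemma \<open>fuss_growth\<close>).
\<close>

section \<open>Wick calculus for products of matrix entries\<close>

text \<open>
  \<open>(True, a, b)\<close> stands for the entry of \<open>G\<close> at row \<open>a\<close> and column \<open>b\<close>, and \<open>(False, a, b)\<close> for the
  entry of the adjoint of \<open>G\<close> at that position, that is, for the conjugate of \<open>g\<^sub>b\<^sub>a\<close>. In both cases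
  the indices are those of a step from \<open>a\<close> to \<open>b\<close> in a matrix product.
\<close>
type_synonym letter = "bool \<times> nat \<times> nat"

fun adj_letter :: "letter \<Rightarrow> letter" where
  "adj_letter (s, a, b) = (\<not> s, b, a)"

lemma adj_letter_adj_letter [simp]: "adj_letter (adj_letter x) = x"
  by (cases x) auto

lemma adj_letter_eq_iff: "adj_letter x = y \<longleftrightarrow> x = adj_letter y"
  by (cases x; cases y) auto

text \<open>
  On monomials, written as lists of variables, this is the partial derivative with respect to \<open>y\<close>
  followed by the linear functional \<open>f\<close>.
\<close>
fun deletion_sum :: "'a \<Rightarrow> ('a list \<Rightarrow> 'b::comm_monoid_add) \<Rightarrow> 'a list \<Rightarrow> 'b" where
  "deletion_sum y f [] = 0"
| "deletion_sum y f (x # l) = (if x = y then f l else 0) + deletion_sum y (\<lambda>m. f (x # m)) l"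

lemma deletion_sum_cong:
  assumes "l = l'" "y = y'" "\<And>m. length m < length l \<Longrightarrow> f m = f' m"
  shows "deletion_sum y f l = deletion_sum y' f' l'"
  using assms(3) unfolding assms(1,2)
proof (induction l' arbitrary: f f')
  case (Cons a l)
  have "f l = f' l" by (rule Cons.prems) simp
  moreover have "deletion_sum y' (\<lambda>m. f (a # m)) l = deletion_sum y' (\<lambda>m. f' (a # m)) l"
    by (intro Cons.IH Cons.prems) simp
  ultimately show ?case by simp
qed simp

lemma deletion_sum_mono:
  fixes f f' :: "'a list \<Rightarrow> real"
  assumes "\<And>m. Suc (length m) = length l \<Longrightarrow> set m \<subseteq> set l \<Longrightarrow> f m \<le> f' m"
  shows "deletion_sum y f l \<le> deletion_sum y f' l"
  using assms
proof (induction l arbitrary: f f')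
  case (Cons a l)
  have "f l \<le> f' l" by (rule Cons.prems) auto
  moreover have "deletion_sum y (\<lambda>m. f (a # m)) l \<le> deletion_sum y (\<lambda>m. f' (a # m)) l"
    by (intro Cons.IH Cons.prems) auto
  ultimately show ?case by (auto intro: add_mono)
qed simp

lemma deletion_sum_zero [simp]: "deletion_sum y (\<lambda>m. 0) l = 0"
  by (induction l) auto

lemma deletion_sum_nonneg:
  fixes f :: "'a list \<Rightarrow> real"
  assumes "\<And>m. Suc (length m) = length l \<Longrightarrow> set m \<subseteq> set l \<Longrightarrow> 0 \<le> f m"
  shows "0 \<le> deletion_sum y f l"
  using deletion_sum_mono[of l "\<lambda>_. 0" f y] assms by simp

lemma deletion_sum_add:
  "deletion_sum y (\<lambda>m. f m + g m) l = deletion_sum y f l + deletion_sum y g l"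
  by (induction l arbitrary: f g) (auto simp: ac_simps)

lemma deletion_sum_sum:
  "deletion_sum y (\<lambda>m. \<Sum>i\<in>A. f i m) l = (\<Sum>i\<in>A. deletion_sum y (f i) l)"
  by (induction A rule: infinite_finite_induct) (auto simp: deletion_sum_add)

lemma deletion_sum_cmult:
  fixes f :: "'a list \<Rightarrow> 'b::semiring_0"
  shows "deletion_sum y (\<lambda>m. c * f m) l = c * deletion_sum y f l"
  by (induction l arbitrary: f) (auto simp: algebra_simps)

lemma deletion_sum_append:
  "deletion_sum y f (l @ l') = deletion_sum y (\<lambda>m. f (m @ l')) l + deletion_sum y (\<lambda>m. f (l @ m)) l'"
  by (induction l arbitrary: f) (auto simp: ac_simps)

lemma deletion_sum_if:
  "deletion_sum y (\<lambda>m. if P then f m else 0) l = (if P then deletion_sum y f l else 0)"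
  by auto

lemma deletion_sum_commute:
  "deletion_sum y (\<lambda>m. deletion_sum z f m) l = deletion_sum z (\<lambda>m. deletion_sum y f m) l"
proof (induction l arbitrary: f)
  case (Cons a l)
  show ?case
    using Cons.IH[of "\<lambda>m. f (a # m)"]
    by (simp add: deletion_sum_add deletion_sum_if algebra_simps)
qed simp

lemma deletion_sum_commute2:
  "deletion_sum y (\<lambda>m. deletion_sum z (\<lambda>m'. f m m') l') l =
   deletion_sum z (\<lambda>m'. deletion_sum y (\<lambda>m. f m m') l) l'"
  by (induction l arbitrary: f) (auto simp: deletion_sum_add)

text \<open>
  For a functional that ignores the order of the factors, the derivative of a monomial is its
  exponent times the monomial with one factor less. Only lists that are one element shorter matter,
  so that the lemma can be used inside an induction on the length.
\<close>
lemma deletion_sum_remove1: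
  assumes "\<And>m m'. mset m = mset m' \<Longrightarrow> Suc (length m) = length l \<Longrightarrow> f m = f m'"
  shows "deletion_sum y f l = (of_nat (count (mset l) y) :: 'b::semiring_1) * f (remove1 y l)"
  using assms
proof (induction l arbitrary: f)
  case (Cons a l)
  have IH: "deletion_sum y (\<lambda>m. f (a # m)) l = of_nat (count (mset l) y) * f (a # remove1 y l)"
    by (rule Cons.IH) (auto intro!: Cons.prems)
  show ?case
  proof (cases "a = y")
    case True
    have "of_nat (count (mset l) y) * f (a # remove1 y l) = (of_nat (count (mset l) y) :: 'b) * f l"
    proof (cases "y \<in> set l")
      case t: True
      then have "f (a # remove1 y l) = f l"
        using True t length_pos_if_in_set[OF t] by (intro Cons.prems) (auto simp: length_remove1)
      then show ?thesis by simp
    next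
      case False
      then have "count (mset l) y = 0" by (simp add: count_eq_zero_iff)
      then show ?thesis by (metis mult_zero_left of_nat_0)
    qed
    then show ?thesis using IH True by (simp add: algebra_simps)
  next
    case False
    then show ?thesis using IH by simp
  qed
qed simp

declare deletion_sum_cong [fundef_cong]

text \<open>
  The expectation of a product of letters. The recursion is Gaussian integration by parts,
  \<open>E [x F] = E [\<partial>F / \<partial>x']\<close> with \<open>x'\<close> the conjugate variable of \<open>x\<close>; unfolded, it counts the perfect
  matchings of letters with conjugate letters.
\<close>
fun wick :: "letter list \<Rightarrow> real" where
  "wick [] = 1"
| "wick (x # l) = deletion_sum (adj_letter x) wick l"

lemma wick_nonneg: "0 \<le> wick l"
proof (induction l rule: length_induct)
  case (1 l)
  then show ?case by (cases l) (auto intro!: deletion_sum_nonneg)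
qed

lemma wick_swap: "wick (x # y # l) = wick (y # x # l)"
  by (auto simp: adj_letter_eq_iff deletion_sum_commute[of "adj_letter x" "adj_letter y"])

lemma wick_mset: "mset l = mset l' \<Longrightarrow> wick l = wick l'"
proof (induction "length l" arbitrary: l l' rule: less_induct)
  case less
  have del: "deletion_sum z wick m = deletion_sum z wick m'"
    if "mset m = mset m'" "length m < length l" for z m m'
  proof -
    have "deletion_sum z wick m = of_nat (count (mset m) z) * wick (remove1 z m)"
      using that by (intro deletion_sum_remove1 less.hyps) auto
    also have "wick (remove1 z m) = wick (remove1 z m')"
    proof (rule less.hyps)
      show "length (remove1 z m) < length l"
        using that(2) by (auto simp: length_remove1)
    qed (use that in simp)
    also have "of_nat (count (mset m) z) * wick (remove1 z m') = deletion_sum z wick m'"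
      using that by (subst deletion_sum_remove1) (auto intro!: less.hyps dest: mset_eq_length)
    finally show ?thesis .
  qed
  show ?case
  proof (cases l)
    case Nil
    then show ?thesis using less.prems by simp
  next
    case l: (Cons x l0)
    then obtain y l1 where l': "l' = y # l1" using less.prems by (cases l') auto
    show ?thesis
    proof (cases "x = y")
      case True
      then show ?thesis using less.prems l l' by (simp add: del)
    next
      case False
      obtain K where K: "mset l0 = add_mset y K" "mset l1 = add_mset x K"
        using False less.prems l l' by (auto simp: add_eq_conv_ex)
      have y: "y \<in> set l0"
        using K(1) by (metis set_mset_mset union_single_eq_member)
      have m: "mset l1 = mset (x # remove1 y l0)"
        using K by simp
      have m0: "mset l0 = mset (y # remove1 y l0)"
        using y by simp
      have "wick l = deletion_sum (adj_letter x) wick l0" using l by simp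
      also have "\<dots> = wick (x # y # remove1 y l0)"
        using del[OF m0] l by simp
      also have "\<dots> = wick (y # x # remove1 y l0)" by (rule wick_swap)
      also have "\<dots> = deletion_sum (adj_letter y) wick (x # remove1 y l0)" by simp
      also have "\<dots> = deletion_sum (adj_letter y) wick l1"
      proof (rule del)
        show "length (x # remove1 y l0) < length l"
          using l length_pos_if_in_set[OF y] y by (simp add: length_remove1)
      qed (use m in simp)
      finally show ?thesis using l' by simp
    qed
  qed
qed

text \<open>
  Each step of the recursion removes one plain and one conjugate letter.
\<close>
lemma wick_unbalanced:
  "length (filter fst l) \<noteq> length (filter (Not \<circ> fst) l) \<Longrightarrow> wick l = 0"
proof (induction l rule: length_induct)
  case (1 l)
  show ?case
  proof (cases l)
    case Nil then show ?thesis using 1 by simp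
  next
    case (Cons x l0)
    let ?c = "\<lambda>l :: letter list. int (length (filter fst l)) - int (length (filter (Not \<circ> fst) l))"
    have aux: "deletion_sum (adj_letter x) f m = 0"
      if "\<And>m'. Suc (length m') = length m \<Longrightarrow> ?c m' = ?c m + (if fst x then 1 else -1) \<Longrightarrow> f m' = 0"
      for f :: "letter list \<Rightarrow> real" and m :: "letter list"
      using that
    proof (induction m arbitrary: f)
      case (Cons a m)
      have "deletion_sum (adj_letter x) (\<lambda>m. f (a # m)) m = 0"
        by (intro Cons.IH Cons.prems) (auto split: if_splits)
      moreover have "f m = 0" if "a = adj_letter x"
        using that by (intro Cons.prems) (cases x; auto)+
      ultimately show ?case by auto
    qed simp
    have "deletion_sum (adj_letter x) wick l0 = 0"
    proof (rule aux)
      fix m' :: "letter list" assume "Suc (length m') = length l0" "?c m' = ?c l0 + (if fst x then 1 else -1)"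
      then show "wick m' = 0"
        using 1 Cons by (auto simp: o_def split: if_splits)
    qed
    then show ?thesis using Cons by simp
  qed
qed

text \<open>
  Matchings of \<open>l\<close> and of \<open>l'\<close> combine to a matching of \<open>l @ l'\<close>. In terms of Gaussian variables,
  the covariance of two such products is nonnegative.
\<close>
lemma wick_append_ge: "wick l * wick l' \<le> wick (l @ l')"
proof (induction l rule: length_induct)
  case (1 l)
  show ?case
  proof (cases l)
    case Nil then show ?thesis by simp
  next
    case (Cons x l0)
    have "deletion_sum (adj_letter x) wick l0 * wick l' = deletion_sum (adj_letter x) (\<lambda>m. wick l' * wick m) l0"
      by (simp add: deletion_sum_cmult)
    also have "\<dots> \<le> deletion_sum (adj_letter x) (\<lambda>m. wick (m @ l')) l0"
      using 1 Cons by (intro deletion_sum_mono) (auto simp: mult.commute)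
    also have "\<dots> \<le> deletion_sum (adj_letter x) wick (l0 @ l')"
      by (auto simp: deletion_sum_append intro!: deletion_sum_nonneg wick_nonneg)
    finally show ?thesis using Cons by simp
  qed
qed

text \<open>
  A matching of \<open>l @ l'\<close> that is not a union of matchings of the two parts contains a pair linking
  \<open>l\<close> to \<open>l'\<close>; the sum marks one such pair. As a matching may contain several linking pairs, this is
  an inequality and not an identity.
\<close>
lemma wick_append_le:
  assumes "finite Y" "set l \<subseteq> Y"
  shows "wick (l @ l') \<le> wick l * wick l' +
    (\<Sum>y\<in>Y. deletion_sum y (\<lambda>m. deletion_sum (adj_letter y) (\<lambda>m'. wick (m @ m')) l') l)"
  using assms(2)
proof (induction l rule: length_induct)
  case (1 l)
  show ?case
  proof (cases l)
    case Nil then show ?thesis by simp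
  next
    case (Cons x l0)
    let ?z = "adj_letter x"
    let ?S = "\<lambda>m y. deletion_sum (adj_letter y) (\<lambda>m'. wick (m @ m')) l'"
    have "deletion_sum ?z (\<lambda>m. wick (m @ l')) l0 \<le>
        deletion_sum ?z (\<lambda>m. wick l' * wick m + (\<Sum>y\<in>Y. deletion_sum y (\<lambda>m. ?S m y) m)) l0"
      using 1 Cons by (intro deletion_sum_mono) (auto simp: mult.commute)
    also have "\<dots> = wick l' * deletion_sum ?z wick l0 +
        (\<Sum>y\<in>Y. deletion_sum y (\<lambda>m. deletion_sum ?z (\<lambda>m. ?S m y) m) l0)"
      by (simp add: deletion_sum_add deletion_sum_sum deletion_sum_cmult
          deletion_sum_commute[of "?z"])
    also have "(\<Sum>y\<in>Y. deletion_sum y (\<lambda>m. deletion_sum ?z (\<lambda>m. ?S m y) m) l0) \<le>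
       (\<Sum>y\<in>Y. deletion_sum y (\<lambda>m. ?S (x # m) y) l0)"
    proof (intro sum_mono deletion_sum_mono)
      fix y m
      \<comment> \<open>A pair inside \<open>l\<close> and a linking pair can be removed in either order.\<close>
      have "deletion_sum ?z (\<lambda>m. ?S m y) m =
          deletion_sum (adj_letter y) (\<lambda>m'. deletion_sum ?z (\<lambda>m. wick (m @ m')) m) l'"
        by (rule deletion_sum_commute2)
      also have "\<dots> \<le> deletion_sum (adj_letter y) (\<lambda>m'. wick (x # m @ m')) l'"
        by (intro deletion_sum_mono) (auto simp: deletion_sum_append intro!: deletion_sum_nonneg wick_nonneg)
      finally show "deletion_sum ?z (\<lambda>m. ?S m y) m \<le> ?S (x # m) y" by simp
    qed
    finally have A: "deletion_sum ?z (\<lambda>m. wick (m @ l')) l0 \<le> wick l' * deletion_sum ?z wick l0 +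
      (\<Sum>y\<in>Y. deletion_sum y (\<lambda>m. ?S (x # m) y) l0)" by simp
    have "x \<in> Y" using 1 Cons by simp
    then have B: "deletion_sum ?z (\<lambda>m'. wick (l0 @ m')) l' = (\<Sum>y\<in>Y. if x = y then ?S l0 y else 0)"
      using assms(1) by (simp add: sum.delta')
    have "wick (l @ l') = deletion_sum ?z (\<lambda>m. wick (m @ l')) l0 + deletion_sum ?z (\<lambda>m'. wick (l0 @ m')) l'"
      using Cons by (simp add: deletion_sum_append)
    moreover have "(\<Sum>y\<in>Y. deletion_sum y (\<lambda>m. ?S m y) l) =
        (\<Sum>y\<in>Y. if x = y then ?S l0 y else 0) + (\<Sum>y\<in>Y. deletion_sum y (\<lambda>m. ?S (x # m) y) l0)"
      unfolding Cons deletion_sum.simps sum.distrib ..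
    moreover have "wick l = deletion_sum ?z wick l0" using Cons by simp
    ultimately show ?thesis using A B by (simp add: mult.commute)
  qed
qed

section \<open>Sums over index paths\<close>

text \<open>
  The counterpart of \<^const>\<open>deletion_sum\<close> for words: removing a letter of a cyclic word cuts it
  open, so both remaining pieces are kept.
\<close>
fun split_sum :: "'a \<Rightarrow> ('a list \<Rightarrow> 'a list \<Rightarrow> 'b::comm_monoid_add) \<Rightarrow> 'a list \<Rightarrow> 'b" where
  "split_sum s F [] = 0"
| "split_sum s F (r # w) = (if r = s then F [] w else 0) + split_sum s (\<lambda>u v. F (r # u) v) w"

lemma split_sum_cong:
  assumes "\<And>u v. w = u @ s # v \<Longrightarrow> F u v = F' u v"
  shows "split_sum s F w = split_sum s F' w"
  using assms
proof (induction w arbitrary: F F')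
  case (Cons r w)
  have "split_sum s (\<lambda>u v. F (r # u) v) w = split_sum s (\<lambda>u v. F' (r # u) v) w"
    by (intro Cons.IH Cons.prems) simp
  then show ?case using Cons.prems[of "[]" w] by simp
qed simp

lemma split_sum_mono:
  fixes F F' :: "'a list \<Rightarrow> 'a list \<Rightarrow> real"
  assumes "\<And>u v. w = u @ s # v \<Longrightarrow> F u v \<le> F' u v"
  shows "split_sum s F w \<le> split_sum s F' w"
  using assms
proof (induction w arbitrary: F F')
  case (Cons r w)
  have "split_sum s (\<lambda>u v. F (r # u) v) w \<le> split_sum s (\<lambda>u v. F' (r # u) v) w"
    by (intro Cons.IH Cons.prems) simp
  then show ?case using Cons.prems[of "[]" w] by (auto intro: add_mono)
qed simp

lemma split_sum_zero [simp]: "split_sum s (\<lambda>u v. 0) w = 0"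
  by (induction w) auto

lemma split_sum_le:
  fixes F :: "'a list \<Rightarrow> 'a list \<Rightarrow> real"
  assumes "\<And>u v. w = u @ s # v \<Longrightarrow> F u v \<le> B" "0 \<le> B"
  shows "split_sum s F w \<le> real (length w) * B"
  using assms
proof (induction w arbitrary: F)
  case (Cons r w)
  have "split_sum s (\<lambda>u v. F (r # u) v) w \<le> real (length w) * B"
    by (intro Cons.IH Cons.prems) auto
  then show ?case using Cons.prems(1)[of "[]" w] Cons.prems(2) by (auto simp: algebra_simps)
qed simp

lemma split_sum_add:
  "split_sum s (\<lambda>u v. F u v + F' u v) w = split_sum s F w + split_sum s F' w"
  by (induction w arbitrary: F F') (auto simp: ac_simps)

lemma split_sum_sum:
  "split_sum s (\<lambda>u v. \<Sum>i\<in>A. F i u v) w = (\<Sum>i\<in>A. split_sum s (F i) w)"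
  by (induction A rule: infinite_finite_induct) (auto simp: split_sum_add)

lemma split_sum_cmult:
  fixes F :: "'a list \<Rightarrow> 'a list \<Rightarrow> 'b::semiring_0"
  shows "split_sum s (\<lambda>u v. c * F u v) w = c * split_sum s F w"
  by (induction w arbitrary: F) (auto simp: algebra_simps)

lemma split_sum_append:
  "split_sum s F (w @ w') =
   split_sum s (\<lambda>u v. F u (v @ w')) w + split_sum s (\<lambda>u v. F (w @ u) v) w'"
  by (induction w arbitrary: F) (auto simp: ac_simps)

lemma split_sum_replicate:
  "split_sum s F (replicate j s) = (\<Sum>i<j. F (replicate i s) (replicate (j - 1 - i) s))"
proof (induction j arbitrary: F)
  case (Suc j)
  show ?case
    unfolding sum.lessThan_Suc_shift
    by (auto simp: Suc.IH intro!: sum.cong arg_cong2[of _ _ _ _ F])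
qed simp

lemma split_sum_replicate_other:
  "r \<noteq> s \<Longrightarrow> split_sum s F (replicate j r) = 0"
  by (induction j arbitrary: F) auto

text \<open>
  The sum of \<open>f\<close> over all monomials in the expansion of the \<open>(a, b)\<close> entry of the matrix word \<open>w\<close>.
  With \<open>f\<close> the product of the letters it is the entry itself; with \<open>f = wick\<close> it is its expectation.
  Since \<open>f\<close> is an argument, the same lemmas serve both readings.
\<close>
primrec path_sum :: "nat \<Rightarrow> bool list \<Rightarrow> nat \<Rightarrow> nat \<Rightarrow> (letter list \<Rightarrow> 'a::comm_monoid_add) \<Rightarrow> 'a" where
  "path_sum n [] a b f = (if a = b then f [] else 0)"
| "path_sum n (s # w) a b f = (\<Sum>c<n. path_sum n w c b (\<lambda>m. f ((s, a, c) # m)))"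

abbreviation letters :: "nat \<Rightarrow> letter set" where
  "letters n \<equiv> UNIV \<times> {..<n} \<times> {..<n}"

lemma path_sum_cong:
  assumes "a < n" "\<And>m. map fst m = w \<Longrightarrow> set m \<subseteq> letters n \<Longrightarrow> f m = f' m"
  shows "path_sum n w a b f = path_sum n w a b f'"
  using assms
proof (induction w arbitrary: a f f')
  case (Cons s w)
  show ?case
    unfolding path_sum.simps
  proof (intro sum.cong refl Cons.IH)
    fix c m assume "c \<in> {..<n}" "map fst m = w" "set m \<subseteq> letters n"
    then show "f ((s, a, c) # m) = f' ((s, a, c) # m)" using Cons.prems by auto
  qed auto
qed auto

lemma path_sum_mono:
  fixes f f' :: "letter list \<Rightarrow> real"
  assumes "a < n" "\<And>m. map fst m = w \<Longrightarrow> set m \<subseteq> letters n \<Longrightarrow> f m \<le> f' m"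
  shows "path_sum n w a b f \<le> path_sum n w a b f'"
  using assms
proof (induction w arbitrary: a f f')
  case (Cons s w)
  show ?case
    unfolding path_sum.simps
  proof (intro sum_mono Cons.IH)
    fix c m assume "c \<in> {..<n}" "map fst m = w" "set m \<subseteq> letters n"
    then show "f ((s, a, c) # m) \<le> f' ((s, a, c) # m)" using Cons.prems by auto
  qed auto
qed auto

lemma path_sum_zero [simp]: "path_sum n w a b (\<lambda>m. 0) = 0"
  by (induction w arbitrary: a) auto

lemma path_sum_add:
  "path_sum n w a b (\<lambda>m. f m + g m) = path_sum n w a b f + path_sum n w a b g"
  by (induction w arbitrary: a f g) (auto simp: sum.distrib)

lemma path_sum_sum:
  "path_sum n w a b (\<lambda>m. \<Sum>i\<in>A. f i m) = (\<Sum>i\<in>A. path_sum n w a b (f i))"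
  by (induction A rule: infinite_finite_induct) (auto simp: path_sum_add)

lemma path_sum_cmult:
  fixes f :: "letter list \<Rightarrow> 'b::semiring_0"
  shows "path_sum n w a b (\<lambda>m. c * f m) = c * path_sum n w a b f"
  by (induction w arbitrary: a f) (auto simp: sum_distrib_left)

lemma path_sum_if:
  "path_sum n w a b (\<lambda>m. if P then f m else 0) = (if P then path_sum n w a b f else 0)"
  by auto

lemma path_sum_append:
  "a < n \<Longrightarrow> path_sum n (u @ v) a b f =
    (\<Sum>c<n. path_sum n u a c (\<lambda>m. path_sum n v c b (\<lambda>m'. f (m @ m'))))"
proof (induction u arbitrary: a f)
  case Nil
  then show ?case by (simp add: sum.delta')
next
  case (Cons s u)
  have "path_sum n ((s # u) @ v) a b f =
      (\<Sum>e<n. \<Sum>c<n. path_sum n u e c (\<lambda>m. path_sum n v c b (\<lambda>m'. f ((s, a, e) # m @ m'))))"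
    by (simp add: Cons.IH)
  also have "\<dots> = (\<Sum>c<n. \<Sum>e<n. path_sum n u e c (\<lambda>m. path_sum n v c b (\<lambda>m'. f ((s, a, e) # m @ m'))))"
    by (rule sum.swap)
  finally show ?case by simp
qed

lemma path_sum_commute:
  "path_sum n u a b (\<lambda>m. path_sum n v c d (\<lambda>m'. f m m')) =
   path_sum n v c d (\<lambda>m'. path_sum n u a b (\<lambda>m. f m m'))"
  by (induction u arbitrary: a f) (auto simp: path_sum_sum)

lemma deletion_sum_path_sum:
  "deletion_sum y (\<lambda>p. path_sum n w a b (f p)) l = path_sum n w a b (\<lambda>m. deletion_sum y (\<lambda>p. f p m) l)"
  by (induction l arbitrary: f) (auto simp: path_sum_add)

lemma split_sum_path_sum:
  "path_sum n w a b (\<lambda>m. split_sum s (\<lambda>u v. f u v m) w') = split_sum s (\<lambda>u v. path_sum n w a b (f u v)) w'"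
  by (induction w' arbitrary: f) (auto simp: path_sum_add)

text \<open>
  The derivative of a matrix word with respect to the entry \<open>(c, d)\<close>: by the Leibniz rule each
  occurrence of the matrix is replaced by the matrix unit at \<open>(c, d)\<close>, which breaks the path into
  one that ends in \<open>c\<close> and one that starts in \<open>d\<close>.
\<close>
lemma path_sum_deletion_sum:
  assumes "d < n"
  shows "path_sum n w a b (deletion_sum (s, c, d) f) =
    split_sum s (\<lambda>u v. path_sum n u a c (\<lambda>m. path_sum n v d b (\<lambda>m'. f (m @ m')))) w"
proof (induction w arbitrary: a f)
  case (Cons r w)
  have "path_sum n (r # w) a b (deletion_sum (s, c, d) f) =
      (\<Sum>e<n. if e = d then (if r = s \<and> a = c then path_sum n w d b f else 0) else 0) +
      (\<Sum>e<n. split_sum s (\<lambda>u v. path_sum n u e c (\<lambda>m. path_sum n v d b (\<lambda>m'. f ((r, a, e) # m @ m')))) w)"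
    unfolding path_sum.simps deletion_sum.simps path_sum_add sum.distrib path_sum_if Cons.IH append_Cons
    by (intro arg_cong2[of _ _ _ _ plus] sum.cong) auto
  also have "(\<Sum>e<n. if e = d then (if r = s \<and> a = c then path_sum n w d b f else 0) else 0)
      = (if r = s then path_sum n [] a c (\<lambda>m. path_sum n w d b (\<lambda>m'. f (m @ m'))) else 0)"
    using assms by (simp add: sum.delta)
  finally show ?case
    by (simp add: split_sum_sum)
qed simp

definition closed_sum :: "nat \<Rightarrow> bool list \<Rightarrow> (letter list \<Rightarrow> 'a::comm_monoid_add) \<Rightarrow> 'a" where
  "closed_sum n w f = (\<Sum>a<n. path_sum n w a a f)"

lemma closed_sum_cong:
  assumes "\<And>m. map fst m = w \<Longrightarrow> set m \<subseteq> letters n \<Longrightarrow> f m = f' m"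
  shows "closed_sum n w f = closed_sum n w f'"
  unfolding closed_sum_def using assms by (intro sum.cong path_sum_cong) auto

lemma closed_sum_mono:
  fixes f f' :: "letter list \<Rightarrow> real"
  assumes "\<And>m. map fst m = w \<Longrightarrow> set m \<subseteq> letters n \<Longrightarrow> f m \<le> f' m"
  shows "closed_sum n w f \<le> closed_sum n w f'"
  unfolding closed_sum_def using assms by (intro sum_mono path_sum_mono) auto

lemma closed_sum_add:
  "closed_sum n w (\<lambda>m. f m + g m) = closed_sum n w f + closed_sum n w g"
  by (simp add: closed_sum_def path_sum_add sum.distrib)

lemma closed_sum_sum:
  "closed_sum n w (\<lambda>m. \<Sum>i\<in>A. f i m) = (\<Sum>i\<in>A. closed_sum n w (f i))"
  unfolding closed_sum_def path_sum_sum by (rule sum.swap)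

lemma closed_sum_cmult:
  fixes f :: "letter list \<Rightarrow> 'b::semiring_0"
  shows "closed_sum n w (\<lambda>m. c * f m) = c * closed_sum n w f"
  by (simp add: closed_sum_def path_sum_cmult sum_distrib_left)

lemma closed_sum_of_real:
  "closed_sum n w (\<lambda>m. complex_of_real (f m)) = of_real (closed_sum n w f)"
proof -
  have "path_sum n w a b (\<lambda>m. complex_of_real (f m)) = of_real (path_sum n w a b f)" for w a b f
    by (induction w arbitrary: a f) auto
  then show ?thesis by (simp only: closed_sum_def of_real_sum)
qed

text \<open>
  The expectations of \<open>Tr w(G)\<close> and of \<open>Tr u(G) Tr v(G)\<close>, without any normalization.
\<close>
definition wick_trace :: "nat \<Rightarrow> bool list \<Rightarrow> real" where
  "wick_trace n w = closed_sum n w wick"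

definition wick_trace2 :: "nat \<Rightarrow> bool list \<Rightarrow> bool list \<Rightarrow> real" where
  "wick_trace2 n u v = closed_sum n u (\<lambda>m. closed_sum n v (\<lambda>m'. wick (m @ m')))"

lemma wick_trace_nonneg: "0 \<le> wick_trace n w"
  using closed_sum_mono[of w n "\<lambda>_. 0" wick] wick_nonneg
  by (simp add: wick_trace_def closed_sum_def)

lemma wick_trace_Nil: "wick_trace n [] = real n"
  by (simp add: wick_trace_def closed_sum_def)

text \<open>
  Cyclicity of the trace.
\<close>
lemma wick_trace_rotate: "wick_trace n (u @ v) = wick_trace n (v @ u)"
proof -
  have "wick_trace n (u @ v) = (\<Sum>a<n. \<Sum>c<n. path_sum n u a c (\<lambda>m. path_sum n v c a (\<lambda>m'. wick (m @ m'))))"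
    by (simp add: wick_trace_def closed_sum_def path_sum_append)
  also have "\<dots> = (\<Sum>c<n. \<Sum>a<n. path_sum n u a c (\<lambda>m. path_sum n v c a (\<lambda>m'. wick (m @ m'))))"
    by (rule sum.swap)
  also have "\<dots> = (\<Sum>c<n. \<Sum>a<n. path_sum n v c a (\<lambda>m'. path_sum n u a c (\<lambda>m. wick (m' @ m))))"
    by (intro sum.cong refl, subst path_sum_commute)
       (auto intro!: path_sum_cong wick_mset)
  also have "\<dots> = wick_trace n (v @ u)"
    by (simp add: wick_trace_def closed_sum_def path_sum_append)
  finally show ?thesis .
qed

lemma wick_trace_unbalanced:
  assumes "count_list w True \<noteq> count_list w False"
  shows "wick_trace n w = 0"
proof -
  have "wick m = 0" if "map fst m = w" for m
  proof (rule wick_unbalanced)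
    have "count_list (map fst m) True = length (filter fst m)"
         "count_list (map fst m) False = length (filter (Not \<circ> fst) m)"
      by (induction m) auto
    then show "length (filter fst m) \<noteq> length (filter (Not \<circ> fst) m)"
      using assms that by simp
  qed
  then have "wick_trace n w = closed_sum n w (\<lambda>m. 0)"
    unfolding wick_trace_def by (intro closed_sum_cong) auto
  then show ?thesis by (simp add: closed_sum_def)
qed

text \<open>
  The Schwinger-Dyson equation: contracting the first letter with a later adjoint letter cuts the
  cyclic word into two.
\<close>
theorem wick_trace_Cons: "wick_trace n (s # w) = split_sum (\<not> s) (wick_trace2 n) w"
proof -
  have "wick_trace n (s # w) =
      (\<Sum>a<n. \<Sum>c<n. split_sum (\<not> s) (\<lambda>u v. path_sum n u c c (\<lambda>m. path_sum n v a a (\<lambda>m'. wick (m @ m')))) w)"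
    by (simp add: wick_trace_def closed_sum_def path_sum_deletion_sum)
  also have "\<dots> = split_sum (\<not> s) (\<lambda>u v. \<Sum>a<n. \<Sum>c<n. path_sum n u c c (\<lambda>m. path_sum n v a a (\<lambda>m'. wick (m @ m')))) w"
    by (simp add: split_sum_sum)
  also have "(\<lambda>u v. \<Sum>a<n. \<Sum>c<n. path_sum n u c c (\<lambda>m. path_sum n v a a (\<lambda>m'. wick (m @ m')))) = wick_trace2 n"
    by (intro ext, subst sum.swap) (simp add: wick_trace2_def closed_sum_def path_sum_sum)
  finally show ?thesis .
qed

lemma wick_trace_mult:
  "wick_trace n u * wick_trace n v = closed_sum n u (\<lambda>m. closed_sum n v (\<lambda>m'. wick m * wick m'))"
proof -
  have "closed_sum n u (\<lambda>m. wick m * closed_sum n v wick) = closed_sum n u (\<lambda>m. closed_sum n v wick * wick m)"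
    by (simp only: mult.commute)
  then show ?thesis by (simp add: closed_sum_cmult wick_trace_def)
qed

lemma wick_trace2_ge: "wick_trace n u * wick_trace n v \<le> wick_trace2 n u v"
  unfolding wick_trace_mult wick_trace2_def
  by (intro closed_sum_mono wick_append_ge)

text \<open>
  Contracting a letter of \<open>u\<close> with an adjoint letter of \<open>v\<close> joins the two cyclic words: with
  \<open>u = \<alpha> s \<beta>\<close> and \<open>v = \<alpha>' s' \<beta>'\<close>, the two remaining paths \<open>\<beta> \<alpha>\<close> and \<open>\<beta>' \<alpha>'\<close> share their end
  points, so that their concatenation is closed.
\<close>
lemma wick_trace2_le:
  "wick_trace2 n u v \<le> wick_trace n u * wick_trace n v +
    (\<Sum>s\<in>UNIV. split_sum s (\<lambda>\<alpha> \<beta>. split_sum (\<not> s) (\<lambda>\<alpha>' \<beta>'. wick_trace n (\<beta> @ \<alpha> @ \<beta>' @ \<alpha>')) v) u)"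
proof -
  let ?D = "\<lambda>y m m'. deletion_sum y (\<lambda>m. deletion_sum (adj_letter y) (\<lambda>m'. wick (m @ m')) m') m"
  have "wick_trace2 n u v \<le> closed_sum n u (\<lambda>m. closed_sum n v (\<lambda>m'. wick m * wick m' + (\<Sum>y\<in>letters n. ?D y m m')))"
    unfolding wick_trace2_def by (intro closed_sum_mono wick_append_le) auto
  also have "\<dots> = wick_trace n u * wick_trace n v +
      (\<Sum>y\<in>letters n. closed_sum n u (\<lambda>m. closed_sum n v (\<lambda>m'. ?D y m m')))"
    by (simp only: closed_sum_add closed_sum_sum wick_trace_mult)
  also have "(\<Sum>y\<in>letters n. closed_sum n u (\<lambda>m. closed_sum n v (\<lambda>m'. ?D y m m'))) =
     (\<Sum>s\<in>UNIV. \<Sum>c<n. \<Sum>d<n. closed_sum n u (\<lambda>m. closed_sum n v (\<lambda>m'. ?D (s, c, d) m m')))"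
    by (simp only: sum.cartesian_product) (auto intro!: sum.cong)
  also have "\<dots> = (\<Sum>s\<in>UNIV. split_sum s (\<lambda>\<alpha> \<beta>. split_sum (\<not> s) (\<lambda>\<alpha>' \<beta>'. wick_trace n (\<beta> @ \<alpha> @ \<beta>' @ \<alpha>')) v) u)"
  proof (intro sum.cong refl)
    fix s :: bool
    \<comment> \<open>Here \<open>a\<close> and \<open>e\<close> are the base points of the closed paths of \<open>u\<close> and \<open>v\<close>, and the contracted
      letters run from \<open>c\<close> to \<open>d\<close> and back.\<close>
    let ?Q = "\<lambda>\<alpha> \<beta> \<alpha>' \<beta>' a c d e. path_sum n \<alpha> a c (\<lambda>p. path_sum n \<beta> d a (\<lambda>p'.
         path_sum n \<alpha>' e d (\<lambda>q. path_sum n \<beta>' c e (\<lambda>q'. wick (p @ p' @ q @ q')))))"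
    have "closed_sum n u (\<lambda>m. closed_sum n v (\<lambda>m'. ?D (s, c, d) m m')) =
        split_sum s (\<lambda>\<alpha> \<beta>. split_sum (\<not> s) (\<lambda>\<alpha>' \<beta>'. \<Sum>a<n. \<Sum>e<n. ?Q \<alpha> \<beta> \<alpha>' \<beta>' a c d e) v) u"
      if "c < n" "d < n" for c d
    proof -
      have "closed_sum n v (\<lambda>m'. ?D (s, c, d) m m') =
          deletion_sum (s, c, d) (\<lambda>m. \<Sum>e<n. path_sum n v e e (deletion_sum (\<not> s, d, c) (\<lambda>m'. wick (m @ m')))) m" for m
        by (simp add: closed_sum_def deletion_sum_sum deletion_sum_path_sum)
      then show ?thesis
        using that
        by (simp add: closed_sum_def path_sum_deletion_sum path_sum_sum split_sum_path_sum split_sum_sum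
            flip: append_assoc)
    qed
    then have "(\<Sum>c<n. \<Sum>d<n. closed_sum n u (\<lambda>m. closed_sum n v (\<lambda>m'. ?D (s, c, d) m m'))) =
        split_sum s (\<lambda>\<alpha> \<beta>. split_sum (\<not> s) (\<lambda>\<alpha>' \<beta>'. \<Sum>c<n. \<Sum>d<n. \<Sum>a<n. \<Sum>e<n. ?Q \<alpha> \<beta> \<alpha>' \<beta>' a c d e) v) u"
      by (simp add: split_sum_sum)
    also have "(\<lambda>\<alpha> \<beta> \<alpha>' \<beta>'. \<Sum>c<n. \<Sum>d<n. \<Sum>a<n. \<Sum>e<n. ?Q \<alpha> \<beta> \<alpha>' \<beta>' a c d e) =
        (\<lambda>\<alpha> \<beta> \<alpha>' \<beta>'. wick_trace n (\<beta> @ \<alpha> @ \<beta>' @ \<alpha>'))"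
    proof (intro ext)
      fix \<alpha> \<beta> \<alpha>' \<beta>'
      have "wick_trace n (\<beta> @ \<alpha> @ \<beta>' @ \<alpha>') = (\<Sum>d<n. \<Sum>a<n. \<Sum>c<n. \<Sum>e<n. path_sum n \<beta> d a (\<lambda>p'. path_sum n \<alpha> a c (\<lambda>p.
          path_sum n \<beta>' c e (\<lambda>q'. path_sum n \<alpha>' e d (\<lambda>q. wick (p' @ p @ q' @ q))))))"
        by (simp add: wick_trace_def closed_sum_def path_sum_append path_sum_sum)
      also have "\<dots> = (\<Sum>d<n. \<Sum>a<n. \<Sum>c<n. \<Sum>e<n. ?Q \<alpha> \<beta> \<alpha>' \<beta>' a c d e)"
      proof (intro sum.cong refl)
        fix d a c e assume *: "d \<in> {..<n}" "a \<in> {..<n}" "c \<in> {..<n}" "e \<in> {..<n}"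
        have "path_sum n \<beta> d a (\<lambda>p'. path_sum n \<alpha> a c (\<lambda>p.
          path_sum n \<beta>' c e (\<lambda>q'. path_sum n \<alpha>' e d (\<lambda>q. wick (p' @ p @ q' @ q))))) =
          path_sum n \<beta> d a (\<lambda>p'. path_sum n \<alpha> a c (\<lambda>p.
          path_sum n \<beta>' c e (\<lambda>q'. path_sum n \<alpha>' e d (\<lambda>q. wick (p @ p' @ q @ q')))))"
          using * by (intro path_sum_cong wick_mset) auto
        also have "\<dots> = ?Q \<alpha> \<beta> \<alpha>' \<beta>' a c d e"
          by (subst path_sum_commute, subst (2) path_sum_commute) (rule refl)
        finally show "path_sum n \<beta> d a (\<lambda>p'. path_sum n \<alpha> a c (\<lambda>p.
          path_sum n \<beta>' c e (\<lambda>q'. path_sum n \<alpha>' e d (\<lambda>q. wick (p' @ p @ q' @ q))))) = ?Q \<alpha> \<beta> \<alpha>' \<beta>' a c d e" .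
      qed
      also have "\<dots> = (\<Sum>c<n. \<Sum>d<n. \<Sum>a<n. \<Sum>e<n. ?Q \<alpha> \<beta> \<alpha>' \<beta>' a c d e)"
      proof -
        have "(\<Sum>d<n. \<Sum>a<n. \<Sum>c<n. \<Sum>e<n. ?Q \<alpha> \<beta> \<alpha>' \<beta>' a c d e) = (\<Sum>d<n. \<Sum>c<n. \<Sum>a<n. \<Sum>e<n. ?Q \<alpha> \<beta> \<alpha>' \<beta>' a c d e)"
          by (intro sum.cong refl sum.swap)
        also have "\<dots> = (\<Sum>c<n. \<Sum>d<n. \<Sum>a<n. \<Sum>e<n. ?Q \<alpha> \<beta> \<alpha>' \<beta>' a c d e)"
          by (rule sum.swap)
        finally show ?thesis .
      qed
      finally show "(\<Sum>c<n. \<Sum>d<n. \<Sum>a<n. \<Sum>e<n. ?Q \<alpha> \<beta> \<alpha>' \<beta>' a c d e) = wick_trace n (\<beta> @ \<alpha> @ \<beta>' @ \<alpha>')"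
        by simp
    qed
    finally show "(\<Sum>c<n. \<Sum>d<n. closed_sum n u (\<lambda>m. closed_sum n v (\<lambda>m'. ?D (s, c, d) m m'))) =
      split_sum s (\<lambda>\<alpha> \<beta>. split_sum (\<not> s) (\<lambda>\<alpha>' \<beta>'. wick_trace n (\<beta> @ \<alpha> @ \<beta>' @ \<alpha>')) v) u" .
  qed
  finally show ?thesis .
qed

section \<open>Normalized trace moments\<close>

text \<open>
  Normalization for \<open>Y = n^(-1/2) G\<close> and for the normalized trace.
\<close>
definition trace_moment :: "nat \<Rightarrow> bool list \<Rightarrow> real" where
  "trace_moment n w = wick_trace n w / (real n * sqrt n ^ length w)"

definition trace_moment2 :: "nat \<Rightarrow> bool list \<Rightarrow> bool list \<Rightarrow> real" where
  "trace_moment2 n u v = wick_trace2 n u v / (real n ^ 2 * sqrt n ^ (length u + length v))"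

text \<open>
  An upper bound for \<open>n^2\<close> times the covariance of two normalized traces.
\<close>
definition merge_sum :: "nat \<Rightarrow> bool list \<Rightarrow> bool list \<Rightarrow> real" where
  "merge_sum n u v = (\<Sum>s\<in>UNIV. split_sum s (\<lambda>\<alpha> \<beta>. split_sum (\<not> s) (\<lambda>\<alpha>' \<beta>'.
     trace_moment n (\<beta> @ \<alpha> @ \<beta>' @ \<alpha>')) v) u)"

lemma trace_moment_nonneg: "0 \<le> trace_moment n w"
  by (simp add: trace_moment_def wick_trace_nonneg)

lemma trace_moment_Nil: "1 \<le> n \<Longrightarrow> trace_moment n [] = 1"
  by (simp add: trace_moment_def wick_trace_Nil)

lemma trace_moment_rotate: "trace_moment n (u @ v) = trace_moment n (v @ u)"
  by (simp add: trace_moment_def wick_trace_rotate[of n u v] add.commute)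

lemma trace_moment_unbalanced:
  "count_list w True \<noteq> count_list w False \<Longrightarrow> trace_moment n w = 0"
  by (simp add: trace_moment_def wick_trace_unbalanced)

lemma trace_moment_Cons:
  assumes "1 \<le> n"
  shows "trace_moment n (s # w) = split_sum (\<not> s) (trace_moment2 n) w"
proof -
  have "split_sum (\<not> s) (trace_moment2 n) w =
      split_sum (\<not> s) (\<lambda>u v. 1 / (real n * sqrt n ^ length (s # w)) * wick_trace2 n u v) w"
  proof (rule split_sum_cong)
    fix u v assume "w = u @ (\<not> s) # v"
    then show "trace_moment2 n u v = 1 / (real n * sqrt n ^ length (s # w)) * wick_trace2 n u v"
      by (simp add: trace_moment2_def power_add power2_eq_square mult.assoc[symmetric])
  qed
  then show ?thesis
    by (simp only: trace_moment_def wick_trace_Cons split_sum_cmult) simp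
qed

lemma trace_moment2_ge:
  "trace_moment n u * trace_moment n v \<le> trace_moment2 n u v"
proof -
  have "trace_moment n u * trace_moment n v =
      wick_trace n u * wick_trace n v / (real n ^ 2 * sqrt n ^ (length u + length v))"
    by (simp add: trace_moment_def power_add power2_eq_square mult_ac)
  also have "\<dots> \<le> trace_moment2 n u v"
    unfolding trace_moment2_def by (intro divide_right_mono wick_trace2_ge) auto
  finally show ?thesis .
qed

text \<open>
  The gain \<open>n^(-2)\<close>: a contraction removes two letters, worth one factor \<open>n\<close>, and turns two
  normalized traces into one, worth another.
\<close>
lemma trace_moment2_le:
  assumes "1 \<le> n"
  shows "trace_moment2 n u v \<le> trace_moment n u * trace_moment n v + merge_sum n u v / real n ^ 2"
proof -
  let ?d = "real n ^ 2 * sqrt n ^ (length u + length v)"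
  have n: "0 < real n" "sqrt (real n) * sqrt (real n) = real n" using assms by auto
  have "merge_sum n u v / real n ^ 2 =
    (\<Sum>s\<in>UNIV. split_sum s (\<lambda>\<alpha> \<beta>. split_sum (\<not> s) (\<lambda>\<alpha>' \<beta>'.
       1 / real n ^ 2 * trace_moment n (\<beta> @ \<alpha> @ \<beta>' @ \<alpha>')) v) u)"
    unfolding merge_sum_def by (simp only: split_sum_cmult sum_distrib_left[symmetric]) simp
  also have "\<dots> = (\<Sum>s\<in>UNIV. split_sum s (\<lambda>\<alpha> \<beta>. split_sum (\<not> s) (\<lambda>\<alpha>' \<beta>'.
       1 / ?d * wick_trace n (\<beta> @ \<alpha> @ \<beta>' @ \<alpha>')) v) u)"
  proof (intro sum.cong refl split_sum_cong)
    fix s \<alpha> \<beta> \<alpha>' \<beta>' assume "u = \<alpha> @ s # \<beta>" "v = \<alpha>' @ (\<not> s) # \<beta>'"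
    then have d: "?d = real n ^ 2 * (real n * sqrt n ^ length (\<beta> @ \<alpha> @ \<beta>' @ \<alpha>'))"
      using n by (simp add: power_add mult_ac)
    show "1 / real n ^ 2 * trace_moment n (\<beta> @ \<alpha> @ \<beta>' @ \<alpha>') = 1 / ?d * wick_trace n (\<beta> @ \<alpha> @ \<beta>' @ \<alpha>')"
      by (simp only: d trace_moment_def) simp
  qed
  also have "\<dots> = (\<Sum>s\<in>UNIV. split_sum s (\<lambda>\<alpha> \<beta>. split_sum (\<not> s) (\<lambda>\<alpha>' \<beta>'.
       wick_trace n (\<beta> @ \<alpha> @ \<beta>' @ \<alpha>')) v) u) / ?d" (is "_ = ?S / ?d")
    by (simp only: split_sum_cmult sum_distrib_left[symmetric]) simp
  finally have S: "merge_sum n u v / real n ^ 2 = ?S / ?d" .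
  have "trace_moment2 n u v \<le> (wick_trace n u * wick_trace n v + ?S) / ?d"
    unfolding trace_moment2_def by (intro divide_right_mono wick_trace2_le) auto
  also have "\<dots> = trace_moment n u * trace_moment n v + ?S / ?d"
    by (simp add: trace_moment_def add_divide_distrib power_add power2_eq_square mult_ac)
  finally show ?thesis unfolding S .
qed

lemma merge_sum_le:
  assumes "\<And>s \<alpha> \<beta> \<alpha>' \<beta>'. u = \<alpha> @ s # \<beta> \<Longrightarrow> v = \<alpha>' @ (\<not> s) # \<beta>' \<Longrightarrow>
     trace_moment n (\<beta> @ \<alpha> @ \<beta>' @ \<alpha>') \<le> B" "0 \<le> B"
  shows "merge_sum n u v \<le> 2 * real (length u) * real (length v) * B"
proof -
  have "merge_sum n u v \<le> (\<Sum>s\<in>(UNIV :: bool set). real (length u) * (real (length v) * B))"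
    unfolding merge_sum_def
    by (intro sum_mono split_sum_le assms(1)) (use assms(2) in auto)
  then show ?thesis by (simp add: UNIV_bool)
qed

section \<open>Words composed of powers\<close>

text \<open>
  Words with \<open>r\<close> full blocks, of length \<open>k\<close>, and \<open>p\<close> short ones. A full block has norm
  \<open>\<parallel>Y^k\<parallel>\<close>, whereas for a short one only a power of \<open>\<parallel>Y\<parallel>\<close> is at hand, which is too large by an
  exponential factor unless the number of short blocks is bounded.
\<close>
inductive block_word :: "nat \<Rightarrow> nat \<Rightarrow> nat \<Rightarrow> bool list \<Rightarrow> bool" for k where
  block_Nil: "block_word k 0 0 []"
| block_full: "block_word k r p w \<Longrightarrow> block_word k (Suc r) p (replicate k s @ w)"
| block_short: "i < k \<Longrightarrow> block_word k r p w \<Longrightarrow> block_word k r (Suc p) (replicate i s @ w)"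

lemma block_word_append:
  "block_word k r p u \<Longrightarrow> block_word k r' p' v \<Longrightarrow> block_word k (r + r') (p + p') (u @ v)"
  by (induction rule: block_word.induct) (auto intro: block_word.intros)

lemma block_word_full: "block_word k 1 0 (replicate k s)"
  using block_full[OF block_Nil, of k s] by simp

lemma block_word_short: "i < k \<Longrightarrow> block_word k 0 1 (replicate i s)"
  using block_short[OF _ block_Nil, of i k s] by simp

lemma replicate_append_eq_split:
  assumes "replicate i s' @ w = \<alpha> @ s # \<beta>"
  shows "(\<exists>\<alpha>'. \<alpha> = replicate i s' @ \<alpha>' \<and> w = \<alpha>' @ s # \<beta>) \<or>
         (\<exists>i1 i2. i1 < i \<and> i2 < i \<and> \<alpha> = replicate i1 s' \<and> \<beta> = replicate i2 s' @ w)"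
  using assms
proof (induction i arbitrary: \<alpha>)
  case (Suc i)
  show ?case
  proof (cases \<alpha>)
    case Nil
    then have "0 < Suc i \<and> i < Suc i \<and> \<alpha> = replicate 0 s' \<and> \<beta> = replicate i s' @ w" using Suc.prems by auto
    then show ?thesis by blast
  next
    case (Cons x \<alpha>0)
    then have x: "x = s'" and eq: "replicate i s' @ w = \<alpha>0 @ s # \<beta>" using Suc.prems by auto
    from Suc.IH[OF eq] show ?thesis
    proof (elim disjE exE conjE)
      fix \<alpha>' assume "\<alpha>0 = replicate i s' @ \<alpha>'" "w = \<alpha>' @ s # \<beta>"
      then show ?thesis using Cons x by auto
    next
      fix i1 i2 assume "i1 < i" "i2 < i" "\<alpha>0 = replicate i1 s'" "\<beta> = replicate i2 s' @ w"
      then have "Suc i1 < Suc i \<and> i2 < Suc i \<and> \<alpha> = replicate (Suc i1) s' \<and> \<beta> = replicate i2 s' @ w"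
        using Cons x by simp
      then show ?thesis by blast
    qed
  qed
qed simp

text \<open>
  Removing a letter destroys one block and leaves at most two short ones.
\<close>
lemma block_word_split:
  assumes "block_word k r p w" "w = \<alpha> @ s # \<beta>"
  obtains r1 p1 r2 p2 where "block_word k r1 p1 \<alpha>" "block_word k r2 p2 \<beta>"
    "r1 + r2 \<le> r" "p1 + p2 \<le> p + 2"
proof -
  have "\<exists>r1 p1 r2 p2. block_word k r1 p1 \<alpha> \<and> block_word k r2 p2 \<beta> \<and> r1 + r2 \<le> r \<and> p1 + p2 \<le> p + 2"
    using assms
  proof (induction arbitrary: \<alpha> rule: block_word.induct)
    case (block_full r p w s')
    from replicate_append_eq_split[OF block_full.prems] show ?case
    proof (elim disjE exE conjE)
      fix \<alpha>' assume *: "\<alpha> = replicate k s' @ \<alpha>'" "w = \<alpha>' @ s # \<beta>"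
      from block_full.IH[OF *(2)] obtain r1 p1 r2 p2 where
        "block_word k r1 p1 \<alpha>'" "block_word k r2 p2 \<beta>" "r1 + r2 \<le> r" "p1 + p2 \<le> p + 2" by blast
      then show ?thesis using *
        by (intro exI[of _ "Suc r1"] exI[of _ p1] exI[of _ r2] exI[of _ p2]) (auto intro: block_word.intros)
    next
      fix i1 i2 assume "i1 < k" "i2 < k" "\<alpha> = replicate i1 s'" "\<beta> = replicate i2 s' @ w"
      then have "block_word k 0 1 \<alpha> \<and> block_word k r (Suc p) \<beta> \<and> 0 + r \<le> Suc r \<and> 1 + Suc p \<le> p + 2"
        using block_full.hyps by (auto intro: block_word.block_short block_word_short[simplified])
      then show ?thesis by blast
    qed
  next
    case (block_short i r p w s')
    from replicate_append_eq_split[OF block_short.prems] show ?case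
    proof (elim disjE exE conjE)
      fix \<alpha>' assume *: "\<alpha> = replicate i s' @ \<alpha>'" "w = \<alpha>' @ s # \<beta>"
      from block_short.IH[OF *(2)] obtain r1 p1 r2 p2 where
        "block_word k r1 p1 \<alpha>'" "block_word k r2 p2 \<beta>" "r1 + r2 \<le> r" "p1 + p2 \<le> p + 2" by blast
      then show ?thesis using * block_short.hyps
        by (intro exI[of _ r1] exI[of _ "Suc p1"] exI[of _ r2] exI[of _ p2]) (auto intro: block_word.intros)
    next
      fix i1 i2 assume "i1 < i" "i2 < i" "\<alpha> = replicate i1 s'" "\<beta> = replicate i2 s' @ w"
      then have "block_word k 0 1 \<alpha> \<and> block_word k r (Suc p) \<beta> \<and> 0 + r \<le> r \<and> 1 + Suc p \<le> Suc p + 2"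
        using block_short.hyps by (auto intro: block_word.block_short block_word_short[simplified])
      then show ?thesis by blast
    qed
  qed simp
  then show ?thesis using that by blast
qed

text \<open>
  With \<open>True\<close> for \<open>Y\<close> and \<open>False\<close> for its adjoint, \<open>periods k a\<close> is the word \<open>(Y*^k Y^k)^a\<close>. The
  words \<open>Y^j (Y*^k Y^k)^a Y*^j\<close> for \<open>j \<le> k\<close> are the ones that occur when it is cut repeatedly.
\<close>
definition periods :: "nat \<Rightarrow> nat \<Rightarrow> bool list" where
  "periods k a = concat (replicate a (replicate k False @ replicate k True))"

definition fuss_word :: "nat \<Rightarrow> nat \<Rightarrow> nat \<Rightarrow> bool list" where
  "fuss_word k j a = replicate j True @ periods k a @ replicate j False"

lemma periods_0 [simp]: "periods k 0 = []"
  and periods_Suc: "periods k (Suc a) = replicate k False @ replicate k True @ periods k a"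
  by (simp_all add: periods_def)

lemma fuss_word_0: "fuss_word k 0 a = periods k a"
  by (simp add: fuss_word_def)

lemma length_periods: "length (periods k a) = 2 * (k * a)"
  by (induction a) (auto simp: periods_Suc)

lemma count_list_periods: "count_list (periods k a) s = k * a"
proof -
  have "count_list (replicate i t) s = (if s = t then i else 0)" for i t by (induction i) auto
  then show ?thesis by (induction a) (auto simp: periods_Suc)
qed

lemma block_word_periods: "block_word k (2 * a) 0 (periods k a)"
proof (induction a)
  case (Suc a)
  then have "block_word k (Suc (Suc (2 * a))) 0 (replicate k False @ replicate k True @ periods k a)"
    by (intro block_full)
  then show ?case by (simp add: periods_Suc)
qed (auto intro: block_Nil)

text \<open>
  This closes the recursion on \<open>j\<close>: up to rotation \<open>Y^k (Y*^k Y^k)^a Y*^k\<close> is \<open>(Y*^k Y^k)^(a+1)\<close>.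
\<close>
lemma trace_moment_fuss_word_last:
  "trace_moment n (fuss_word k k a) = trace_moment n (fuss_word k 0 (Suc a))"
proof -
  have "trace_moment n ((replicate k True @ periods k a) @ replicate k False) =
        trace_moment n (replicate k False @ (replicate k True @ periods k a))"
    by (rule trace_moment_rotate)
  then show ?thesis by (simp add: fuss_word_def periods_Suc)
qed

lemma split_sum_periods:
  "split_sum False F (periods k a) =
    (\<Sum>b<a. \<Sum>i<k. F (periods k b @ replicate i False)
        (replicate (k - 1 - i) False @ replicate k True @ periods k (a - 1 - b)))"
proof (induction a arbitrary: F)
  case (Suc a)
  show ?case
    unfolding sum.lessThan_Suc_shift periods_Suc split_sum_append Suc.IH
    by (simp add: split_sum_replicate split_sum_replicate_other)
qed simp

lemma split_sum_fuss_word: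
  "split_sum False F (replicate (j - 1) True @ periods k a @ replicate j False) =
    (\<Sum>b<a. \<Sum>i<k. F (replicate (j - 1) True @ periods k b @ replicate i False)
        (replicate (k - 1 - i) False @ replicate k True @ periods k (a - 1 - b) @ replicate j False)) +
    (\<Sum>i<j. F (replicate (j - 1) True @ periods k a @ replicate i False) (replicate (j - 1 - i) False))"
  by (simp add: split_sum_append split_sum_periods split_sum_replicate split_sum_replicate_other)

text \<open>
  Of the \<open>k\<close> adjoint letters in a block only one leaves as many letters \<open>Y\<close> as \<open>Y*\<close> in the first
  piece. For it the first piece is again one of the words considered, and the second is a rotation
  of a power of \<open>Y*^k Y^k\<close>; all other pieces have moment zero.
\<close>
lemma sum_trace_moment_fuss_word:
  assumes "1 \<le> n" "1 \<le> j" "j \<le> k"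
  shows "split_sum False (\<lambda>u v. trace_moment n u * trace_moment n v)
      (replicate (j - 1) True @ periods k a @ replicate j False) =
    (\<Sum>b\<le>a. trace_moment n (fuss_word k (j - 1) b) * trace_moment n (fuss_word k 0 (a - b)))"
proof -
  let ?t = "trace_moment n"
  have zero: "?t (replicate (j - 1) True @ periods k b @ replicate i False) = 0" if "i \<noteq> j - 1" for b i
  proof (rule trace_moment_unbalanced)
    have "count_list (replicate i t) s = (if s = t then i else 0)" for i and s t :: bool by (induction i) auto
    then show "count_list (replicate (j - 1) True @ periods k b @ replicate i False) True \<noteq>
      count_list (replicate (j - 1) True @ periods k b @ replicate i False) False"
      using that by (simp add: count_list_periods)
  qed
  have rot: "?t (replicate (k - 1 - (j - 1)) False @ replicate k True @ periods k (a - 1 - b) @ replicate j False) =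
      ?t (fuss_word k 0 (a - b))" if "b < a" for b
  proof -
    have "?t ((replicate (k - j) False @ replicate k True @ periods k (a - 1 - b)) @ replicate j False) =
      ?t (replicate j False @ replicate (k - j) False @ replicate k True @ periods k (a - 1 - b))"
      by (rule trace_moment_rotate)
    also have "replicate j False @ replicate (k - j) False @ replicate k True @ periods k (a - 1 - b) =
       periods k (Suc (a - 1 - b))"
      using assms by (simp add: periods_Suc flip: append_assoc replicate_add)
    also have "Suc (a - 1 - b) = a - b" using that by simp
    finally show ?thesis using assms by (simp add: fuss_word_0)
  qed
  have A: "(\<Sum>i<k. ?t (replicate (j - 1) True @ periods k b @ replicate i False) *
        ?t (replicate (k - 1 - i) False @ replicate k True @ periods k (a - 1 - b) @ replicate j False)) =
      ?t (fuss_word k (j - 1) b) * ?t (fuss_word k 0 (a - b))" if "b < a" for b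
  proof -
    have "(\<Sum>i<k. ?t (replicate (j - 1) True @ periods k b @ replicate i False) *
        ?t (replicate (k - 1 - i) False @ replicate k True @ periods k (a - 1 - b) @ replicate j False)) =
       (\<Sum>i\<in>{j - 1}. ?t (replicate (j - 1) True @ periods k b @ replicate i False) *
        ?t (replicate (k - 1 - i) False @ replicate k True @ periods k (a - 1 - b) @ replicate j False))"
      using assms zero by (intro sum.mono_neutral_right) auto
    then show ?thesis using rot[OF that] by (simp add: fuss_word_def)
  qed
  have B: "(\<Sum>i<j. ?t (replicate (j - 1) True @ periods k a @ replicate i False) * ?t (replicate (j - 1 - i) False)) =
      ?t (fuss_word k (j - 1) a)"
  proof -
    have "(\<Sum>i<j. ?t (replicate (j - 1) True @ periods k a @ replicate i False) * ?t (replicate (j - 1 - i) False)) =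
      (\<Sum>i\<in>{j - 1}. ?t (replicate (j - 1) True @ periods k a @ replicate i False) * ?t (replicate (j - 1 - i) False))"
      using assms zero by (intro sum.mono_neutral_right) auto
    then show ?thesis using assms by (simp add: fuss_word_def trace_moment_Nil)
  qed
  show ?thesis
    unfolding split_sum_fuss_word B lessThan_Suc_atMost[symmetric] sum.lessThan_Suc
  proof (intro arg_cong2[of _ _ _ _ plus] sum.cong refl)
    fix b assume "b \<in> {..<a}"
    then show "(\<Sum>i<k. ?t (replicate (j - 1) True @ periods k b @ replicate i False) *
        ?t (replicate (k - 1 - i) False @ replicate k True @ periods k (a - 1 - b) @ replicate j False)) =
      ?t (fuss_word k (j - 1) b) * ?t (fuss_word k 0 (a - b))"
      by (intro A) simp
  qed (use assms in \<open>simp add: fuss_word_0 trace_moment_Nil\<close>)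
qed

text \<open>
  The Fuss-Catalan recursion as an inequality, exact up to covariances.
\<close>
lemma trace_moment_fuss_word_ge:
  assumes "1 \<le> n" "1 \<le> j" "j \<le> k"
  shows "(\<Sum>b\<le>a. trace_moment n (fuss_word k (j - 1) b) * trace_moment n (fuss_word k 0 (a - b)))
    \<le> trace_moment n (fuss_word k j a)"
proof -
  have "fuss_word k j a = True # replicate (j - 1) True @ periods k a @ replicate j False"
    using assms by (cases j) (auto simp: fuss_word_def)
  then show ?thesis
    using assms unfolding sum_trace_moment_fuss_word[OF assms, symmetric]
    by (auto simp: trace_moment_Cons intro!: split_sum_mono trace_moment2_ge)
qed

text \<open>
  The words that enter the covariances arise from \<open>Y^j (Y*^k Y^k)^a Y*^j\<close> by removing four letters:
  the first one, its partner, and a contracted pair. Removing the first two leaves at most four short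
  blocks in the two pieces, and each letter of the pair adds at most two more. Removing the first
  letter and its partner also ensures that at most \<open>2 a\<close> blocks are full, even if \<open>j = k\<close>.
\<close>
lemma trace_moment_fuss_word_le:
  assumes "1 \<le> n" "1 \<le> j" "j \<le> k" "0 \<le> B"
    and B: "\<And>v r p. block_word k r p v \<Longrightarrow> r \<le> 2 * a \<Longrightarrow> p \<le> 8 \<Longrightarrow> trace_moment n v \<le> B"
  shows "trace_moment n (fuss_word k j a) \<le>
    (\<Sum>b\<le>a. trace_moment n (fuss_word k (j - 1) b) * trace_moment n (fuss_word k 0 (a - b))) +
    8 * real (k * (a + 1)) ^ 3 * B / real n ^ 2"
proof -
  let ?w = "replicate (j - 1) True @ periods k a @ replicate j False"
  let ?E = "8 * real (k * (a + 1)) ^ 2 * B"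
  have k: "k > 0" using assms by auto
  have merge: "merge_sum n u v \<le> ?E"
    if u: "block_word k r p u" and v: "block_word k r' p' v" and le: "r + r' \<le> 2 * a" "p + p' \<le> 4"
       and len: "length u \<le> 2 * (k * (a + 1))" "length v \<le> 2 * (k * (a + 1))" for u v r r' p p'
  proof -
    have "merge_sum n u v \<le> 2 * real (length u) * real (length v) * B"
    proof (rule merge_sum_le)
      fix s \<alpha> \<beta> \<alpha>' \<beta>' assume eq: "u = \<alpha> @ s # \<beta>" "v = \<alpha>' @ (\<not> s) # \<beta>'"
      obtain r1 p1 r2 p2 where 1: "block_word k r1 p1 \<alpha>" "block_word k r2 p2 \<beta>" "r1 + r2 \<le> r" "p1 + p2 \<le> p + 2"
        using block_word_split[OF u eq(1)] .
      obtain r3 p3 r4 p4 where 2: "block_word k r3 p3 \<alpha>'" "block_word k r4 p4 \<beta>'" "r3 + r4 \<le> r'" "p3 + p4 \<le> p' + 2"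
        using block_word_split[OF v eq(2)] .
      have "block_word k (r2 + (r1 + (r4 + r3))) (p2 + (p1 + (p4 + p3))) (\<beta> @ \<alpha> @ \<beta>' @ \<alpha>')"
        using 1 2 by (intro block_word_append)
      then show "trace_moment n (\<beta> @ \<alpha> @ \<beta>' @ \<alpha>') \<le> B"
        by (rule B) (use 1 2 le in linarith)+
    qed fact
    also have "\<dots> \<le> 2 * (2 * real (k * (a + 1))) * (2 * real (k * (a + 1))) * B"
      using len assms(4) by (intro mult_right_mono mult_mono mult_left_mono) (auto simp flip: of_nat_mult)
    also have "2 * (2 * x) * (2 * x) * B = 8 * x ^ 2 * B" for x :: real
      by (simp add: power2_eq_square)
    finally show ?thesis .
  qed
  have short: "block_word k 0 1 (replicate i s)" if "i < k" for i s
    using that by (rule block_word_short)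
  have first: "block_word k (2 * b) 2 (replicate (j - 1) True @ periods k b @ replicate i False)" if "i < k" for b i
    using block_word_append[OF short[of "j - 1" True] block_word_append[OF block_word_periods[of k b] short[OF that, of False]]]
      assms k by (simp add: numeral_2_eq_2)
  \<comment> \<open>The last block is full if \<open>j = k\<close> and short otherwise.\<close>
  have "\<exists>r p. block_word k r p (replicate j False) \<and> r + p \<le> 1"
    using assms(3) block_word_full[of k False] short[of j False] by (cases "j = k") fastforce+
  then obtain rj pj where j: "block_word k rj pj (replicate j False)" "rj + pj \<le> 1" by blast
  have second: "block_word k (1 + (2 * c + rj)) (1 + pj)
      (replicate (k - 1 - i) False @ replicate k True @ periods k c @ replicate j False)" if "i < k" for c i
    using block_word_append[OF short[of "k - 1 - i" False] block_word_append[OF block_word_full[of k True]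
        block_word_append[OF block_word_periods[of k c] j(1)]]] that by simp
  have "fuss_word k j a = True # ?w"
    using assms by (cases j) (auto simp: fuss_word_def)
  then have "trace_moment n (fuss_word k j a) \<le>
      split_sum False (\<lambda>u v. trace_moment n u * trace_moment n v + 1 / real n ^ 2 * merge_sum n u v) ?w"
    using assms by (auto simp: trace_moment_Cons intro!: split_sum_mono order_trans[OF trace_moment2_le])
  also have "\<dots> = (\<Sum>b\<le>a. trace_moment n (fuss_word k (j - 1) b) * trace_moment n (fuss_word k 0 (a - b))) +
      1 / real n ^ 2 * split_sum False (merge_sum n) ?w"
    using sum_trace_moment_fuss_word[OF assms(1-3)] by (simp only: split_sum_add split_sum_cmult)
  also have "split_sum False (merge_sum n) ?w \<le> (\<Sum>b<a. \<Sum>i<k. ?E) + (\<Sum>i<j. ?E)"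
    unfolding split_sum_fuss_word
  proof (intro add_mono sum_mono)
    fix b i assume bi: "b \<in> {..<a}" "i \<in> {..<k}"
    have "k * (a - 1 - b) + k = k * (a - 1 - b + 1)" by simp
    also have "\<dots> \<le> k * a" using bi by (intro mult_le_mono2) auto
    finally have kb: "k * (a - 1 - b) + k \<le> k * a" .
    have kb': "k * b \<le> k * a" using bi by simp
    have ka: "k * (a + 1) = k * a + k" by simp
    show "merge_sum n (replicate (j - 1) True @ periods k b @ replicate i False)
       (replicate (k - 1 - i) False @ replicate k True @ periods k (a - 1 - b) @ replicate j False) \<le> ?E"
    proof (rule merge[OF first[of i b] second[of i "a - 1 - b"]])
      show "length (replicate (j - 1) True @ periods k b @ replicate i False) \<le> 2 * (k * (a + 1))"
      proof -
        have "j - 1 + (2 * x + i) \<le> 2 * (y + k)" if "x \<le> y" for x y :: nat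
          using that bi(2) assms(3) by simp
        from this[OF kb'] show ?thesis
          by (simp only: length_append length_replicate length_periods ka)
      qed
      show "length (replicate (k - 1 - i) False @ replicate k True @ periods k (a - 1 - b) @ replicate j False)
          \<le> 2 * (k * (a + 1))"
        unfolding length_append length_replicate length_periods ka using bi assms(3) kb by auto
    qed (use bi j(2) in auto)
  next
    fix i assume i: "i \<in> {..<j}"
    then show "merge_sum n (replicate (j - 1) True @ periods k a @ replicate i False) (replicate (j - 1 - i) False) \<le> ?E"
      using assms by (intro merge[OF first[of i a] short[of "j - 1 - i" False]])
        (auto simp: length_periods algebra_simps)
  qed
  also have "\<dots> = real (a * k + j) * ?E" by (simp add: algebra_simps)
  also have "\<dots> \<le> real (k * (a + 1)) * ?E"
    using assms by (intro mult_right_mono) (auto simp: algebra_simps)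
  also have "\<dots> = 8 * real (k * (a + 1)) ^ 3 * B"
    by (simp add: power2_eq_square power3_eq_cube)
  finally show ?thesis using assms by (simp add: mult_left_mono divide_right_mono)
qed

section \<open>Operator norms and traces of matrix words\<close>

definition adjoint_mat :: "complex mat \<Rightarrow> complex mat" where
  "adjoint_mat A = mat (dim_col A) (dim_row A) (\<lambda>(i, j). cnj (A $$ (j, i)))"

definition hdot :: "complex vec \<Rightarrow> complex vec \<Rightarrow> complex" where
  "hdot u v = (\<Sum>i<dim_vec u. u $ i * cnj (v $ i))"

definition mat_trace :: "complex mat \<Rightarrow> complex" where
  "mat_trace A = (\<Sum>i<dim_row A. A $$ (i, i))"

lemma adjoint_mat_carrier [simp, intro]: "A \<in> carrier_mat n m \<Longrightarrow> adjoint_mat A \<in> carrier_mat m n"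
  by (auto simp: adjoint_mat_def)

lemma adjoint_mat_adjoint_mat [simp]: "adjoint_mat (adjoint_mat A) = A"
  by (auto simp: adjoint_mat_def)

lemma mult_mat_vec_index:
  assumes "A \<in> carrier_mat n m" "v \<in> carrier_vec m" "i < n"
  shows "(A *\<^sub>v v) $ i = (\<Sum>j<m. A $$ (i, j) * v $ j)"
  using assms by (auto simp: scalar_prod_def lessThan_atLeast0)

lemma mult_mat_index:
  assumes "A \<in> carrier_mat n m" "B \<in> carrier_mat m p" "i < n" "j < p"
  shows "(A * B) $$ (i, j) = (\<Sum>k<m. A $$ (i, k) * B $$ (k, j))"
  using assms by (auto simp: scalar_prod_def lessThan_atLeast0)

lemma hdot_adjoint:
  assumes "A \<in> carrier_mat n m" "u \<in> carrier_vec m" "v \<in> carrier_vec n"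
  shows "hdot (A *\<^sub>v u) v = hdot u (adjoint_mat A *\<^sub>v v)"
proof -
  have "hdot (A *\<^sub>v u) v = (\<Sum>i<n. \<Sum>j<m. A $$ (i, j) * u $ j * cnj (v $ i))"
    using assms by (auto simp: hdot_def mult_mat_vec_index[of A n m] sum_distrib_right
        simp del: index_mult_mat_vec intro!: sum.cong)
  also have "\<dots> = (\<Sum>j<m. \<Sum>i<n. A $$ (i, j) * u $ j * cnj (v $ i))"
    by (rule sum.swap)
  also have "\<dots> = hdot u (adjoint_mat A *\<^sub>v v)"
    using assms mult_mat_vec_index[of "adjoint_mat A" m n v]
    by (auto simp: hdot_def adjoint_mat_def sum_distrib_left mult_ac
        simp del: index_mult_mat_vec intro!: sum.cong)
  finally show ?thesis .
qed

lemma hdot_self: "hdot u u = of_real (euclidean_norm_vec u ^ 2)"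
  by (simp add: hdot_def euclidean_norm_vec_def L2_set_def sum_nonneg complex_mult_cnj cmod_power2)

lemma norm_hdot_le:
  assumes "dim_vec u = dim_vec v"
  shows "cmod (hdot u v) \<le> euclidean_norm_vec u * euclidean_norm_vec v"
proof -
  have "cmod (hdot u v) \<le> (\<Sum>i<dim_vec u. \<bar>cmod (u $ i)\<bar> * \<bar>cmod (v $ i)\<bar>)"
    unfolding hdot_def by (rule order_trans[OF norm_sum]) (simp add: norm_mult)
  also have "\<dots> \<le> euclidean_norm_vec u * euclidean_norm_vec v"
    unfolding euclidean_norm_vec_def assms by (rule L2_set_mult_ineq)
  finally show ?thesis .
qed

lemma euclidean_norm_vec_nonneg [simp]: "0 \<le> euclidean_norm_vec v"
  by (simp add: euclidean_norm_vec_def)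

lemma euclidean_norm_vec_smult: "euclidean_norm_vec (c \<cdot>\<^sub>v v) = cmod c * euclidean_norm_vec v"
proof -
  have "euclidean_norm_vec (c \<cdot>\<^sub>v v) = L2_set (\<lambda>i. cmod c * cmod (v $ i)) {..<dim_vec v}"
    unfolding euclidean_norm_vec_def by (intro L2_set_cong) (auto simp: norm_mult)
  then show ?thesis by (simp add: euclidean_norm_vec_def L2_set_right_distrib)
qed

lemma euclidean_norm_vec_eq_0D:
  assumes "euclidean_norm_vec v = 0"
  shows "v = 0\<^sub>v (dim_vec v)"
  using assms by (intro eq_vecI) (auto simp: euclidean_norm_vec_def L2_set_eq_0_iff)

lemma operator_norm_mat_le:
  assumes "\<And>v. v \<in> carrier_vec (dim_col A) \<Longrightarrow> euclidean_norm_vec v \<le> 1 \<Longrightarrow> euclidean_norm_vec (A *\<^sub>v v) \<le> c"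
  shows "operator_norm_mat A \<le> c"
  unfolding operator_norm_mat_def
proof (rule cSUP_least)
  have "0\<^sub>v (dim_col A) \<in> {v \<in> carrier_vec (dim_col A). euclidean_norm_vec v \<le> 1}"
    by (simp add: euclidean_norm_vec_def L2_set_def)
  then show "{v \<in> carrier_vec (dim_col A). euclidean_norm_vec v \<le> 1} \<noteq> {}" by blast
qed (use assms in auto)

lemma euclidean_norm_mult_mat_vec_unit:
  assumes "v \<in> carrier_vec (dim_col A)" "euclidean_norm_vec v \<le> 1"
  shows "euclidean_norm_vec (A *\<^sub>v v) \<le> operator_norm_mat A"
  unfolding operator_norm_mat_def
  by (rule cSUP_upper[OF _ bdd_above_operator_norm_mat]) (use assms in auto)

lemma operator_norm_mat_nonneg: "0 \<le> operator_norm_mat A"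
  using euclidean_norm_mult_mat_vec_unit[of "0\<^sub>v (dim_col A)" A] euclidean_norm_vec_nonneg[of "A *\<^sub>v 0\<^sub>v (dim_col A)"]
  by (simp add: euclidean_norm_vec_def L2_set_def)

lemma euclidean_norm_mult_mat_vec_le:
  assumes "v \<in> carrier_vec (dim_col A)"
  shows "euclidean_norm_vec (A *\<^sub>v v) \<le> operator_norm_mat A * euclidean_norm_vec v"
proof (cases "euclidean_norm_vec v = 0")
  case True
  then have "v = 0\<^sub>v (dim_col A)" using euclidean_norm_vec_eq_0D[OF True] assms by auto
  then have "A *\<^sub>v v = 0\<^sub>v (dim_row A)" by (intro eq_vecI) (auto simp: scalar_prod_def)
  then show ?thesis using True by (simp add: euclidean_norm_vec_def L2_set_def)
next
  case False
  let ?c = "euclidean_norm_vec v"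
  have c: "?c > 0" using False euclidean_norm_vec_nonneg[of v] by linarith
  have "euclidean_norm_vec (A *\<^sub>v (complex_of_real (1 / ?c) \<cdot>\<^sub>v v)) \<le> operator_norm_mat A"
    using assms c by (intro euclidean_norm_mult_mat_vec_unit) (auto simp: euclidean_norm_vec_smult norm_divide)
  also have "A *\<^sub>v (complex_of_real (1 / ?c) \<cdot>\<^sub>v v) = complex_of_real (1 / ?c) \<cdot>\<^sub>v (A *\<^sub>v v)"
    using assms by (intro mult_mat_vec) auto
  finally show ?thesis using c by (simp add: euclidean_norm_vec_smult norm_divide field_simps)
qed

lemma operator_norm_mat_mult_le:
  assumes "A \<in> carrier_mat n m" "B \<in> carrier_mat m p"
  shows "operator_norm_mat (A * B) \<le> operator_norm_mat A * operator_norm_mat B"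
proof (rule operator_norm_mat_le)
  fix v :: "complex vec" assume v: "v \<in> carrier_vec (dim_col (A * B))" "euclidean_norm_vec v \<le> 1"
  have "(A * B) *\<^sub>v v = A *\<^sub>v (B *\<^sub>v v)" using assms v by (intro assoc_mult_mat_vec) auto
  then have "euclidean_norm_vec ((A * B) *\<^sub>v v) \<le> operator_norm_mat A * euclidean_norm_vec (B *\<^sub>v v)"
    using assms v by (auto intro!: euclidean_norm_mult_mat_vec_le)
  also have "\<dots> \<le> operator_norm_mat A * operator_norm_mat B"
    using assms v by (intro mult_left_mono euclidean_norm_mult_mat_vec_unit operator_norm_mat_nonneg) auto
  finally show "euclidean_norm_vec ((A * B) *\<^sub>v v) \<le> operator_norm_mat A * operator_norm_mat B" .
qed

lemma operator_norm_mat_one_le: "operator_norm_mat (1\<^sub>m n) \<le> 1"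
  by (rule operator_norm_mat_le) simp

text \<open>
  With \<open>w = A* v\<close> this is \<open>\<parallel>w\<parallel>^2 = \<langle>A w, v\<rangle> \<le> \<parallel>A\<parallel> \<parallel>w\<parallel> \<parallel>v\<parallel>\<close>.
\<close>
lemma operator_norm_mat_adjoint_le:
  assumes "A \<in> carrier_mat n m"
  shows "operator_norm_mat (adjoint_mat A) \<le> operator_norm_mat A"
proof (rule operator_norm_mat_le)
  fix v :: "complex vec" assume v: "v \<in> carrier_vec (dim_col (adjoint_mat A))" "euclidean_norm_vec v \<le> 1"
  then have v': "v \<in> carrier_vec n" using assms by (auto simp: adjoint_mat_def)
  let ?w = "adjoint_mat A *\<^sub>v v"
  have w: "?w \<in> carrier_vec m" using assms v' by (intro mult_mat_vec_carrier[of _ m n]) auto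
  have "euclidean_norm_vec ?w ^ 2 = cmod (hdot (A *\<^sub>v ?w) v)"
    using hdot_adjoint[OF assms w v'] by (simp add: hdot_self norm_power)
  also have "\<dots> \<le> euclidean_norm_vec (A *\<^sub>v ?w) * euclidean_norm_vec v"
    using assms v' by (intro norm_hdot_le) auto
  also have "\<dots> \<le> operator_norm_mat A * euclidean_norm_vec ?w * 1"
    using assms w v by (intro mult_mono euclidean_norm_mult_mat_vec_le mult_nonneg_nonneg operator_norm_mat_nonneg) auto
  finally show "euclidean_norm_vec ?w \<le> operator_norm_mat A"
    using operator_norm_mat_nonneg[of A] euclidean_norm_vec_nonneg[of ?w]
    by (cases "euclidean_norm_vec ?w = 0") (auto simp: power2_eq_square)
qed

lemma operator_norm_mat_adjoint:
  assumes "A \<in> carrier_mat n m"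
  shows "operator_norm_mat (adjoint_mat A) = operator_norm_mat A"
  using operator_norm_mat_adjoint_le[OF assms] operator_norm_mat_adjoint_le[OF adjoint_mat_carrier[OF assms]]
  by simp

lemma norm_entry_le_operator_norm:
  assumes "A \<in> carrier_mat n m" "i < n" "j < m"
  shows "cmod (A $$ (i, j)) \<le> operator_norm_mat A"
proof -
  have "(A *\<^sub>v unit_vec m j) $ i = A $$ (i, j)" using assms by auto
  then have "cmod (A $$ (i, j)) = cmod ((A *\<^sub>v unit_vec m j) $ i)" by simp
  also have "\<dots> \<le> euclidean_norm_vec (A *\<^sub>v unit_vec m j)"
    unfolding euclidean_norm_vec_def using assms by (intro member_le_L2_set) auto
  also have "\<dots> \<le> operator_norm_mat A"
  proof (rule euclidean_norm_mult_mat_vec_unit)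
    have "euclidean_norm_vec (unit_vec m j) = L2_set (\<lambda>i. if i = j then 1 else 0) {..<m}"
      unfolding euclidean_norm_vec_def using assms by (intro L2_set_cong) (auto simp: unit_vec_def)
    also have "\<dots> = 1" using assms by (simp add: L2_set_def if_distrib[of "\<lambda>x. x ^ 2"] cong: if_cong)
    finally show "euclidean_norm_vec (unit_vec m j) \<le> 1" by simp
  qed (use assms in auto)
  finally show ?thesis .
qed

lemma norm_mat_trace_le:
  assumes "A \<in> carrier_mat n n"
  shows "cmod (mat_trace A) \<le> real n * operator_norm_mat A"
proof -
  have "cmod (mat_trace A) \<le> (\<Sum>i<n. operator_norm_mat A)"
    unfolding mat_trace_def carrier_matD(1)[OF assms]
    by (intro sum_norm_le norm_entry_le_operator_norm[OF assms]) auto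
  then show ?thesis by simp
qed

text \<open>
  The trace of \<open>C* C\<close> is the square of the Frobenius norm, so this is the Cauchy-Schwarz inequality
  for each row of \<open>C\<close>.
\<close>
lemma euclidean_norm_mult_mat_vec_le_frobenius:
  assumes "C \<in> carrier_mat n n" "v \<in> carrier_vec n" "euclidean_norm_vec v \<le> 1"
  shows "euclidean_norm_vec (C *\<^sub>v v) ^ 2 \<le> Re (mat_trace (adjoint_mat C * C))"
proof -
  have "euclidean_norm_vec (C *\<^sub>v v) ^ 2 = (\<Sum>i<n. cmod (\<Sum>j<n. C $$ (i, j) * v $ j) ^ 2)"
    using assms by (simp add: euclidean_norm_vec_def L2_set_def sum_nonneg mult_mat_vec_index[of C n n]
        del: index_mult_mat_vec)
  also have "\<dots> \<le> (\<Sum>i<n. \<Sum>j<n. cmod (C $$ (i, j)) ^ 2)"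
  proof (intro sum_mono)
    fix i
    have "cmod (\<Sum>j<n. C $$ (i, j) * v $ j) \<le> (\<Sum>j<n. \<bar>cmod (C $$ (i, j))\<bar> * \<bar>cmod (v $ j)\<bar>)"
      by (rule order_trans[OF norm_sum]) (simp add: norm_mult)
    also have "\<dots> \<le> L2_set (\<lambda>j. cmod (C $$ (i, j))) {..<n} * euclidean_norm_vec v"
      using L2_set_mult_ineq[of "\<lambda>j. cmod (C $$ (i, j))" "\<lambda>j. cmod (v $ j)" "{..<n}"] assms
      by (simp add: euclidean_norm_vec_def)
    also have "\<dots> \<le> L2_set (\<lambda>j. cmod (C $$ (i, j))) {..<n}"
      using assms(3) by (intro mult_left_le) auto
    finally have "cmod (\<Sum>j<n. C $$ (i, j) * v $ j) ^ 2 \<le> L2_set (\<lambda>j. cmod (C $$ (i, j))) {..<n} ^ 2"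
      by (intro power_mono) auto
    also have "\<dots> = (\<Sum>j<n. cmod (C $$ (i, j)) ^ 2)"
      by (simp add: L2_set_def sum_nonneg)
    finally show "cmod (\<Sum>j<n. C $$ (i, j) * v $ j) ^ 2 \<le> (\<Sum>j<n. cmod (C $$ (i, j)) ^ 2)" .
  qed
  also have "\<dots> = (\<Sum>j<n. \<Sum>i<n. cmod (C $$ (i, j)) ^ 2)" by (rule sum.swap)
  also have "\<dots> = Re (mat_trace (adjoint_mat C * C))"
    using assms mult_mat_index[of "adjoint_mat C" n n C n]
    by (simp add: mat_trace_def adjoint_mat_def complex_norm_square[symmetric] mult.commute[of "cnj _"]
        cmod_power2 power2_eq_square)
  finally show ?thesis .
qed

definition letter_mat :: "complex mat \<Rightarrow> bool \<Rightarrow> complex mat" where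
  "letter_mat A s = (if s then A else adjoint_mat A)"

primrec word_mat :: "nat \<Rightarrow> complex mat \<Rightarrow> bool list \<Rightarrow> complex mat" where
  "word_mat n A [] = 1\<^sub>m n"
| "word_mat n A (s # w) = letter_mat A s * word_mat n A w"

lemma letter_mat_carrier [simp, intro]: "A \<in> carrier_mat n n \<Longrightarrow> letter_mat A s \<in> carrier_mat n n"
  by (simp add: letter_mat_def)

lemma word_mat_carrier [simp, intro]: "A \<in> carrier_mat n n \<Longrightarrow> word_mat n A w \<in> carrier_mat n n"
  by (induction w) (auto intro: mult_carrier_mat[of _ n n])

lemma word_mat_append:
  "A \<in> carrier_mat n n \<Longrightarrow> word_mat n A (u @ v) = word_mat n A u * word_mat n A v"
proof (induction u)
  case (Cons s u)
  then show ?case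
    using assoc_mult_mat[of "letter_mat A s" n n "word_mat n A u" n "word_mat n A v" n] by auto
next
  case Nil
  then show ?case using left_mult_one_mat[OF word_mat_carrier, of A n v] by simp
qed

lemma adjoint_mat_mult:
  assumes "A \<in> carrier_mat n n" "B \<in> carrier_mat n n"
  shows "adjoint_mat (A * B) = adjoint_mat B * adjoint_mat A"
proof (rule eq_matI)
  fix i j assume "i < dim_row (adjoint_mat B * adjoint_mat A)" "j < dim_col (adjoint_mat B * adjoint_mat A)"
  then have ij: "i < n" "j < n" using assms by (auto simp: adjoint_mat_def)
  have "adjoint_mat (A * B) $$ (i, j) = cnj ((A * B) $$ (j, i))"
    using assms ij by (auto simp: adjoint_mat_def)
  also have "\<dots> = (\<Sum>k<n. adjoint_mat B $$ (i, k) * adjoint_mat A $$ (k, j))"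
    using assms ij by (auto simp: mult_mat_index[of A n n B n] adjoint_mat_def mult.commute
        simp del: index_mult_mat(1) intro!: sum.cong)
  also have "\<dots> = (adjoint_mat B * adjoint_mat A) $$ (i, j)"
    using assms ij by (subst mult_mat_index[of _ n n _ n]) auto
  finally show "adjoint_mat (A * B) $$ (i, j) = (adjoint_mat B * adjoint_mat A) $$ (i, j)" .
qed (use assms in \<open>auto simp: adjoint_mat_def\<close>)

lemma adjoint_word_mat:
  "A \<in> carrier_mat n n \<Longrightarrow> adjoint_mat (word_mat n A w) = word_mat n A (rev (map Not w))"
proof (induction w)
  case Nil
  show ?case by (auto simp: adjoint_mat_def)
next
  case (Cons s w)
  have "letter_mat A (\<not> s) * 1\<^sub>m n = adjoint_mat (letter_mat A s)"
    using right_mult_one_mat[OF letter_mat_carrier[OF Cons.prems, of "\<not> s"]] by (auto simp: letter_mat_def)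
  then show ?case
    using Cons by (simp add: word_mat_append adjoint_mat_mult[of _ n])
qed

lemma word_mat_replicate_True:
  "A \<in> carrier_mat n n \<Longrightarrow> word_mat n A (replicate j True) = A ^\<^sub>m j"
proof (induction j)
  case (Suc j)
  have "word_mat n A (replicate (Suc j) True) = word_mat n A (replicate j True @ [True])"
    by (simp add: replicate_append_same)
  also have "\<dots> = A ^\<^sub>m j * (A * 1\<^sub>m n)"
    unfolding word_mat_append[OF Suc.prems] Suc.IH[OF Suc.prems] by (simp add: letter_mat_def)
  also have "A * 1\<^sub>m n = A" using Suc.prems by (rule right_mult_one_mat)
  finally show ?case by simp
qed auto

lemma operator_norm_word_mat_replicate:
  assumes "A \<in> carrier_mat n n"
  shows "operator_norm_mat (word_mat n A (replicate j s)) = operator_norm_mat (A ^\<^sub>m j)"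
proof (cases s)
  case False
  have "word_mat n A (replicate j False) = adjoint_mat (word_mat n A (replicate j True))"
    using assms by (simp add: adjoint_word_mat)
  then show ?thesis using assms False
    by (simp add: operator_norm_mat_adjoint[of _ n n] word_mat_replicate_True)
qed (use assms in \<open>simp add: word_mat_replicate_True\<close>)

lemma operator_norm_pow_le:
  assumes "A \<in> carrier_mat n n"
  shows "operator_norm_mat (A ^\<^sub>m j) \<le> operator_norm_mat A ^ j"
proof (induction j)
  case 0
  show ?case using operator_norm_mat_one_le by simp
next
  case (Suc j)
  have "operator_norm_mat (A ^\<^sub>m Suc j) \<le> operator_norm_mat (A ^\<^sub>m j) * operator_norm_mat A"
    using assms by (simp, intro operator_norm_mat_mult_le[of _ n n]) auto
  also have "\<dots> \<le> operator_norm_mat A ^ j * operator_norm_mat A"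
    by (intro mult_right_mono Suc.IH operator_norm_mat_nonneg)
  finally show ?case by (simp add: mult.commute)
qed

lemma operator_norm_block_word_le:
  assumes "A \<in> carrier_mat n n" "block_word k r p w"
    and R: "operator_norm_mat A \<le> R" "1 \<le> R" and B: "operator_norm_mat (A ^\<^sub>m k) \<le> B"
  shows "operator_norm_mat (word_mat n A w) \<le> R ^ ((k - 1) * p) * B ^ r"
proof -
  have B0: "0 \<le> B" using B operator_norm_mat_nonneg order_trans by blast
  show ?thesis using assms(2)
  proof (induction rule: block_word.induct)
    case block_Nil
    show ?case using operator_norm_mat_one_le by simp
  next
    case (block_full r p w s)
    have "operator_norm_mat (word_mat n A (replicate k s @ w)) \<le> B * (R ^ ((k - 1) * p) * B ^ r)"
      unfolding word_mat_append[OF assms(1)]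
      using assms block_full.IH
      by (intro order_trans[OF operator_norm_mat_mult_le[of _ n n _ n]] mult_mono operator_norm_mat_nonneg B0)
         (auto simp: operator_norm_word_mat_replicate)
    then show ?case by (simp add: mult_ac)
  next
    case (block_short i r p w s)
    have "operator_norm_mat (A ^\<^sub>m i) \<le> operator_norm_mat A ^ i" by (rule operator_norm_pow_le) fact
    also have "\<dots> \<le> R ^ i" by (intro power_mono R operator_norm_mat_nonneg)
    also have "\<dots> \<le> R ^ (k - 1)" using block_short.hyps R by (intro power_increasing) auto
    finally have "operator_norm_mat (word_mat n A (replicate i s @ w)) \<le> R ^ (k - 1) * (R ^ ((k - 1) * p) * B ^ r)"
      unfolding word_mat_append[OF assms(1)]
      using assms block_short.IH
      by (intro order_trans[OF operator_norm_mat_mult_le[of _ n n _ n]] mult_mono operator_norm_mat_nonneg)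
         (auto simp: operator_norm_word_mat_replicate)
    then show ?case by (simp add: mult_ac power_add)
  qed
qed

text \<open>
  The word of length \<open>i\<close> in which \<open>Y\<close> and \<open>Y*\<close> alternate and which ends in \<open>Y\<close>, the factor that is
  applied first.
\<close>
primrec alternating :: "nat \<Rightarrow> bool list" where
  "alternating 0 = []"
| "alternating (Suc i) = even i # alternating i"

lemma alternating_snoc: "alternating (Suc i) = map Not (alternating i) @ [True]"
proof (induction i)
  case (Suc i)
  have "alternating (Suc (Suc i)) = odd i # alternating (Suc i)" by simp
  also have "\<dots> = odd i # map Not (alternating i) @ [True]" by (simp only: Suc.IH)
  finally show ?case by (simp only: alternating.simps(2)[of i] list.map append_Cons)
qed simp

lemma alternating_periods: "rev (map Not (alternating m)) @ alternating m = periods 1 m"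
proof (induction m)
  case (Suc m)
  have "rev (map Not (alternating (Suc m))) @ alternating (Suc m) =
      False # map Not (rev (map Not (alternating m)) @ alternating m) @ [True]"
    unfolding alternating_snoc by (simp add: rev_map comp_def)
  also have "\<dots> = False # map Not (periods 1 m) @ [True]" by (simp only: Suc.IH)
  also have "\<dots> = periods 1 (Suc m)"
    by (induction m) (auto simp: periods_Suc)
  finally show ?case .
qed simp

text \<open>
  Without spectral theory: for a vector \<open>v\<close> in the unit ball let \<open>x\<^sub>i\<close> be \<open>v\<close>, \<open>A v\<close>, \<open>A* A v\<close>,
  \<open>A A* A v\<close>, and so on. From \<open>\<parallel>x\<^sub>i\<^sub>+\<^sub>1\<parallel>^2 = \<langle>x\<^sub>i, x\<^sub>i\<^sub>+\<^sub>2\<rangle>\<close> the norms are log-convex, so the norm of \<open>x\<^sub>m\<close>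
  is at least the \<open>m\<close>-th power of that of \<open>A v\<close>, while the Frobenius norm bounds it from above.
\<close>
lemma operator_norm_power_le_trace:
  assumes A: "A \<in> carrier_mat n n" and "1 \<le> m"
  shows "operator_norm_mat A ^ (2 * m) \<le> Re (mat_trace (word_mat n A (periods 1 m)))"
proof -
  let ?T = "Re (mat_trace (word_mat n A (periods 1 m)))"
  have main: "(euclidean_norm_vec (A *\<^sub>v v) ^ m) ^ 2 \<le> ?T"
    if v: "v \<in> carrier_vec n" "euclidean_norm_vec v \<le> 1" for v
  proof -
    define x where "x i = word_mat n A (alternating i) *\<^sub>v v" for i
    define p where "p i = euclidean_norm_vec (x i)" for i
    have x: "x i \<in> carrier_vec n" for i
      using A v unfolding x_def by (intro mult_mat_vec_carrier[of _ n n]) auto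
    have x_Suc: "x (Suc i) = letter_mat A (even i) *\<^sub>v x i" for i
      unfolding x_def using A v by (auto intro!: assoc_mult_mat_vec[of _ n n _ n])
    have log_convex: "p (Suc i) ^ 2 \<le> p i * p (Suc (Suc i))" for i
    proof -
      have "adjoint_mat (letter_mat A (even i)) = letter_mat A (even (Suc i))"
        by (simp add: letter_mat_def)
      then have "hdot (x (Suc i)) (x (Suc i)) = hdot (x i) (x (Suc (Suc i)))"
        using hdot_adjoint[OF letter_mat_carrier[OF A, of "even i"] x[of i] x[of "Suc i"]]
        by (simp only: x_Suc[symmetric])
      then have "p (Suc i) ^ 2 = cmod (hdot (x i) (x (Suc (Suc i))))"
        unfolding p_def hdot_self by (metis abs_of_nonneg norm_of_real zero_le_power2)
      also have "\<dots> \<le> p i * p (Suc (Suc i))"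
        unfolding p_def using x[of i] x[of "Suc (Suc i)"] by (intro norm_hdot_le) auto
      finally show ?thesis .
    qed
    have nonneg: "0 \<le> p i" for i by (simp add: p_def)
    have ratio: "p 1 * p i \<le> p (Suc i)" for i
    proof (induction i)
      case 0
      have "p 0 \<le> 1" using v A by (simp add: p_def x_def)
      then show ?case using nonneg[of 1] by (simp add: mult_left_le)
    next
      case (Suc i)
      show ?case
      proof (cases "p (Suc i) = 0")
        case False
        then have pos: "p (Suc i) > 0" using nonneg[of "Suc i"] by linarith
        have "p 1 * p (Suc i) * p (Suc i) \<le> p 1 * (p i * p (Suc (Suc i)))"
          using log_convex[of i] nonneg[of 1] by (simp add: power2_eq_square mult.assoc mult_left_mono)
        also have "\<dots> \<le> p (Suc i) * p (Suc (Suc i))"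
          using mult_right_mono[OF Suc.IH nonneg[of "Suc (Suc i)"]] by (simp add: mult.assoc)
        finally show ?thesis using pos by (simp add: mult.commute)
      qed (use nonneg in simp)
    qed
    have pow: "p 1 ^ i \<le> p i" if "1 \<le> i" for i
      using that
    proof (induction i rule: dec_induct)
      case (step i)
      have "p 1 ^ Suc i \<le> p 1 * p i" using step nonneg[of 1] by (simp add: mult_left_mono)
      then show ?case using ratio[of i] by linarith
    qed simp
    have "x 1 = A *\<^sub>v v" using A v by (simp add: x_def letter_mat_def)
    then have "(euclidean_norm_vec (A *\<^sub>v v) ^ m) ^ 2 \<le> p m ^ 2"
      using pow[OF assms(2)] by (intro power_mono) (auto simp: p_def)
    also have "\<dots> \<le> Re (mat_trace (adjoint_mat (word_mat n A (alternating m)) * word_mat n A (alternating m)))"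
      unfolding p_def x_def using A v by (intro euclidean_norm_mult_mat_vec_le_frobenius) auto
    also have "\<dots> = ?T"
      using A by (simp add: adjoint_word_mat word_mat_append[symmetric] alternating_periods)
    finally show ?thesis .
  qed
  have T0: "0 \<le> ?T" using main[of "0\<^sub>v n"] by (rule order_trans[rotated]) (auto simp: euclidean_norm_vec_def L2_set_def)
  have "operator_norm_mat A \<le> root (2 * m) ?T"
  proof (rule operator_norm_mat_le)
    fix v :: "complex vec" assume "v \<in> carrier_vec (dim_col A)" "euclidean_norm_vec v \<le> 1"
    then have "euclidean_norm_vec (A *\<^sub>v v) ^ (2 * m) \<le> ?T"
      using main[of v] A by (auto simp: power_mult mult.commute[of 2])
    then show "euclidean_norm_vec (A *\<^sub>v v) \<le> root (2 * m) ?T"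
      using assms(2) by (metis euclidean_norm_vec_nonneg mult_pos_pos pos2 real_root_le_mono real_root_power_cancel less_eq_Suc_le One_nat_def)
  qed
  then have "operator_norm_mat A ^ (2 * m) \<le> root (2 * m) ?T ^ (2 * m)"
    by (intro power_mono operator_norm_mat_nonneg)
  then show ?thesis using T0 assms(2) by simp
qed

lemma word_mat_periods:
  assumes "A \<in> carrier_mat n n"
  shows "word_mat n (A ^\<^sub>m k) (periods 1 a) = word_mat n A (periods k a)"
proof (induction a)
  case (Suc a)
  have Ak: "A ^\<^sub>m k \<in> carrier_mat n n" using assms by simp
  have "word_mat n A (replicate k False) = adjoint_mat (A ^\<^sub>m k)"
    using assms adjoint_word_mat[OF assms, of "replicate k True"] by (simp add: word_mat_replicate_True)
  then show ?case
    using assms Suc Ak by (simp add: periods_Suc word_mat_append word_mat_replicate_True letter_mat_def)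
qed simp

text \<open>
  A bound by traces only, so that expectations can be taken on both sides. Where the norm of \<open>A\<close> is
  at most \<open>8\<close>, the short blocks contribute a constant. Elsewhere everything is bounded by \<open>R^Q\<close>, where
  \<open>R\<close> is this norm, and \<open>R^Q \<le> 8^(-Q) R^(2 Q)\<close> leads to a trace whose expected growth is at most of
  the order \<open>8^Q\<close>, by lemma \<open>trace_moment_periods_1_le\<close> below.
\<close>
lemma block_trace_le:
  assumes A: "A \<in> carrier_mat n n" and n: "1 \<le> n" and k: "1 \<le> k"
    and w: "block_word k r p w" and rp: "r \<le> 2 * a" "p \<le> 8" and Q: "8 * k + 2 * (k * a) \<le> Q"
  shows "Re (mat_trace (word_mat n A w)) \<le> real n *
    (8 ^ (8 * k) * (1 + Re (mat_trace (word_mat n A (periods k a)))) +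
     (1 / 8) ^ Q * Re (mat_trace (word_mat n A (periods 1 Q))))"
proof -
  let ?Tk = "Re (mat_trace (word_mat n A (periods k a)))"
  let ?T1 = "Re (mat_trace (word_mat n A (periods 1 Q)))"
  define R where "R = max 1 (operator_norm_mat A)"
  define B where "B = max 1 (operator_norm_mat (A ^\<^sub>m k))"
  have R1: "1 \<le> R" and B1: "1 \<le> B" by (auto simp: R_def B_def)
  have Tk: "operator_norm_mat (A ^\<^sub>m k) ^ (2 * a) \<le> 1 + ?Tk" and Tk0: "0 \<le> ?Tk"
  proof -
    have "operator_norm_mat (A ^\<^sub>m k) ^ (2 * a) \<le> 1 + ?Tk \<and> 0 \<le> ?Tk"
    proof (cases "a = 0")
      case False
      then have "operator_norm_mat (A ^\<^sub>m k) ^ (2 * a) \<le> ?Tk"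
        using operator_norm_power_le_trace[of "A ^\<^sub>m k" n a] A word_mat_periods[OF A, of k a] by simp
      moreover have "0 \<le> operator_norm_mat (A ^\<^sub>m k) ^ (2 * a)"
        by (intro zero_le_power operator_norm_mat_nonneg)
      ultimately show ?thesis by linarith
    qed (simp add: mat_trace_def)
    then show "operator_norm_mat (A ^\<^sub>m k) ^ (2 * a) \<le> 1 + ?Tk" "0 \<le> ?Tk" by auto
  qed
  have T1: "operator_norm_mat A ^ (2 * Q) \<le> ?T1"
    using operator_norm_power_le_trace[OF A, of Q] k Q by simp
  then have T10: "0 \<le> ?T1"
    by (rule order_trans[rotated]) (intro zero_le_power operator_norm_mat_nonneg)
  have "Re (mat_trace (word_mat n A w)) \<le> real n * operator_norm_mat (word_mat n A w)"
    using norm_mat_trace_le[OF word_mat_carrier[OF A, of w]] complex_Re_le_cmod order_trans by blast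
  also have "\<dots> \<le> real n * (R ^ ((k - 1) * p) * B ^ r)"
    by (intro mult_left_mono operator_norm_block_word_le[OF A w]) (auto simp: R_def B_def)
  also have "R ^ ((k - 1) * p) * B ^ r \<le> R ^ (8 * k) * B ^ (2 * a)"
  proof (rule mult_mono)
    have "(k - 1) * p \<le> k * 8" using rp by (intro mult_le_mono) auto
    then show "R ^ ((k - 1) * p) \<le> R ^ (8 * k)"
      using R1 by (intro power_increasing) (auto simp: mult.commute)
    show "B ^ r \<le> B ^ (2 * a)" using B1 rp by (intro power_increasing)
  qed (use R1 B1 in auto)
  also have "R ^ (8 * k) * B ^ (2 * a) \<le> 8 ^ (8 * k) * (1 + ?Tk) + (1 / 8) ^ Q * ?T1"
  proof (cases "R \<le> 8")
    case True
    have "B ^ (2 * a) \<le> 1 + ?Tk"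
      using Tk Tk0 by (auto simp: B_def max_def)
    then have "R ^ (8 * k) * B ^ (2 * a) \<le> 8 ^ (8 * k) * (1 + ?Tk)"
      using True R1 B1 by (intro mult_mono power_mono) auto
    then show ?thesis using T10 by (simp add: add_increasing2)
  next
    case False
    then have RA: "R = operator_norm_mat A" by (auto simp: R_def max_def split: if_splits)
    have "B \<le> R ^ k"
      using operator_norm_pow_le[OF A, of k] R1 by (auto simp: B_def RA)
    then have "R ^ (8 * k) * B ^ (2 * a) \<le> R ^ (8 * k) * (R ^ k) ^ (2 * a)"
      using R1 B1 by (intro mult_left_mono power_mono) auto
    also have "\<dots> = R ^ (8 * k + 2 * (k * a))" by (simp add: power_add power_mult[symmetric] mult_ac)
    also have "\<dots> \<le> R ^ Q" using R1 Q by (intro power_increasing)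
    also have "\<dots> \<le> R ^ Q * (R / 8) ^ Q"
      using False R1 one_le_power[of "R / 8" Q] mult_left_mono[of 1 "(R / 8) ^ Q" "R ^ Q"] by simp
    also have "\<dots> = (1 / 8) ^ Q * R ^ (2 * Q)" by (simp add: power_divide power_mult power2_eq_square power_mult_distrib mult.commute[of 2])
    also have "\<dots> \<le> (1 / 8) ^ Q * ?T1" using T1 RA by (intro mult_left_mono) auto
    finally show ?thesis using Tk0 by (simp add: add_increasing)
  qed
  finally show ?thesis by (simp add: mult_left_mono)
qed

lemma word_mat_index:
  assumes "A \<in> carrier_mat n n" "a < n" "b < n"
  shows "word_mat n A w $$ (a, b) =
    path_sum n w a b (\<lambda>m. prod_list (map (\<lambda>(s, c, d). letter_mat A s $$ (c, d)) m))"
  using assms(2)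
proof (induction w arbitrary: a)
  case Nil
  then show ?case using assms by (auto simp: one_mat_def)
next
  case (Cons s w)
  have "word_mat n A (s # w) $$ (a, b) = (\<Sum>c<n. letter_mat A s $$ (a, c) * word_mat n A w $$ (c, b))"
    using assms Cons.prems mult_mat_index[of "letter_mat A s" n n "word_mat n A w" n a b] by simp
  then show ?case using assms Cons by (simp add: path_sum_cmult)
qed

lemma mat_trace_word_mat:
  assumes "A \<in> carrier_mat n n"
  shows "mat_trace (word_mat n A w) =
    closed_sum n w (\<lambda>m. prod_list (map (\<lambda>(s, c, d). letter_mat A s $$ (c, d)) m))"
proof -
  have "dim_row (word_mat n A w) = n" using word_mat_carrier[OF assms, of w] by blast
  then show ?thesis using assms by (simp add: mat_trace_def closed_sum_def word_mat_index)
qed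

section \<open>Moments of Gaussian arrays\<close>

text \<open>
  \<open>K a b p q\<close> stands for \<open>E [x^a y^b z^p z'^q]\<close> where \<open>z = c (x + \<i> y)\<close>, \<open>z' = c (x - \<i> y)\<close>, and \<open>x\<close>
  and \<open>y\<close> are real. The conclusions are integration by parts in \<open>x\<close> and in \<open>y\<close>, extended from the
  monomials in \<open>x\<close> and \<open>y\<close> by expanding one factor \<open>z\<close> or \<open>z'\<close> at a time.
\<close>
lemma integration_by_parts_from_monomials:
  fixes K :: "nat \<Rightarrow> nat \<Rightarrow> nat \<Rightarrow> nat \<Rightarrow> complex" and c :: complex
  assumes p: "\<And>a b p q. K a b (Suc p) q = c * (K (Suc a) b p q + \<i> * K a (Suc b) p q)"
    and q: "\<And>a b p q. K a b p (Suc q) = c * (K (Suc a) b p q - \<i> * K a (Suc b) p q)"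
    and x: "\<And>a b. K (Suc a) b 0 0 = of_nat a * K (a - 1) b 0 0"
    and y: "\<And>a b. K a (Suc b) 0 0 = of_nat b * K a (b - 1) 0 0"
  shows "K (Suc a) b p q = of_nat a * K (a - 1) b p q +
      c * (of_nat p * K a b (p - 1) q + of_nat q * K a b p (q - 1))"
    and "K a (Suc b) p q = of_nat b * K a (b - 1) p q +
      \<i> * c * (of_nat p * K a b (p - 1) q - of_nat q * K a b p (q - 1))"
proof -
  have "(\<forall>a b. K (Suc a) b p q = of_nat a * K (a - 1) b p q +
      c * (of_nat p * K a b (p - 1) q + of_nat q * K a b p (q - 1))) \<and>
    (\<forall>a b. K a (Suc b) p q = of_nat b * K a (b - 1) p q +
      \<i> * c * (of_nat p * K a b (p - 1) q - of_nat q * K a b p (q - 1)))"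
  proof (induction "p + q" arbitrary: p q rule: less_induct)
    case less
    show ?case
    proof (cases p)
      case (Suc p')
      note IH = less[of p' q, unfolded Suc, simplified]
      have IH1: "K (Suc a) b p' q = of_nat a * K (a - 1) b p' q +
          c * (of_nat p' * K a b (p' - 1) q + of_nat q * K a b p' (q - 1))" for a b
        using IH by simp
      have IH2: "K a (Suc b) p' q = of_nat b * K a (b - 1) p' q +
          \<i> * c * (of_nat p' * K a b (p' - 1) q - of_nat q * K a b p' (q - 1))" for a b
        using IH by simp
      have e1: "of_nat p' * K a b p' q = of_nat p' * (c * (K (Suc a) b (p' - 1) q + \<i> * K a (Suc b) (p' - 1) q))" for a b
        by (cases p') (simp_all add: p)
      have e2: "of_nat q * K a b (Suc p') (q - 1) = of_nat q * (c * (K (Suc a) b p' (q - 1) + \<i> * K a (Suc b) p' (q - 1)))" for a b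
        by (simp add: p)
      have A: "K (Suc a) b p q = of_nat a * K (a - 1) b p q +
          c * (of_nat p * K a b (p - 1) q + of_nat q * K a b p (q - 1))" for a b
      proof -
        have "K (Suc a) b p q = c * (K (Suc (Suc a)) b p' q + \<i> * K (Suc a) (Suc b) p' q)"
          by (simp add: Suc p)
        also have "\<dots> = c * (of_nat (Suc a) * K a b p' q + c * (of_nat p' * K (Suc a) b (p' - 1) q + of_nat q * K (Suc a) b p' (q - 1))
            + \<i> * (of_nat a * K (a - 1) (Suc b) p' q + c * (of_nat p' * K a (Suc b) (p' - 1) q + of_nat q * K a (Suc b) p' (q - 1))))"
          by (simp only: IH1[of "Suc a" b] IH1[of a "Suc b"] diff_Suc_1)
        also have "\<dots> = of_nat a * (c * (K (Suc (a - 1)) b p' q + \<i> * K (a - 1) (Suc b) p' q)) +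
            c * (K a b p' q + of_nat p' * K a b p' q + of_nat q * K a b (Suc p') (q - 1))"
          unfolding e1 e2 by (cases a) (simp_all add: algebra_simps)
        finally show ?thesis by (simp add: Suc p algebra_simps)
      qed
      have B: "K a (Suc b) p q = of_nat b * K a (b - 1) p q +
          \<i> * c * (of_nat p * K a b (p - 1) q - of_nat q * K a b p (q - 1))" for a b
      proof -
        have "K a (Suc b) p q = c * (K (Suc a) (Suc b) p' q + \<i> * K a (Suc (Suc b)) p' q)"
          by (simp add: Suc p)
        also have "\<dots> = c * (of_nat b * K (Suc a) (b - 1) p' q + \<i> * c * (of_nat p' * K (Suc a) b (p' - 1) q - of_nat q * K (Suc a) b p' (q - 1))
            + \<i> * (of_nat (Suc b) * K a b p' q + \<i> * c * (of_nat p' * K a (Suc b) (p' - 1) q - of_nat q * K a (Suc b) p' (q - 1))))"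
          by (simp only: IH2[of "Suc a" b] IH2[of a "Suc b"] diff_Suc_1)
        also have "\<dots> = of_nat b * (c * (K (Suc a) (b - 1) p' q + \<i> * K a (Suc (b - 1)) p' q)) +
            \<i> * c * (K a b p' q + of_nat p' * K a b p' q - of_nat q * K a b (Suc p') (q - 1))"
          unfolding e1 e2 by (cases b) (simp_all add: algebra_simps)
        finally show ?thesis by (simp add: Suc p algebra_simps)
      qed
      show ?thesis using A B by blast
    next
      case 0
      show ?thesis
      proof (cases q)
        case (Suc q')
        note IH = less[of 0 q', unfolded 0 Suc, simplified]
        have IH1: "K (Suc a) b 0 q' = of_nat a * K (a - 1) b 0 q' + c * (of_nat q' * K a b 0 (q' - 1))" for a b
          using IH by simp
        have IH2: "K a (Suc b) 0 q' = of_nat b * K a (b - 1) 0 q' - \<i> * c * (of_nat q' * K a b 0 (q' - 1))" for a b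
          using IH by simp
        have e1: "of_nat q' * K a b 0 q' = of_nat q' * (c * (K (Suc a) b 0 (q' - 1) - \<i> * K a (Suc b) 0 (q' - 1)))" for a b
          by (cases q') (simp_all add: q)
        have A: "K (Suc a) b 0 q = of_nat a * K (a - 1) b 0 q + c * (of_nat q * K a b 0 (q - 1))" for a b
        proof -
          have "K (Suc a) b 0 q = c * (K (Suc (Suc a)) b 0 q' - \<i> * K (Suc a) (Suc b) 0 q')"
            by (simp add: Suc q)
          also have "\<dots> = c * (of_nat (Suc a) * K a b 0 q' + c * (of_nat q' * K (Suc a) b 0 (q' - 1))
              - \<i> * (of_nat a * K (a - 1) (Suc b) 0 q' + c * (of_nat q' * K a (Suc b) 0 (q' - 1))))"
            by (simp only: IH1[of "Suc a" b] IH1[of a "Suc b"] diff_Suc_1)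
          also have "\<dots> = of_nat a * (c * (K (Suc (a - 1)) b 0 q' - \<i> * K (a - 1) (Suc b) 0 q')) +
              c * (K a b 0 q' + of_nat q' * K a b 0 q')"
            unfolding e1 by (cases a) (simp_all add: algebra_simps)
          finally show ?thesis by (simp add: Suc q algebra_simps)
        qed
        have B: "K a (Suc b) 0 q = of_nat b * K a (b - 1) 0 q - \<i> * c * (of_nat q * K a b 0 (q - 1))" for a b
        proof -
          have "K a (Suc b) 0 q = c * (K (Suc a) (Suc b) 0 q' - \<i> * K a (Suc (Suc b)) 0 q')"
            by (simp add: Suc q)
          also have "\<dots> = c * (of_nat b * K (Suc a) (b - 1) 0 q' - \<i> * c * (of_nat q' * K (Suc a) b 0 (q' - 1))
              - \<i> * (of_nat (Suc b) * K a b 0 q' - \<i> * c * (of_nat q' * K a (Suc b) 0 (q' - 1))))"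
            by (simp only: IH2[of "Suc a" b] IH2[of a "Suc b"] diff_Suc_1)
          also have "\<dots> = of_nat b * (c * (K (Suc a) (b - 1) 0 q' - \<i> * K a (Suc (b - 1)) 0 q')) -
              \<i> * c * (K a b 0 q' + of_nat q' * K a b 0 q')"
            unfolding e1 by (cases b) (simp_all add: algebra_simps)
          finally show ?thesis by (simp add: Suc q algebra_simps)
        qed
        show ?thesis using A B 0 by simp
      qed (use 0 x y in simp)
    qed
  qed
  then show "K (Suc a) b p q = of_nat a * K (a - 1) b p q +
      c * (of_nat p * K a b (p - 1) q + of_nat q * K a b p (q - 1))"
    and "K a (Suc b) p q = of_nat b * K a (b - 1) p q +
      \<i> * c * (of_nat p * K a b (p - 1) q - of_nat q * K a b p (q - 1))"
    by blast+
qed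

definition std_normal_moment :: "nat \<Rightarrow> real" where
  "std_normal_moment a = (\<integral>x. std_normal_density x * x ^ a \<partial>lborel)"

lemma std_normal_moment_0: "std_normal_moment 0 = 1"
  using integral_std_normal_moment_even[of 0] by (simp add: std_normal_moment_def)

lemma std_normal_moment_Suc: "std_normal_moment (Suc a) = real a * std_normal_moment (a - 1)"
proof (cases "even a")
  case True
  then obtain k where k: "a = 2 * k" by auto
  have "std_normal_moment (2 * k + 1) = 0"
    unfolding std_normal_moment_def by (rule integral_std_normal_moment_odd)
  moreover have "real a * std_normal_moment (a - 1) = 0"
  proof (cases k)
    case (Suc k')
    then have "a - 1 = 2 * k' + 1" using k by simp
    then show ?thesis
      unfolding std_normal_moment_def by (simp only: integral_std_normal_moment_odd mult_zero_right)
  qed (simp add: k)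
  ultimately show ?thesis by (simp add: k)
next
  case False
  then obtain k where k: "a = 2 * k + 1" by (elim oddE)
  have "std_normal_moment (2 * Suc k) = fact (2 * Suc k) / (2 ^ Suc k * fact (Suc k))"
    unfolding std_normal_moment_def by (rule integral_std_normal_moment_even)
  also have "\<dots> = real (2 * k + 1) * (fact (2 * k) / (2 ^ k * fact k))"
  proof -
    have 1: "fact (2 * Suc k) = (2 * real k + 2) * (2 * real k + 1) * fact (2 * k)"
      by (simp add: algebra_simps)
    have 2: "(2::real) ^ Suc k * fact (Suc k) = (2 * real k + 2) * (2 ^ k * fact k)"
      by (simp add: algebra_simps)
    have 3: "(2 * real k + 2) * (2 * real k + 1) * x / ((2 * real k + 2) * y) = real (2 * k + 1) * (x / y)" for x y :: real
      using of_nat_0_le_iff[of k, where ?'a = real] by (simp add: divide_simps)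
    show ?thesis unfolding 1 2 3 ..
  qed
  also have "fact (2 * k) / (2 ^ k * fact k) = std_normal_moment (2 * k)"
    unfolding std_normal_moment_def by (rule integral_std_normal_moment_even[symmetric])
  finally show ?thesis by (simp add: k)
qed

definition gaussian_mixed_moment :: "nat \<Rightarrow> nat \<Rightarrow> real" where
  "gaussian_mixed_moment p q = (if p = q then fact p else 0)"

context prob_space
begin

text \<open>
  Combining the two integrations by parts yields \<open>E [z^(p+1) z'^q] = q E [z^p z'^(q-1)]\<close>: as
  \<open>x + \<i> y\<close> corresponds to the derivative with respect to \<open>z'\<close>, the terms with factor \<open>p\<close> cancel.
\<close>
lemma std_complex_gaussian_moments:
  assumes "std_complex_gaussian z"
  shows "integrable M (\<lambda>\<omega>. z \<omega> ^ p * cnj (z \<omega>) ^ q)" (is ?int)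
    and "(\<integral>\<omega>. z \<omega> ^ p * cnj (z \<omega>) ^ q \<partial>M) = of_real (gaussian_mixed_moment p q)" (is ?eq)
proof -
  obtain x y where x: "distributed M lborel x std_normal_density"
    and y: "distributed M lborel y std_normal_density"
    and xy: "indep_var borel x borel y"
    and z: "\<And>\<omega>. \<omega> \<in> space M \<Longrightarrow> z \<omega> = (of_real (x \<omega>) + \<i> * of_real (y \<omega>)) / of_real (sqrt 2)"
    using assms unfolding std_complex_gaussian_def by blast
  have single: "integrable M (\<lambda>\<omega>. u \<omega> ^ a) \<and> (\<integral>\<omega>. u \<omega> ^ a \<partial>M) = std_normal_moment a"
    if "distributed M lborel u std_normal_density" for u :: "'a \<Rightarrow> real" and a
    using distributed_integrable[OF that, of "\<lambda>t. t ^ a"] distributed_integral[OF that, of "\<lambda>t. t ^ a"]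
      integrable_std_normal_moment[of a]
    by (simp add: std_normal_moment_def)
  have ind: "indep_var borel (\<lambda>\<omega>. x \<omega> ^ a) borel (\<lambda>\<omega>. y \<omega> ^ b)" for a b
    using indep_var_compose[OF xy, of "\<lambda>t. t ^ a" borel "\<lambda>t. t ^ b" borel] by (simp add: comp_def)
  have mono: "integrable M (\<lambda>\<omega>. x \<omega> ^ a * y \<omega> ^ b)"
    "(\<integral>\<omega>. x \<omega> ^ a * y \<omega> ^ b \<partial>M) = std_normal_moment a * std_normal_moment b" for a b
    using indep_var_integrable[OF ind] indep_var_lebesgue_integral[OF ind] single[OF x] single[OF y] by auto
  define c :: complex where "c = 1 / of_real (sqrt 2)"
  have c2: "c * c = 1 / 2" by (simp add: c_def flip: of_real_mult)
  define H where "H a b p q \<omega> = of_real (x \<omega> ^ a * y \<omega> ^ b) * (z \<omega> ^ p * cnj (z \<omega>) ^ q)" for a b p q \<omega>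
  have Hp: "H a b (Suc p) q \<omega> = c * (H (Suc a) b p q \<omega> + \<i> * H a (Suc b) p q \<omega>)" if "\<omega> \<in> space M" for a b p q \<omega>
  proof -
    have "z \<omega> = c * (of_real (x \<omega>) + \<i> * of_real (y \<omega>))" using z[OF that] by (simp add: c_def)
    then have "H a b (Suc p) q \<omega> = of_real (x \<omega> ^ a * y \<omega> ^ b) * (c * (of_real (x \<omega>) + \<i> * of_real (y \<omega>)) * (z \<omega> ^ p * cnj (z \<omega>) ^ q))"
      by (simp add: H_def)
    then show ?thesis by (simp add: H_def algebra_simps)
  qed
  have Hq: "H a b p (Suc q) \<omega> = c * (H (Suc a) b p q \<omega> - \<i> * H a (Suc b) p q \<omega>)" if "\<omega> \<in> space M" for a b p q \<omega>
  proof -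
    have "cnj (z \<omega>) = c * (of_real (x \<omega>) - \<i> * of_real (y \<omega>))" using z[OF that] by (simp add: c_def)
    then have "H a b p (Suc q) \<omega> = of_real (x \<omega> ^ a * y \<omega> ^ b) * (c * (of_real (x \<omega>) - \<i> * of_real (y \<omega>)) * (z \<omega> ^ p * cnj (z \<omega>) ^ q))"
      by (simp add: H_def)
    then show ?thesis by (simp add: H_def algebra_simps)
  qed
  have int: "integrable M (H a b p q)" for a b p q
  proof (induction p arbitrary: a b)
    case 0
    show ?case
    proof (induction q arbitrary: a b)
      case 0
      show ?case using mono(1)[of a b, THEN integrable_of_real[where ?'a = complex]] by (simp add: H_def)
    next
      case (Suc q)
      have "integrable M (\<lambda>\<omega>. c * (H (Suc a) b 0 q \<omega> - \<i> * H a (Suc b) 0 q \<omega>))"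
        by (intro integrable_mult_right Bochner_Integration.integrable_diff Suc)
      moreover have "integrable M (H a b 0 (Suc q)) = integrable M (\<lambda>\<omega>. c * (H (Suc a) b 0 q \<omega> - \<i> * H a (Suc b) 0 q \<omega>))"
        by (rule Bochner_Integration.integrable_cong[OF refl]) (rule Hq)
      ultimately show ?case by simp
    qed
  next
    case (Suc p)
    have "integrable M (\<lambda>\<omega>. c * (H (Suc a) b p q \<omega> + \<i> * H a (Suc b) p q \<omega>))"
      by (intro integrable_mult_right Bochner_Integration.integrable_add Suc)
    moreover have "integrable M (H a b (Suc p) q) = integrable M (\<lambda>\<omega>. c * (H (Suc a) b p q \<omega> + \<i> * H a (Suc b) p q \<omega>))"
      by (rule Bochner_Integration.integrable_cong[OF refl]) (rule Hp)
    ultimately show ?case by simp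
  qed
  define K where "K a b p q = (\<integral>\<omega>. H a b p q \<omega> \<partial>M)" for a b p q
  have Kp: "K a b (Suc p) q = c * (K (Suc a) b p q + \<i> * K a (Suc b) p q)" for a b p q
    unfolding K_def by (subst Bochner_Integration.integral_cong[OF refl Hp]) (auto simp: int)
  have Kq: "K a b p (Suc q) = c * (K (Suc a) b p q - \<i> * K a (Suc b) p q)" for a b p q
    unfolding K_def by (subst Bochner_Integration.integral_cong[OF refl Hq]) (auto simp: int)
  have K0: "K a b 0 0 = of_real (std_normal_moment a * std_normal_moment b)" for a b
    using mono(2)[of a b] integral_complex_of_real[of M "\<lambda>\<omega>. x \<omega> ^ a * y \<omega> ^ b"]
    unfolding K_def H_def by (simp only: power_0 mult_1_right)
  have Kx: "K (Suc a) b 0 0 = of_nat a * K (a - 1) b 0 0" and Ky: "K a (Suc b) 0 0 = of_nat b * K a (b - 1) 0 0" for a b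
    by (simp_all add: K0 std_normal_moment_Suc)
  note ibp = integration_by_parts_from_monomials[where K = K and c = c, OF Kp Kq Kx Ky]
  have step: "K 0 0 (Suc p) q = of_nat q * K 0 0 p (q - 1)" for p q
  proof -
    have "K 0 0 (Suc p) q = c * (c * (of_nat p * K 0 0 (p - 1) q + of_nat q * K 0 0 p (q - 1)) +
        \<i> * (\<i> * c * (of_nat p * K 0 0 (p - 1) q - of_nat q * K 0 0 p (q - 1))))"
      unfolding Kp by (subst ibp(1), subst ibp(2)) simp
    also have "\<dots> = 2 * (c * c) * (of_nat q * K 0 0 p (q - 1))" by (simp add: algebra_simps)
    finally show ?thesis by (simp add: c2)
  qed
  have step': "K 0 0 0 (Suc q) = 0" for q
  proof -
    have "K 0 0 0 (Suc q) = c * (c * (of_nat q * K 0 0 0 (q - 1)) - \<i> * (\<i> * c * (- (of_nat q * K 0 0 0 (q - 1)))))"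
      unfolding Kq by (subst ibp(1), subst ibp(2)) simp
    then show ?thesis by (simp add: algebra_simps)
  qed
  have "K 0 0 p q = of_real (gaussian_mixed_moment p q)"
  proof (induction p arbitrary: q)
    case 0
    show ?case
      by (cases q) (auto simp: step' K0 std_normal_moment_0 gaussian_mixed_moment_def)
  next
    case (Suc p)
    show ?case by (cases q) (auto simp: step Suc gaussian_mixed_moment_def)
  qed
  then show ?eq by (simp add: K_def H_def)
  show ?int using int[of 0 0 p q] by (simp add: H_def[abs_def])
qed

end

text \<open>
  The exponents of \<open>g\<^sub>i\<^sub>j\<close> and of its conjugate in a product of letters. Letters count rows and columns
  from 0, the array counts them from 1, and a conjugate letter has its indices interchanged.
\<close>
definition exponent :: "letter list \<Rightarrow> nat \<times> nat \<Rightarrow> nat" where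
  "exponent l e = count_list l (True, fst e - 1, snd e - 1)"

definition conj_exponent :: "letter list \<Rightarrow> nat \<times> nat \<Rightarrow> nat" where
  "conj_exponent l e = count_list l (False, snd e - 1, fst e - 1)"

definition product_moment :: "nat \<Rightarrow> letter list \<Rightarrow> real" where
  "product_moment n l = (\<Prod>e\<in>{1..n} \<times> {1..n}. gaussian_mixed_moment (exponent l e) (conj_exponent l e))"

lemma gaussian_mixed_moment_Suc:
  "gaussian_mixed_moment (Suc p) q = real q * gaussian_mixed_moment p (q - 1)"
  "gaussian_mixed_moment p (Suc q) = real p * gaussian_mixed_moment (p - 1) q"
  by (cases q; cases p; simp add: gaussian_mixed_moment_def)+

lemma count_list_mset: "count_list l x = count (mset l) x"
  by (induction l) auto

lemma count_list_remove1: "count_list (remove1 y l) x = (if x = y then count_list l x - 1 else count_list l x)"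
  by (simp add: count_list_mset)

lemma product_moment_Cons:
  assumes "x \<in> letters n"
  shows "product_moment n (x # l) =
    real (count_list l (adj_letter x)) * product_moment n (remove1 (adj_letter x) l)"
proof -
  obtain s a b where x: "x = (s, a, b)" by (cases x) auto
  define e where "e = (if s then (a + 1, b + 1) else (b + 1, a + 1))"
  let ?J = "{1..n} \<times> {1..n}"
  let ?f = "\<lambda>l e. gaussian_mixed_moment (exponent l e) (conj_exponent l e)"
  let ?l' = "remove1 (adj_letter x) l"
  have e: "e \<in> ?J" using assms by (auto simp: x e_def)
  have rest: "?f (x # l) e' = ?f ?l' e'" if "e' \<in> ?J - {e}" for e'
    using that by (auto simp: exponent_def conj_exponent_def x e_def count_list_remove1 split: if_splits)
  have at: "?f (x # l) e = real (count_list l (adj_letter x)) * ?f ?l' e"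
    by (auto simp: exponent_def conj_exponent_def x e_def count_list_remove1 gaussian_mixed_moment_Suc)
  have "product_moment n (x # l) = ?f (x # l) e * prod (?f (x # l)) (?J - {e})"
    unfolding product_moment_def using e by (intro prod.remove) auto
  also have "prod (?f (x # l)) (?J - {e}) = prod (?f ?l') (?J - {e})"
    using rest by (intro prod.cong) auto
  also have "?f (x # l) e * \<dots> = real (count_list l (adj_letter x)) * (?f ?l' e * prod (?f ?l') (?J - {e}))"
    by (simp add: at)
  also have "?f ?l' e * prod (?f ?l') (?J - {e}) = product_moment n ?l'"
    unfolding product_moment_def using e by (intro prod.remove[symmetric]) auto
  finally show ?thesis .
qed

text \<open>
  Both sides satisfy the same recursion, since \<open>(p+1)! = (p+1) p!\<close> is the one-variable case.
\<close>
lemma product_moment_eq_wick: "set l \<subseteq> letters n \<Longrightarrow> product_moment n l = wick l"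
proof (induction l rule: length_induct)
  case (1 l)
  show ?case
  proof (cases l)
    case Nil
    then show ?thesis
      by (simp add: product_moment_def exponent_def conj_exponent_def gaussian_mixed_moment_def)
  next
    case (Cons x l0)
    let ?y = "adj_letter x"
    have "wick l = real (count (mset l0) ?y) * wick (remove1 ?y l0)"
      unfolding Cons wick.simps by (rule deletion_sum_remove1) (rule wick_mset)
    also have "wick (remove1 ?y l0) = product_moment n (remove1 ?y l0)"
    proof -
      have "length (remove1 ?y l0) < length l" using Cons by (auto simp: length_remove1)
      moreover have "set (remove1 ?y l0) \<subseteq> letters n" using 1 Cons set_remove1_subset[of ?y l0] by auto
      ultimately show ?thesis using 1 by simp
    qed
    also have "real (count (mset l0) ?y) * \<dots> = product_moment n l"
      using 1 Cons by (simp add: product_moment_Cons count_list_mset)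
    finally show ?thesis by simp
  qed
qed

locale gaussian_array = prob_space M for M :: "'a measure" +
  fixes g :: "nat \<Rightarrow> nat \<Rightarrow> 'a \<Rightarrow> complex"
  assumes indep: "indep_vars (\<lambda>_. borel) (\<lambda>(i, j). g i j) ({1..} \<times> {1..})"
    and gaussian: "\<And>i j. 1 \<le> i \<Longrightarrow> 1 \<le> j \<Longrightarrow> std_complex_gaussian (g i j)"
begin

definition entry :: "letter \<Rightarrow> 'a \<Rightarrow> complex" where
  "entry x \<omega> = (case x of (s, a, b) \<Rightarrow> if s then g (a + 1) (b + 1) \<omega> else cnj (g (b + 1) (a + 1) \<omega>))"

text \<open>
  Grouping the factors of a monomial by independent variables.
\<close>
lemma prod_entry:
  assumes "set l \<subseteq> letters n"
  shows "prod_list (map (\<lambda>x. entry x \<omega>) l) =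
    (\<Prod>e\<in>{1..n} \<times> {1..n}. (case e of (i, j) \<Rightarrow> g i j) \<omega> ^ exponent l e * cnj ((case e of (i, j) \<Rightarrow> g i j) \<omega>) ^ conj_exponent l e)"
  using assms
proof (induction l)
  case Nil
  show ?case by (simp add: exponent_def conj_exponent_def)
next
  case (Cons x l)
  obtain s a b where x: "x = (s, a, b)" by (cases x) auto
  define e where "e = (if s then (a + 1, b + 1) else (b + 1, a + 1))"
  let ?J = "{1..n} \<times> {1..n}"
  let ?G = "\<lambda>e :: nat \<times> nat. (case e of (i, j) \<Rightarrow> g i j) \<omega>"
  let ?f = "\<lambda>l e. ?G e ^ exponent l e * cnj (?G e) ^ conj_exponent l e"
  have e: "e \<in> ?J" using Cons.prems by (auto simp: x e_def)
  have rest: "?f (x # l) e' = ?f l e'" if "e' \<in> ?J - {e}" for e'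
    using that by (auto simp: exponent_def conj_exponent_def x e_def split: if_splits)
  have at: "?f (x # l) e = entry x \<omega> * ?f l e"
    by (auto simp: exponent_def conj_exponent_def x e_def entry_def)
  have "prod (?f (x # l)) ?J = ?f (x # l) e * prod (?f (x # l)) (?J - {e})"
    using e by (intro prod.remove) auto
  also have "prod (?f (x # l)) (?J - {e}) = prod (?f l) (?J - {e})"
    using rest by (intro prod.cong) auto
  also have "?f (x # l) e * \<dots> = entry x \<omega> * (?f l e * prod (?f l) (?J - {e}))"
    by (simp add: at)
  also have "?f l e * prod (?f l) (?J - {e}) = prod (?f l) ?J"
    using e by (intro prod.remove[symmetric]) auto
  finally show ?case using Cons by simp
qed

theorem wick_formula:
  assumes "set l \<subseteq> letters n"
  shows "integrable M (\<lambda>\<omega>. prod_list (map (\<lambda>x. entry x \<omega>) l))"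
    and "expectation (\<lambda>\<omega>. prod_list (map (\<lambda>x. entry x \<omega>) l)) = of_real (wick l)"
proof -
  let ?J = "{1..n} \<times> {1..n}"
  let ?X = "\<lambda>e \<omega>. (case e of (i, j) \<Rightarrow> g i j) \<omega> ^ exponent l e * cnj ((case e of (i, j) \<Rightarrow> g i j) \<omega>) ^ conj_exponent l e"
  have "indep_vars (\<lambda>_. borel) (\<lambda>(i, j). g i j) ?J"
    by (rule indep_vars_subset[OF indep]) auto
  then have ind: "indep_vars (\<lambda>_. borel) ?X ?J"
    by (rule indep_vars_compose2) (auto intro!: borel_measurable_continuous_onI continuous_intros)
  have single: "integrable M (?X e) \<and> expectation (?X e) = of_real (gaussian_mixed_moment (exponent l e) (conj_exponent l e))"
    if "e \<in> ?J" for e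
    using that std_complex_gaussian_moments[OF gaussian] by (cases e) auto
  show "integrable M (\<lambda>\<omega>. prod_list (map (\<lambda>x. entry x \<omega>) l))"
    unfolding prod_entry[OF assms] using single by (intro indep_vars_integrable ind) auto
  have "expectation (\<lambda>\<omega>. prod_list (map (\<lambda>x. entry x \<omega>) l)) = (\<Prod>e\<in>?J. expectation (?X e))"
    unfolding prod_entry[OF assms] using single by (intro indep_vars_lebesgue_integral ind) auto
  also have "\<dots> = of_real (product_moment n l)"
    using single by (simp add: product_moment_def)
  finally show "expectation (\<lambda>\<omega>. prod_list (map (\<lambda>x. entry x \<omega>) l)) = of_real (wick l)"
    by (simp add: product_moment_eq_wick[OF assms])
qed

lemma integrable_path_sum:
  fixes f :: "letter list \<Rightarrow> 'a \<Rightarrow> complex"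
  assumes "a < n" "\<And>m. set m \<subseteq> letters n \<Longrightarrow> integrable M (f m)"
  shows "integrable M (\<lambda>\<omega>. path_sum n w a b (\<lambda>m. f m \<omega>)) \<and>
    expectation (\<lambda>\<omega>. path_sum n w a b (\<lambda>m. f m \<omega>)) = path_sum n w a b (\<lambda>m. expectation (f m))"
  using assms
proof (induction w arbitrary: a f)
  case (Cons s w)
  have "integrable M (\<lambda>\<omega>. path_sum n w c b (\<lambda>m. f ((s, a, c) # m) \<omega>)) \<and>
    expectation (\<lambda>\<omega>. path_sum n w c b (\<lambda>m. f ((s, a, c) # m) \<omega>)) = path_sum n w c b (\<lambda>m. expectation (f ((s, a, c) # m)))"
    if "c < n" for c
    using that Cons.prems by (intro Cons.IH) auto
  then show ?case by auto
qed auto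

lemma integrable_closed_sum:
  fixes f :: "letter list \<Rightarrow> 'a \<Rightarrow> complex"
  assumes "\<And>m. set m \<subseteq> letters n \<Longrightarrow> integrable M (f m)"
  shows "integrable M (\<lambda>\<omega>. closed_sum n w (\<lambda>m. f m \<omega>))"
    and "expectation (\<lambda>\<omega>. closed_sum n w (\<lambda>m. f m \<omega>)) = closed_sum n w (\<lambda>m. expectation (f m))"
  using integrable_path_sum[of _ n f w] assms unfolding closed_sum_def by auto

definition ginibre :: "nat \<Rightarrow> 'a \<Rightarrow> complex mat" where
  "ginibre n \<omega> = normalized_mat (\<lambda>i j. g i j \<omega>) n"

definition trace_word :: "nat \<Rightarrow> bool list \<Rightarrow> 'a \<Rightarrow> complex" where
  "trace_word n w \<omega> = mat_trace (word_mat n (ginibre n \<omega>) w)"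

lemma ginibre_carrier [simp, intro]: "ginibre n \<omega> \<in> carrier_mat n n"
  by (simp add: ginibre_def normalized_mat_def corner_mat_def)

lemma trace_word_eq:
  "trace_word n w \<omega> = closed_sum n w (\<lambda>m. of_real (1 / sqrt n ^ length w) * prod_list (map (\<lambda>x. entry x \<omega>) m))"
proof -
  have c: "real n powr - (1 / 2) = 1 / sqrt n"
    using powr_minus_divide[of "real n" "1 / 2"] by (simp add: powr_half_sqrt)
  have letter: "letter_mat (ginibre n \<omega>) s $$ (a, b) = of_real (1 / sqrt n) * entry (s, a, b) \<omega>"
    if "a < n" "b < n" for s a b
    using that by (auto simp: letter_mat_def ginibre_def normalized_mat_def corner_mat_def adjoint_mat_def entry_def c)
  have "prod_list (map (\<lambda>(s, c, d). letter_mat (ginibre n \<omega>) s $$ (c, d)) m) =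
      of_real (1 / sqrt n ^ length m) * prod_list (map (\<lambda>x. entry x \<omega>) m)" if "set m \<subseteq> letters n" for m
    using that by (induction m) (auto simp: letter)
  then show ?thesis
    unfolding trace_word_def mat_trace_word_mat[OF ginibre_carrier]
    by (intro closed_sum_cong) auto
qed

lemma trace_word_moment:
  assumes "1 \<le> n"
  shows "integrable M (trace_word n w)" "expectation (trace_word n w) = of_real (real n * trace_moment n w)"
proof -
  let ?c = "complex_of_real (1 / sqrt n ^ length w)"
  have eq: "trace_word n w = (\<lambda>\<omega>. closed_sum n w (\<lambda>m. ?c * prod_list (map (\<lambda>x. entry x \<omega>) m)))"
    by (simp only: fun_eq_iff trace_word_eq) simp
  have int: "integrable M (\<lambda>\<omega>. ?c * prod_list (map (\<lambda>x. entry x \<omega>) m))" if "set m \<subseteq> letters n" for m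
    using wick_formula(1)[OF that] by simp
  show "integrable M (trace_word n w)" unfolding eq by (rule integrable_closed_sum[OF int])
  have "expectation (trace_word n w) = closed_sum n w (\<lambda>m. expectation (\<lambda>\<omega>. ?c * prod_list (map (\<lambda>x. entry x \<omega>) m)))"
    unfolding eq by (rule integrable_closed_sum[OF int])
  also have "\<dots> = closed_sum n w (\<lambda>m. ?c * of_real (wick m))"
    by (intro closed_sum_cong) (simp add: wick_formula)
  also have "\<dots> = ?c * of_real (closed_sum n w wick)"
    by (simp only: closed_sum_cmult closed_sum_of_real)
  finally show "expectation (trace_word n w) = of_real (real n * trace_moment n w)"
    using assms by (simp add: trace_moment_def wick_trace_def)
qed

lemma trace_word_moment2:
  assumes "1 \<le> n"
  shows "integrable M (\<lambda>\<omega>. trace_word n u \<omega> * trace_word n v \<omega>)"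
    "expectation (\<lambda>\<omega>. trace_word n u \<omega> * trace_word n v \<omega>) = of_real (real n ^ 2 * trace_moment2 n u v)"
proof -
  let ?c = "complex_of_real (1 / sqrt n ^ (length u + length v))"
  have eq: "trace_word n u \<omega> * trace_word n v \<omega> =
      closed_sum n u (\<lambda>m. closed_sum n v (\<lambda>m'. ?c * prod_list (map (\<lambda>x. entry x \<omega>) (m @ m'))))" for \<omega>
  proof -
    have "closed_sum n u (\<lambda>m. closed_sum n v (\<lambda>m'. ?c * prod_list (map (\<lambda>x. entry x \<omega>) (m @ m')))) =
       closed_sum n u (\<lambda>m. trace_word n v \<omega> * (of_real (1 / sqrt n ^ length u) * prod_list (map (\<lambda>x. entry x \<omega>) m)))"
      unfolding trace_word_eq closed_sum_cmult[symmetric]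
      by (simp add: power_add closed_sum_cmult[symmetric] mult_ac)
    then show ?thesis by (simp only: closed_sum_cmult trace_word_eq[of n u] mult.commute)
  qed
  have int: "integrable M (\<lambda>\<omega>. ?c * prod_list (map (\<lambda>x. entry x \<omega>) (m @ m')))"
    if "set m \<subseteq> letters n" "set m' \<subseteq> letters n" for m m'
    using wick_formula(1)[of "m @ m'" n] that by simp
  have int': "integrable M (\<lambda>\<omega>. closed_sum n v (\<lambda>m'. ?c * prod_list (map (\<lambda>x. entry x \<omega>) (m @ m'))))"
    if "set m \<subseteq> letters n" for m
    by (rule integrable_closed_sum[OF int[OF that]])
  show "integrable M (\<lambda>\<omega>. trace_word n u \<omega> * trace_word n v \<omega>)"
    unfolding eq by (rule integrable_closed_sum[OF int'])
  have "expectation (\<lambda>\<omega>. trace_word n u \<omega> * trace_word n v \<omega>) =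
      closed_sum n u (\<lambda>m. expectation (\<lambda>\<omega>. closed_sum n v (\<lambda>m'. ?c * prod_list (map (\<lambda>x. entry x \<omega>) (m @ m')))))"
    unfolding eq by (rule integrable_closed_sum[OF int'])
  also have "\<dots> = closed_sum n u (\<lambda>m. closed_sum n v (\<lambda>m'. expectation (\<lambda>\<omega>. ?c * prod_list (map (\<lambda>x. entry x \<omega>) (m @ m')))))"
    by (intro closed_sum_cong integrable_closed_sum int)
  also have "\<dots> = closed_sum n u (\<lambda>m. closed_sum n v (\<lambda>m'. of_real (1 / sqrt n ^ (length u + length v) * wick (m @ m'))))"
  proof (intro closed_sum_cong)
    fix m m' assume "set m \<subseteq> letters n" "set m' \<subseteq> letters n"
    then show "expectation (\<lambda>\<omega>. ?c * prod_list (map (\<lambda>x. entry x \<omega>) (m @ m'))) =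
      of_real (1 / sqrt n ^ (length u + length v) * wick (m @ m'))"
      using wick_formula(2)[of "m @ m'" n] by simp
  qed
  also have "\<dots> = of_real (closed_sum n u (\<lambda>m. closed_sum n v (\<lambda>m'. 1 / sqrt n ^ (length u + length v) * wick (m @ m'))))"
    by (simp only: closed_sum_of_real)
  also have "closed_sum n u (\<lambda>m. closed_sum n v (\<lambda>m'. 1 / sqrt n ^ (length u + length v) * wick (m @ m'))) = real n ^ 2 * trace_moment2 n u v"
    using assms by (simp only: closed_sum_cmult) (simp add: trace_moment2_def wick_trace2_def)
  finally show "expectation (\<lambda>\<omega>. trace_word n u \<omega> * trace_word n v \<omega>) = of_real (real n ^ 2 * trace_moment2 n u v)" .
qed

end

section \<open>The Fuss-Catalan recursion\<close>

lemma cauchy_product_partial_le: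
  fixes u v :: "nat \<Rightarrow> real"
  assumes "\<And>i. 0 \<le> u i" "\<And>i. 0 \<le> v i"
  shows "(\<Sum>b\<le>a. \<Sum>c\<le>b. u c * v (b - c)) \<le> (\<Sum>b\<le>a. u b) * (\<Sum>b\<le>a. v b)"
proof -
  have "(\<Sum>b\<le>a. \<Sum>c\<le>b. u c * v (b - c)) = (\<Sum>(i, j)\<in>{(i, j). i + j \<le> a}. u i * v j)"
    by (rule sum.triangle_reindex_eq[symmetric])
  also have "\<dots> \<le> (\<Sum>(i, j)\<in>{..a} \<times> {..a}. u i * v j)"
    using assms by (intro sum_mono2) auto
  also have "\<dots> = (\<Sum>b\<le>a. u b) * (\<Sum>b\<le>a. v b)"
    by (simp add: sum_product sum.cartesian_product)
  finally show ?thesis .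
qed

text \<open>
  A solution \<open>z\<close> of the fixed point inequality dominates all partial sums of the generating function:
  if the partial sum up to \<open>a\<close> for \<open>j = 0\<close> is at most \<open>z\<close>, then the one for \<open>j\<close> is at most
  \<open>z^(j+1)\<close> up to the accumulated errors, and \<open>j = k\<close> gives the partial sum up to \<open>a + 1\<close> for
  \<open>j = 0\<close>. The error may be proportional to the unknown \<open>T 0 a\<close>, because its sum is bounded by \<open>z\<close>
  as well.
\<close>
lemma fuss_recursion_bound:
  fixes T :: "nat \<Rightarrow> nat \<Rightarrow> real"
  assumes nonneg: "\<And>j a. 0 \<le> T j a" and T0: "T 0 0 \<le> 1" and TSuc: "\<And>a. T 0 (Suc a) = T k a"
    and rec: "\<And>j a. 1 \<le> j \<Longrightarrow> j \<le> k \<Longrightarrow> a < N \<Longrightarrow>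
      T j a \<le> (\<Sum>b\<le>a. T (j - 1) b * T 0 (a - b)) + \<eta> * (1 + T 0 a)"
    and x: "0 < x" "x \<le> 1 / 2" and z: "1 \<le> z" and \<eta>: "0 \<le> \<eta>"
    and slack: "1 + x * (z ^ Suc k + real k * (\<eta> * (2 + z)) * z ^ k) \<le> z"
  shows "a \<le> N \<Longrightarrow> (\<Sum>b\<le>a. T 0 b * x ^ b) \<le> z"
proof (induction a)
  case 0
  then show ?case using T0 z by simp
next
  case (Suc a)
  let ?S = "\<lambda>j. \<Sum>b\<le>a. T j b * x ^ b"
  have S0: "?S 0 \<le> z" using Suc by simp
  have S_nonneg: "0 \<le> ?S j" for j using nonneg x by (intro sum_nonneg) auto
  have geom: "(\<Sum>b\<le>a. x ^ b) \<le> 2"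
  proof -
    have "(\<Sum>b\<le>a. x ^ b) \<le> (\<Sum>b\<le>a. (1 / 2) ^ b)"
      using x by (intro sum_mono power_mono) auto
    also have "\<dots> = 2 - (1 / 2) ^ a" by (induction a) auto
    also have "\<dots> \<le> 2" by simp
    finally show ?thesis .
  qed
  have "?S j \<le> z ^ Suc j + real j * (\<eta> * (2 + z)) * z ^ j" if "j \<le> k" for j
    using that
  proof (induction j)
    case 0
    then show ?case using S0 by simp
  next
    case (Suc j)
    define e where "e = \<eta> * (2 + z)"
    have e0: "0 \<le> e" using \<eta> z by (simp add: e_def)
    have "?S (Suc j) \<le> (\<Sum>b\<le>a. ((\<Sum>c\<le>b. T j c * T 0 (b - c)) + \<eta> * (1 + T 0 b)) * x ^ b)"
      using rec[of "Suc j"] Suc.prems \<open>Suc a \<le> N\<close> x by (intro sum_mono mult_right_mono) auto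
    also have "\<dots> = (\<Sum>b\<le>a. \<Sum>c\<le>b. (T j c * x ^ c) * (T 0 (b - c) * x ^ (b - c))) + \<eta> * ((\<Sum>b\<le>a. x ^ b) + ?S 0)"
    proof -
      have "(\<Sum>c\<le>b. T j c * T 0 (b - c)) * x ^ b = (\<Sum>c\<le>b. (T j c * x ^ c) * (T 0 (b - c) * x ^ (b - c)))" for b
        unfolding sum_distrib_right
        by (intro sum.cong refl) (simp add: mult_ac power_add[symmetric])
      then show ?thesis
        by (simp add: distrib_right sum.distrib sum_distrib_left distrib_left mult.assoc)
    qed
    also have "\<dots> \<le> ?S j * ?S 0 + e"
      unfolding e_def using nonneg x \<eta> geom S0
      by (intro add_mono cauchy_product_partial_le mult_left_mono) auto
    finally have 1: "?S (Suc j) \<le> ?S j * ?S 0 + e" .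
    have 2: "?S j * ?S 0 \<le> (z ^ Suc j + real j * e * z ^ j) * z"
      unfolding e_def using Suc S0 S_nonneg z \<eta> by (intro mult_mono) auto
    have 3: "e * 1 \<le> e * z ^ Suc j"
      using e0 z by (intro mult_left_mono one_le_power) auto
    have "?S (Suc j) \<le> (z ^ Suc j + real j * e * z ^ j) * z + e * z ^ Suc j"
      using 1 2 3 by linarith
    also have "\<dots> = z ^ Suc (Suc j) + real (Suc j) * e * z ^ Suc j"
      by (simp add: algebra_simps)
    finally show ?case unfolding e_def .
  qed
  from this[of k] have Sk: "?S k \<le> z ^ Suc k + real k * (\<eta> * (2 + z)) * z ^ k" by simp
  have "(\<Sum>b\<le>Suc a. T 0 b * x ^ b) = T 0 0 + x * ?S k"
    by (simp add: sum.atMost_Suc_shift TSuc sum_distrib_left mult_ac del: sum.atMost_Suc)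
  also have "\<dots> \<le> 1 + x * (z ^ Suc k + real k * (\<eta> * (2 + z)) * z ^ k)"
    using T0 Sk x by (intro add_mono mult_left_mono) auto
  also have "\<dots> \<le> z" by (rule slack)
  finally show ?case .
qed

text \<open>
  \<open>fuss k j a\<close> is the coefficient of \<open>x^a\<close> in \<open>F^(j+1)\<close>, where \<open>F = 1 + x F^(k+1)\<close>; for \<open>j = 0\<close> these
  are the Fuss-Catalan numbers.
\<close>
function fuss :: "nat \<Rightarrow> nat \<Rightarrow> nat \<Rightarrow> real" where
  "fuss k 0 0 = 1"
| "fuss k 0 (Suc a) = fuss k k a"
| "fuss k (Suc j) a = (\<Sum>b\<le>a. fuss k j b * fuss k 0 (a - b))"
  by pat_completeness auto
termination
  by (relation "measures [\<lambda>(k, j, a). a, \<lambda>(k, j, a). j]") auto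

lemma fuss_nonneg: "0 \<le> fuss k j a"
  by (induction k j a rule: fuss.induct) (auto intro!: sum_nonneg mult_nonneg_nonneg)

lemma fuss_le_trace_moment:
  assumes "1 \<le> n"
  shows "j \<le> k \<Longrightarrow> fuss k j a \<le> trace_moment n (fuss_word k j a)"
proof (induction k j a rule: fuss.induct)
  case (1 k)
  then show ?case using assms by (simp add: fuss_word_0 trace_moment_Nil)
next
  case (2 k a)
  then show ?case using trace_moment_fuss_word_last[of n k a] by simp
next
  case (3 k j a)
  have "fuss k (Suc j) a \<le> (\<Sum>b\<le>a. trace_moment n (fuss_word k j b) * trace_moment n (fuss_word k 0 (a - b)))"
    unfolding fuss.simps using 3
    by (intro sum_mono mult_mono) (auto simp: fuss_nonneg trace_moment_nonneg)
  also have "\<dots> \<le> trace_moment n (fuss_word k (Suc j) a)"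
    using trace_moment_fuss_word_ge[OF assms, of "Suc j" k a] 3 by simp
  finally show ?case .
qed

definition gamma_squared :: "nat \<Rightarrow> real" where
  "gamma_squared k = real ((k + 1) ^ (k + 1)) / real (k ^ k)"

lemma gamma_squared_ge_2: "1 \<le> k \<Longrightarrow> 2 \<le> gamma_squared k"
proof -
  assume k: "1 \<le> k"
  have "2 * real k ^ k \<le> real (k + 1) * real (k + 1) ^ k"
    using k by (intro mult_mono power_mono) auto
  then show ?thesis using k by (simp add: gamma_squared_def field_simps)
qed

text \<open>
  At the critical parameter \<open>x = \<gamma>^(-2)\<close> the double root of \<open>z = 1 + x z^(k+1)\<close> is \<open>(k+1)/k\<close>.
\<close>
lemma fuss_fixed_point:
  assumes "1 \<le> k"
  shows "1 + (1 / gamma_squared k) * ((real k + 1) / real k) ^ Suc k = (real k + 1) / real k"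
proof -
  have "real ((k + 1) ^ (k + 1)) = (real k + 1) ^ Suc k"
    by (simp only: of_nat_power of_nat_add of_nat_1 Suc_eq_plus1)
  moreover have "(1 / (u / v)) * (u / (real k * v)) = 1 / real k" if "u \<noteq> 0" "v \<noteq> 0" for u v :: real
    using that by simp
  ultimately have "(1 / gamma_squared k) * ((real k + 1) / real k) ^ Suc k = 1 / real k"
    using assms unfolding gamma_squared_def power_divide power_Suc[of "real k"] by (simp del: power_Suc)
  then show ?thesis using assms by (simp add: field_simps del: power_Suc)
qed

text \<open>
  After rescaling \<open>z\<close> by the double root this is Bernoulli's inequality.
\<close>
lemma fuss_fixed_point_max:
  assumes "1 \<le> k" "0 \<le> z"
  shows "z - 1 \<le> (1 / gamma_squared k) * z ^ Suc k"
proof -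
  define s where "s = z * real k / (real k + 1)"
  have z: "z = s * ((real k + 1) / real k)" using assms by (simp add: s_def)
  have "1 + real (Suc k) * (s - 1) \<le> (1 + (s - 1)) ^ Suc k"
    using assms by (intro Bernoulli_inequality) (simp add: s_def)
  then have "(1 + real (Suc k) * (s - 1)) / real k \<le> s ^ Suc k / real k"
    using assms by (intro divide_right_mono) auto
  also have "s ^ Suc k / real k = s ^ Suc k * ((real k + 1) / real k - 1)"
    using assms by (simp add: field_simps)
  also have "\<dots> = s ^ Suc k * ((1 / gamma_squared k) * ((real k + 1) / real k) ^ Suc k)"
    using fuss_fixed_point[OF assms(1)] by (metis add_diff_cancel_left')
  also have "\<dots> = (1 / gamma_squared k) * z ^ Suc k"
    unfolding z power_mult_distrib by simp
  also have "(1 + real (Suc k) * (s - 1)) / real k = z - 1"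
    unfolding z using assms by (simp add: field_simps)
  finally show ?thesis .
qed

text \<open>
  If all these numbers were below \<open>y^m\<close>, the generating function would converge at some \<open>x\<close> beyond
  the critical parameter, and its value would solve \<open>z = 1 + x z^(k+1)\<close>, which has no positive
  solution there.
\<close>
lemma fuss_growth:
  assumes "1 \<le> k" "0 < y" "y < gamma_squared k"
  obtains m where "1 \<le> m" "y ^ m \<le> fuss k 0 m"
proof (rule ccontr)
  assume no: "\<not> thesis"
  note hyp = that
  have small: "fuss k 0 m < y ^ m" if "1 \<le> m" for m
    using hyp[of m] that no by (meson not_le)
  define x where "x = 2 / (y + gamma_squared k)"
  have x: "0 < x" "x * y < 1" "1 < x * gamma_squared k" using assms by (auto simp: x_def field_simps)
  let ?F = "\<lambda>j a. fuss k j a * x ^ a"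
  have F_nonneg: "0 \<le> ?F j a" for j a using x by (simp add: fuss_nonneg)
  have sum0: "summable (?F 0)"
  proof (rule summable_comparison_test')
    show "summable (\<lambda>a. (x * y) ^ a)" using x assms by (intro summable_geometric) auto
    fix a
    have "fuss k 0 a \<le> y ^ a" using small[of a] by (cases "a = 0") auto
    then show "norm (?F 0 a) \<le> (x * y) ^ a"
      using x fuss_nonneg[of k 0 a] by (simp add: power_mult_distrib abs_mult mult.commute mult_left_mono)
  qed
  define z where "z = suminf (?F 0)"
  have "summable (?F j) \<and> suminf (?F j) = z ^ Suc j" for j
  proof (induction j)
    case 0
    then show ?case using sum0 by (simp add: z_def)
  next
    case (Suc j)
    have eq: "?F (Suc j) a = (\<Sum>b\<le>a. ?F j b * ?F 0 (a - b))" for a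
      unfolding fuss.simps sum_distrib_right
      by (intro sum.cong refl) (simp add: mult_ac power_add[symmetric])
    have "(\<lambda>a. \<Sum>b\<le>a. ?F j b * ?F 0 (a - b)) sums (suminf (?F j) * suminf (?F 0))"
      using Suc sum0 F_nonneg by (intro Cauchy_product_sums) auto
    then show ?case unfolding eq[symmetric] using Suc by (auto simp: sums_iff z_def)
  qed
  then have k: "summable (?F k)" "suminf (?F k) = z ^ Suc k" by auto
  have "z = ?F 0 0 + (\<Sum>a. ?F 0 (Suc a))"
    unfolding z_def using suminf_split_head[OF sum0] by simp
  also have "(\<Sum>a. ?F 0 (Suc a)) = (\<Sum>a. x * ?F k a)" by (simp add: mult_ac)
  also have "\<dots> = x * z ^ Suc k" using k by (simp only: suminf_mult)
  finally have z_eq: "z = 1 + x * z ^ Suc k" by simp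
  have z0: "0 \<le> z" unfolding z_def by (intro suminf_nonneg sum0 F_nonneg)
  have "0 \<le> x * z ^ Suc k" using x z0 by (intro mult_nonneg_nonneg zero_le_power) auto
  then have z1: "0 < z" using z_eq by linarith
  have "x * z ^ Suc k \<le> (1 / gamma_squared k) * z ^ Suc k"
    using fuss_fixed_point_max[OF assms(1) z0] z_eq by linarith
  then have "x \<le> 1 / gamma_squared k" by (rule mult_right_le_imp_le) (use z1 in simp)
  then show False using x assms by (simp add: field_simps)
qed

section \<open>Trace inequalities for a fixed matrix\<close>

lemma block_word_singletons: "block_word 1 (length w) 0 w"
proof (induction w)
  case (Cons s w)
  then have "block_word 1 (Suc (length w)) 0 (replicate 1 s @ w)" by (rule block_full)
  then show ?case by simp
qed (simp add: block_Nil)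

lemma rev_map_Not_periods: "rev (map Not (periods k a)) = periods k a"
proof -
  have "replicate k False @ replicate k True @ periods k a = periods k a @ replicate k False @ replicate k True" for a
    by (induction a) (auto simp: periods_Suc)
  then show ?thesis by (induction a) (auto simp: periods_Suc)
qed

lemma mat_trace_adjoint: "A \<in> carrier_mat n n \<Longrightarrow> mat_trace (adjoint_mat A) = cnj (mat_trace A)"
  by (auto simp: mat_trace_def adjoint_mat_def intro!: sum.cong)

lemma Im_mat_trace_periods:
  assumes "A \<in> carrier_mat n n"
  shows "Im (mat_trace (word_mat n A (periods k a))) = 0"
proof -
  have "cnj (mat_trace (word_mat n A (periods k a))) = mat_trace (word_mat n A (periods k a))"
    using mat_trace_adjoint[OF word_mat_carrier[OF assms], of "periods k a"]
    by (simp add: adjoint_word_mat[OF assms] rev_map_Not_periods)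
  then show ?thesis by (simp add: complex_eq_iff)
qed

lemma trace_le_operator_norm_power:
  assumes "A \<in> carrier_mat n n"
  shows "Re (mat_trace (word_mat n A (periods k m))) \<le> real n * operator_norm_mat (A ^\<^sub>m k) ^ (2 * m)"
proof -
  have "Re (mat_trace (word_mat n A (periods k m))) \<le> real n * operator_norm_mat (word_mat n A (periods k m))"
    using norm_mat_trace_le[OF word_mat_carrier[OF assms], of "periods k m"] complex_Re_le_cmod order_trans by blast
  also have "operator_norm_mat (word_mat n A (periods k m)) \<le>
      max 1 (operator_norm_mat A) ^ ((k - 1) * 0) * operator_norm_mat (A ^\<^sub>m k) ^ (2 * m)"
    by (intro operator_norm_block_word_le[OF assms block_word_periods]) auto
  finally show ?thesis by (simp add: mult_left_mono)
qed

lemma operator_norm_mat_power_le_trace: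
  assumes "A \<in> carrier_mat n n" "1 \<le> m"
  shows "operator_norm_mat (A ^\<^sub>m k) ^ (2 * m) \<le> Re (mat_trace (word_mat n A (periods k m)))"
  using operator_norm_power_le_trace[of "A ^\<^sub>m k" n m] assms word_mat_periods[OF assms(1), of k m] by simp

lemma max_operator_norm_power_le_trace:
  assumes "A \<in> carrier_mat n n" "1 \<le> n"
  shows "max 1 (operator_norm_mat A) ^ (2 * m) \<le> 1 + Re (mat_trace (word_mat n A (periods 1 m)))"
proof (cases "m = 0")
  case False
  then have *: "operator_norm_mat A ^ (2 * m) \<le> Re (mat_trace (word_mat n A (periods 1 m)))"
    using operator_norm_power_le_trace[OF assms(1), of m] by simp
  moreover have "0 \<le> operator_norm_mat A ^ (2 * m)" by (intro zero_le_power operator_norm_mat_nonneg)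
  ultimately have "0 \<le> Re (mat_trace (word_mat n A (periods 1 m)))" by linarith
  with * show ?thesis by (auto simp: max_def)
qed (use assms in \<open>simp add: mat_trace_def\<close>)

text \<open>
  For \<open>k = 1\<close> short blocks are empty, and the norm of the matrix enters only with the exponent \<open>2 a\<close>.
\<close>
lemma block_trace_le_1:
  assumes A: "A \<in> carrier_mat n n" and n: "1 \<le> n"
    and w: "block_word 1 r p w" and r: "r \<le> 2 * a"
  shows "Re (mat_trace (word_mat n A w)) \<le> real n * (1 + Re (mat_trace (word_mat n A (periods 1 a))))"
proof -
  define R where "R = max 1 (operator_norm_mat A)"
  have "Re (mat_trace (word_mat n A w)) \<le> real n * operator_norm_mat (word_mat n A w)"
    using norm_mat_trace_le[OF word_mat_carrier[OF A, of w]] complex_Re_le_cmod order_trans by blast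
  also have "operator_norm_mat (word_mat n A w) \<le> R ^ ((1 - 1) * p) * R ^ r"
    using A by (intro operator_norm_block_word_le[OF A w]) (auto simp: R_def)
  also have "\<dots> \<le> R ^ (2 * a)" using r by (simp add: R_def power_increasing)
  also have "\<dots> \<le> 1 + Re (mat_trace (word_mat n A (periods 1 a)))"
    unfolding R_def by (rule max_operator_norm_power_le_trace[OF A n])
  finally show ?thesis by (simp add: mult_left_mono)
qed

text \<open>
  The bound by \<open>1\<close> plus a trace alone would lose a factor \<open>n\<close>, and the resulting variance bound of
  order \<open>1/n\<close> would not be summable. The interpolation \<open>t \<le> sqrt n + t^3 / n\<close> for \<open>t = R^(2 L)\<close>
  reduces the loss to \<open>sqrt n\<close>.
\<close>
lemma trace_le_truncated:
  assumes A: "A \<in> carrier_mat n n" and n: "1 \<le> n" and w: "length w \<le> 2 * L"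
  shows "Re (mat_trace (word_mat n A w)) \<le>
    real n * (sqrt n + (1 + Re (mat_trace (word_mat n A (periods 1 (3 * L))))) / real n)"
proof -
  define R where "R = max 1 (operator_norm_mat A)"
  have R1: "1 \<le> R" by (simp add: R_def)
  have "Re (mat_trace (word_mat n A w)) \<le> real n * operator_norm_mat (word_mat n A w)"
    using norm_mat_trace_le[OF word_mat_carrier[OF A, of w]] complex_Re_le_cmod order_trans by blast
  also have "operator_norm_mat (word_mat n A w) \<le> R ^ ((1 - 1) * 0) * R ^ length w"
    using A by (intro operator_norm_block_word_le[OF A block_word_singletons]) (auto simp: R_def)
  also have "\<dots> \<le> R ^ (2 * L)" using w R1 by (simp add: power_increasing)
  also have "\<dots> \<le> sqrt n + R ^ (2 * (3 * L)) / real n"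
  proof (cases "R ^ (2 * L) \<le> sqrt n")
    case True
    then show ?thesis using R1 by (simp add: add_increasing2)
  next
    case False
    then have "real n \<le> R ^ (2 * L) * R ^ (2 * L)"
      using mult_mono[of "sqrt n" "R ^ (2 * L)" "sqrt n" "R ^ (2 * L)"] R1 by simp
    then have "R ^ (2 * L) * real n \<le> R ^ (2 * L) * (R ^ (2 * L) * R ^ (2 * L))"
      using R1 by (intro mult_left_mono) auto
    also have "\<dots> = R ^ (2 * (3 * L))" by (simp add: power_add[symmetric])
    finally have "R ^ (2 * L) \<le> R ^ (2 * (3 * L)) / real n" using n by (simp add: field_simps)
    then show ?thesis by (simp add: add_increasing)
  qed
  also have "R ^ (2 * (3 * L)) \<le> 1 + Re (mat_trace (word_mat n A (periods 1 (3 * L))))"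
    unfolding R_def by (rule max_operator_norm_power_le_trace[OF A n])
  finally show ?thesis by (simp add: mult_left_mono divide_right_mono)
qed

section \<open>Bounds for the trace moments of the Gaussian array\<close>

context gaussian_array
begin

lemma trace_word_Re:
  assumes "1 \<le> n"
  shows "integrable M (\<lambda>\<omega>. Re (trace_word n w \<omega>))" "expectation (\<lambda>\<omega>. Re (trace_word n w \<omega>)) = real n * trace_moment n w"
  using trace_word_moment[OF assms, of w] by auto

lemma trace_moment_le_1:
  assumes n: "1 \<le> n" and w: "block_word 1 r p w" "r \<le> 2 * a"
  shows "trace_moment n w \<le> 1 + real n * trace_moment n (periods 1 a)"
proof -
  have "expectation (\<lambda>\<omega>. Re (trace_word n w \<omega>)) \<le> expectation (\<lambda>\<omega>. real n * (1 + Re (trace_word n (periods 1 a) \<omega>)))"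
    using trace_word_Re(1)[OF n] block_trace_le_1[OF ginibre_carrier n w] unfolding trace_word_def
    by (intro integral_mono) (auto simp: trace_word_def[symmetric])
  also have "\<dots> = real n * (1 + real n * trace_moment n (periods 1 a))"
    using trace_word_Re[OF n, of "periods 1 a"] by (simp add: prob_space)
  finally show ?thesis using n by (simp add: trace_word_Re)
qed

text \<open>
  The recursion for \<open>k = 1\<close> at \<open>x = 1/8\<close>, where \<open>z = 2\<close> leaves room for an error: the critical
  parameter is \<open>1/4\<close>, corresponding to the limit \<open>2\<close> of the norm itself.
\<close>
lemma trace_moment_periods_1_le:
  assumes n: "16 * N ^ 3 \<le> n" "1 \<le> n"
  shows "trace_moment n (periods 1 N) \<le> 2 * 8 ^ N"
proof -
  let ?T = "\<lambda>j a. trace_moment n (fuss_word 1 j a)"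
  define \<eta> where "\<eta> = 8 * real N ^ 3 / real n"
  have "16 * real N ^ 3 \<le> real n" using n(1) by (metis of_nat_le_iff of_nat_mult of_nat_numeral of_nat_power)
  then have \<eta>: "0 \<le> \<eta>" "\<eta> \<le> 1 / 2" using n(2) by (auto simp: \<eta>_def field_simps)
  have rec: "?T j a \<le> (\<Sum>b\<le>a. ?T (j - 1) b * ?T 0 (a - b)) + \<eta> * (1 + ?T 0 a)"
    if "1 \<le> j" "j \<le> 1" "a < N" for j a
  proof -
    let ?B = "1 + real n * ?T 0 a"
    have "?T j a \<le> (\<Sum>b\<le>a. ?T (j - 1) b * ?T 0 (a - b)) + 8 * real (1 * (a + 1)) ^ 3 * ?B / real n ^ 2"
      using that by (intro trace_moment_fuss_word_le[OF n(2)])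
        (auto simp: fuss_word_0 trace_moment_nonneg intro!: trace_moment_le_1[OF n(2), simplified])
    also have "8 * real (1 * (a + 1)) ^ 3 * ?B / real n ^ 2 \<le> 8 * real N ^ 3 * (real n * (1 + ?T 0 a)) / real n ^ 2"
      using that n(2) by (intro divide_right_mono mult_mono power_mono)
        (auto simp: trace_moment_nonneg algebra_simps)
    also have "\<dots> = \<eta> * (1 + ?T 0 a)" using n(2) by (simp add: \<eta>_def power2_eq_square)
    finally show ?thesis by simp
  qed
  have "(\<Sum>b\<le>N. ?T 0 b * (1 / 8) ^ b) \<le> 2"
  proof (rule fuss_recursion_bound[where k = 1 and N = N and \<eta> = \<eta>])
    show "?T 0 (Suc a) = ?T 1 a" for a using trace_moment_fuss_word_last[of n 1 a] by simp
    show "1 + 1 / 8 * (2 ^ Suc 1 + real 1 * (\<eta> * (2 + 2)) * 2 ^ 1) \<le> 2" using \<eta> by simp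
  qed (use rec \<eta> n(2) in \<open>auto simp: trace_moment_nonneg trace_moment_Nil fuss_word_0\<close>)
  moreover have "?T 0 N * (1 / 8) ^ N \<le> (\<Sum>b\<le>N. ?T 0 b * (1 / 8) ^ b)"
    by (intro member_le_sum) (auto simp: trace_moment_nonneg)
  ultimately have "?T 0 N * (1 / 8) ^ N \<le> 2" by linarith
  then show ?thesis by (simp add: fuss_word_0 power_divide field_simps)
qed

text \<open>
  In the recursion this bound is multiplied by \<open>n^(-2)\<close>, so that a factor \<open>1/n\<close> remains.
\<close>
lemma trace_moment_block_le:
  assumes n: "1 \<le> n" "16 * Q ^ 3 \<le> n" and k: "1 \<le> k"
    and w: "block_word k r p w" "r \<le> 2 * a" "p \<le> 8" and Q: "8 * k + 2 * (k * a) \<le> Q"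
  shows "trace_moment n w \<le> (8 ^ (8 * k) + 2) * (real n * (1 + trace_moment n (periods k a)))"
proof -
  let ?t = "\<lambda>w \<omega>. Re (trace_word n w \<omega>)"
  have "expectation (?t w) \<le> expectation (\<lambda>\<omega>. real n * (8 ^ (8 * k) * (1 + ?t (periods k a) \<omega>) + (1 / 8) ^ Q * ?t (periods 1 Q) \<omega>))"
    using trace_word_Re(1)[OF n(1)] block_trace_le[OF ginibre_carrier n(1) k w Q]
    by (intro integral_mono) (auto simp: trace_word_def)
  also have "\<dots> = real n * (8 ^ (8 * k) * (1 + real n * trace_moment n (periods k a)) +
      (1 / 8) ^ Q * (real n * trace_moment n (periods 1 Q)))"
    using trace_word_Re[OF n(1)] by (simp add: prob_space)
  finally have "trace_moment n w \<le> 8 ^ (8 * k) * (1 + real n * trace_moment n (periods k a)) +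
      (1 / 8) ^ Q * (real n * trace_moment n (periods 1 Q))"
    using n by (simp add: trace_word_Re)
  also have "\<dots> \<le> 8 ^ (8 * k) * (real n + real n * trace_moment n (periods k a)) +
      (1 / 8) ^ Q * (real n * (2 * 8 ^ Q))"
    using n trace_moment_periods_1_le[OF n(2,1)] by (intro add_mono mult_left_mono) auto
  also have "(1 / 8) ^ Q * (real n * (2 * 8 ^ Q)) = 2 * real n" by (simp add: power_divide)
  also have "2 * real n \<le> 2 * (real n + real n * trace_moment n (periods k a))"
    by (simp add: trace_moment_nonneg)
  finally show ?thesis by (simp add: algebra_simps)
qed

text \<open>
  The exponential growth rate of the moments is at most \<open>\<gamma>^2\<close>, uniformly as long as the cube of the
  order is small compared with \<open>n\<close>.
\<close>
theorem trace_moment_periods_le: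
  assumes k: "1 \<le> k" and x: "0 < x" "x < 1 / gamma_squared k"
  obtains D z :: real where "\<And>n N. 1 \<le> n \<Longrightarrow> D * (real N + 1) ^ 3 \<le> real n \<Longrightarrow>
    trace_moment n (periods k N) \<le> z * (1 / x) ^ N"
proof -
  define z where "z = (real k + 1) / real k"
  have z: "1 \<le> z" using k by (simp add: z_def)
  have "x * z ^ Suc k < 1 / gamma_squared k * z ^ Suc k"
    using x z by (intro mult_strict_right_mono) auto
  then have gap: "1 + x * z ^ Suc k < z"
    using fuss_fixed_point[OF k] unfolding z_def[symmetric] by linarith
  \<comment> \<open>The largest error that the gap can absorb.\<close>
  define \<eta> where "\<eta> = (z - 1 - x * z ^ Suc k) / (x * (real k * (2 + z) * z ^ k))"
  have den: "0 < x * (real k * (2 + z) * z ^ k)" using x k z by simp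
  have \<eta>: "0 < \<eta>" using gap den by (simp add: \<eta>_def)
  have "x * (real k * (2 + z) * z ^ k) * \<eta> = z - 1 - x * z ^ Suc k"
  proof -
    have "d * (u / d) = u" if "0 < d" for d u :: real using that by simp
    from this[OF den] show ?thesis unfolding \<eta>_def .
  qed
  then have slack: "1 + x * (z ^ Suc k + real k * (\<eta> * (2 + z)) * z ^ k) \<le> z"
    by (simp add: algebra_simps)
  have x2: "x \<le> 1 / 2"
    using x gamma_squared_ge_2[OF k] by (intro order_trans[OF less_imp_le[OF x(2)]]) (simp add: field_simps)
  define C where "C = 8 * real k ^ 3 * (8 ^ (8 * k) + 2)"
  \<comment> \<open>The first summand makes the relative error \<open>C N^3 / n\<close> at most \<open>\<eta>\<close>; the second allows the bound
    for \<open>k = 1\<close> to be used up to the order \<open>Q\<close> chosen below.\<close>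
  define D where "D = C / \<eta> + 16 * (8 * real k) ^ 3"
  have C0: "0 \<le> C" by (simp add: C_def)
  have "trace_moment n (periods k N) \<le> z * (1 / x) ^ N"
    if n: "1 \<le> n" and D: "D * (real N + 1) ^ 3 \<le> real n" for n N
  proof -
    let ?T = "\<lambda>j a. trace_moment n (fuss_word k j a)"
    define Q where "Q = 8 * k + 2 * (k * N)"
    have "real (16 * Q ^ 3) = 16 * real Q ^ 3" by simp
    also have "real Q \<le> 8 * real k * (real N + 1)" by (simp add: Q_def algebra_simps)
    then have "16 * real Q ^ 3 \<le> 16 * (8 * real k * (real N + 1)) ^ 3"
      by (intro mult_left_mono power_mono) auto
    also have "\<dots> = 16 * (8 * real k) ^ 3 * (real N + 1) ^ 3" by (simp add: power_mult_distrib)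
    also have "\<dots> \<le> D * (real N + 1) ^ 3"
      using C0 \<eta> by (intro mult_right_mono) (auto simp: D_def)
    also have "\<dots> \<le> real n" by (rule D)
    finally have Q: "16 * Q ^ 3 \<le> n" by (simp only: of_nat_le_iff)
    have "C / \<eta> * real N ^ 3 \<le> D * (real N + 1) ^ 3"
      using C0 \<eta> by (intro mult_mono power_mono) (auto simp: D_def)
    also have "\<dots> \<le> real n" by (rule D)
    finally have small: "C * real N ^ 3 / real n \<le> \<eta>" using \<eta> n by (simp add: field_simps)
    have rec: "?T j a \<le> (\<Sum>b\<le>a. ?T (j - 1) b * ?T 0 (a - b)) + \<eta> * (1 + ?T 0 a)"
      if ja: "1 \<le> j" "j \<le> k" "a < N" for j a
    proof -
      let ?B = "(8 ^ (8 * k) + 2) * (real n * (1 + ?T 0 a))"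
      have "k * a \<le> k * N" using ja by simp
      then have "8 * k + 2 * (k * a) \<le> Q" by (simp add: Q_def)
      then have "?T j a \<le> (\<Sum>b\<le>a. ?T (j - 1) b * ?T 0 (a - b)) + 8 * real (k * (a + 1)) ^ 3 * ?B / real n ^ 2"
        using trace_moment_block_le[OF n Q k] ja
        by (intro trace_moment_fuss_word_le[OF n]) (auto simp: fuss_word_0 trace_moment_nonneg)
      also have "8 * real (k * (a + 1)) ^ 3 * ?B / real n ^ 2 \<le> 8 * (real k * real N) ^ 3 * ?B / real n ^ 2"
      proof -
        have "k * (a + 1) \<le> k * N" using ja by (intro mult_le_mono2) auto
        then have "real (k * (a + 1)) \<le> real k * real N"
          by (simp only: of_nat_mult[symmetric] of_nat_le_iff)
        then show ?thesis
          by (intro divide_right_mono mult_right_mono mult_left_mono power_mono) (auto simp: trace_moment_nonneg)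
      qed
      also have "\<dots> = C * real N ^ 3 / real n * (1 + ?T 0 a)"
        using n by (simp add: C_def power2_eq_square power_mult_distrib)
      also have "\<dots> \<le> \<eta> * (1 + ?T 0 a)"
        using small by (intro mult_right_mono) (auto simp: trace_moment_nonneg)
      finally show ?thesis by simp
    qed
    have "(\<Sum>b\<le>N. ?T 0 b * x ^ b) \<le> z"
    proof (rule fuss_recursion_bound[where k = k and N = N and \<eta> = \<eta>])
      show "?T 0 (Suc a) = ?T k a" for a using trace_moment_fuss_word_last[of n k a] by simp
    qed (use rec \<eta> n x x2 z slack in \<open>auto simp: trace_moment_nonneg trace_moment_Nil fuss_word_0\<close>)
    moreover have "?T 0 N * x ^ N \<le> (\<Sum>b\<le>N. ?T 0 b * x ^ b)"
      using x by (intro member_le_sum) (auto simp: trace_moment_nonneg)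
    ultimately show ?thesis using x by (simp add: fuss_word_0 power_divide field_simps)
  qed
  then show ?thesis using that by blast
qed

lemma trace_moment_truncated_le:
  assumes n: "1 \<le> n" "16 * (3 * L) ^ 3 \<le> n" and w: "length w \<le> 2 * L"
  shows "trace_moment n w \<le> sqrt n + 1 + 2 * 8 ^ (3 * L)"
proof -
  let ?t = "\<lambda>w \<omega>. Re (trace_word n w \<omega>)"
  have "expectation (?t w) \<le> expectation (\<lambda>\<omega>. real n * (sqrt n + (1 + ?t (periods 1 (3 * L)) \<omega>) / real n))"
    using trace_word_Re(1)[OF n(1)] trace_le_truncated[OF ginibre_carrier n(1) w]
    by (intro integral_mono) (auto simp: trace_word_def)
  also have "\<dots> = real n * (sqrt n + (1 + real n * trace_moment n (periods 1 (3 * L))) / real n)"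
    using trace_word_Re[OF n(1)] by (simp add: prob_space)
  finally have "trace_moment n w \<le> sqrt n + 1 / real n + trace_moment n (periods 1 (3 * L))"
    using n by (simp add: trace_word_Re add_divide_distrib)
  also have "\<dots> \<le> sqrt n + 1 + 2 * 8 ^ (3 * L)"
    using n trace_moment_periods_1_le[OF n(2,1)] by (intro add_mono) auto
  finally show ?thesis .
qed

text \<open>
  The trace of \<open>(Y*^k Y^k)^m\<close> is real, so that the second moment of its real part is that of the
  trace.
\<close>
lemma variance_trace_le:
  assumes n: "1 \<le> n" "16 * (3 * length w) ^ 3 \<le> n" and w: "w = periods k m"
  defines "V \<equiv> \<lambda>\<omega>. Re (trace_word n w \<omega>) / real n"
  shows "integrable M V" "integrable M (\<lambda>\<omega>. V \<omega> ^ 2)" "expectation V = trace_moment n w"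
    "variance V \<le> 2 * real (length w) ^ 2 * (sqrt n + 1 + 2 * 8 ^ (3 * length w)) / real n ^ 2"
proof -
  show int: "integrable M V" and exp: "expectation V = trace_moment n w"
    unfolding V_def using trace_word_Re[OF n(1), of w] n by auto
  have sq: "V \<omega> ^ 2 = Re (trace_word n w \<omega> * trace_word n w \<omega>) / real n ^ 2" for \<omega>
    using Im_mat_trace_periods[OF ginibre_carrier, of n \<omega> k m]
    by (simp add: V_def trace_word_def w power2_eq_square)
  show int2: "integrable M (\<lambda>\<omega>. V \<omega> ^ 2)"
    unfolding sq
    by (intro integrable_divide integrable_bounded_linear[OF bounded_linear_Re] trace_word_moment2(1)[OF n(1)])
  have "expectation (\<lambda>\<omega>. V \<omega> ^ 2) = trace_moment2 n w w"
  proof -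
    have "expectation (\<lambda>\<omega>. Re (trace_word n w \<omega> * trace_word n w \<omega>)) = Re (of_real (real n ^ 2 * trace_moment2 n w w))"
      unfolding trace_word_moment2(2)[OF n(1), of w w, symmetric]
      by (intro integral_bounded_linear[OF bounded_linear_Re] trace_word_moment2(1)[OF n(1)])
    then show ?thesis unfolding sq using n by (simp del: times_complex.sel of_real_mult)
  qed
  then have "variance V = trace_moment2 n w w - trace_moment n w * trace_moment n w"
    using variance_eq[OF int int2] exp by (simp add: power2_eq_square)
  also have "\<dots> \<le> merge_sum n w w / real n ^ 2"
    using trace_moment2_le[OF n(1), of w w] by simp
  also have "\<dots> \<le> 2 * real (length w) * real (length w) * (sqrt n + 1 + 2 * 8 ^ (3 * length w)) / real n ^ 2"
    by (intro divide_right_mono merge_sum_le trace_moment_truncated_le[OF n]) (auto dest: arg_cong[of _ _ length])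
  finally show "variance V \<le> 2 * real (length w) ^ 2 * (sqrt n + 1 + 2 * 8 ^ (3 * length w)) / real n ^ 2"
    by (simp add: power2_eq_square)
qed

section \<open>Almost sure convergence\<close>

lemma Re_trace_word_periods_nonneg: "0 \<le> Re (trace_word n (periods k m) \<omega>)"
proof (cases "m = 0")
  case True
  then show ?thesis by (simp add: trace_word_def mat_trace_def)
next
  case False
  have "0 \<le> operator_norm_mat (ginibre n \<omega> ^\<^sub>m k) ^ (2 * m)"
    by (intro zero_le_power operator_norm_mat_nonneg)
  also have "\<dots> \<le> Re (trace_word n (periods k m) \<omega>)"
    unfolding trace_word_def using False by (intro operator_norm_mat_power_le_trace) auto
  finally show ?thesis .
qed

lemma prob_trace_word_ge_le:
  assumes n: "1 \<le> n" and c: "0 < c"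
  shows "prob {\<omega> \<in> space M. c \<le> Re (trace_word n (periods k N) \<omega>)} \<le> real n * trace_moment n (periods k N) / c"
  using integral_Markov_inequality_measure[OF trace_word_Re(1)[OF n], of "{}" "periods k N" c] c
  by (simp add: Re_trace_word_periods_nonneg trace_word_Re(2)[OF n])

lemma measurable_trace_word [measurable]:
  "1 \<le> n \<Longrightarrow> (\<lambda>\<omega>. Re (trace_word n w \<omega>)) \<in> borel_measurable M"
  by (rule borel_measurable_integrable[OF trace_word_Re(1)])

text \<open>
  Markov's inequality for a moment of order \<open>N\<close> gives a tail bound \<open>n z (x y)^(-N)\<close>. The choice
  \<open>N = n^(1/4)\<close>, rounded down, is large enough to make it summable and small enough for
  \<open>D (N+1)^3 \<le> n\<close>.
\<close>
lemma eventually_operator_norm_less: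
  assumes k: "1 \<le> k" and y: "gamma_squared k < y"
  shows "AE \<omega> in M. eventually (\<lambda>n. operator_norm_mat (ginibre n \<omega> ^\<^sub>m k) ^ 2 < y) sequentially"
proof -
  have g: "2 \<le> gamma_squared k" by (rule gamma_squared_ge_2[OF k])
  define x where "x = 2 / (y + gamma_squared k)"
  have x: "0 < x" "x < 1 / gamma_squared k" "1 < x * y" using y g by (auto simp: x_def field_simps)
  obtain D z :: real where Dz: "\<And>n N. 1 \<le> n \<Longrightarrow> D * (real N + 1) ^ 3 \<le> real n \<Longrightarrow>
    trace_moment n (periods k N) \<le> z * (1 / x) ^ N"
    using trace_moment_periods_le[OF k x(1,2)] by blast
  define D' z' where "D' = \<bar>D\<bar> + 1" and "z' = \<bar>z\<bar> + 1"
  have D': "0 < D'" "D \<le> D'" and z': "0 < z'" "z \<le> z'" by (auto simp: D'_def z'_def)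
  define N where "N n = nat \<lfloor>real n powr (1 / 4)\<rfloor>" for n
  have N_le: "real (N n) \<le> real n powr (1 / 4)" and N_ge: "real n powr (1 / 4) - 1 \<le> real (N n)" for n
    using powr_ge_zero[of "real n" "1 / 4"] unfolding N_def by linarith+
  define c where "c = ln (x * y)"
  have c: "0 < c" using x by (simp add: c_def)
  define A where "A n = (if n = 0 then {} else {\<omega> \<in> space M. y ^ N n \<le> Re (trace_word n (periods k (N n)) \<omega>)})" for n
  have sets: "A n \<in> sets M" for n
  proof (cases "n = 0")
    case False
    then have [measurable]: "(\<lambda>\<omega>. Re (trace_word n (periods k (N n)) \<omega>)) \<in> borel_measurable M"
      by (intro measurable_trace_word) auto
    show ?thesis using False by (simp add: A_def)
  qed (simp add: A_def)
  have "eventually (\<lambda>n. D' * (real n powr (1 / 4) + 1) ^ 3 \<le> real n) sequentially"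
    using D' by real_asymp
  moreover have "eventually (\<lambda>n. real n * z' * exp (- c * (real n powr (1 / 4) - 1)) \<le> 1 / real n ^ 2) sequentially"
    using c z' by real_asymp
  moreover have "eventually (\<lambda>n::nat. 1 \<le> n) sequentially" by (rule eventually_ge_at_top)
  ultimately have small: "eventually (\<lambda>n. prob (A n) \<le> 1 / real n ^ 2) sequentially"
  proof eventually_elim
    case (elim n)
    have "D * (real (N n) + 1) ^ 3 \<le> D' * (real n powr (1 / 4) + 1) ^ 3"
      using D' N_le by (intro mult_mono power_mono) auto
    then have T: "trace_moment n (periods k (N n)) \<le> z * (1 / x) ^ N n"
      using elim by (intro Dz) auto
    have "prob (A n) \<le> real n * trace_moment n (periods k (N n)) / y ^ N n"
      using prob_trace_word_ge_le[of n "y ^ N n" k "N n"] elim y g by (simp add: A_def)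
    also have "\<dots> \<le> real n * (z' * (1 / x) ^ N n) / y ^ N n"
      using T z' x y g by (intro divide_right_mono mult_left_mono order_trans[OF T] mult_right_mono) auto
    also have "\<dots> = real n * z' * (1 / (x * y) ^ N n)"
      by (simp add: power_mult_distrib power_divide)
    also have "1 / (x * y) ^ N n = exp (- c * real (N n))"
    proof -
      have "0 < x * y" using x by linarith
      then have "exp (real (N n) * c) = (x * y) ^ N n" by (simp add: exp_of_nat_mult c_def)
      then show ?thesis by (simp add: exp_minus divide_inverse mult.commute)
    qed
    also have "real n * z' * exp (- c * real (N n)) \<le> real n * z' * exp (- c * (real n powr (1 / 4) - 1))"
      using N_ge[of n] c z' by (intro mult_left_mono) auto
    also have "\<dots> \<le> 1 / real n ^ 2" by (rule elim)
    finally show ?case .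
  qed
  have "summable (\<lambda>n. prob (A n))"
  proof (rule summable_comparison_test_ev)
    show "eventually (\<lambda>n. norm (prob (A n)) \<le> 1 / real n ^ 2) sequentially" using small by simp
    show "summable (\<lambda>n. 1 / real n ^ 2)" using inverse_power_summable[of 2, where ?'a = real] by (simp add: inverse_eq_divide)
  qed
  then have "AE \<omega> in M. eventually (\<lambda>n. \<omega> \<in> space M - A n) sequentially"
    using sets by (intro borel_cantelli_AE1) (auto simp: emeasure_eq_measure)
  then show ?thesis
  proof (rule AE_mp, intro AE_I2 impI)
    fix \<omega> assume \<omega>: "eventually (\<lambda>n. \<omega> \<in> space M - A n) sequentially"
    have "eventually (\<lambda>n::nat. 1 \<le> n) sequentially" by (rule eventually_ge_at_top)
    with \<omega> show "eventually (\<lambda>n. operator_norm_mat (ginibre n \<omega> ^\<^sub>m k) ^ 2 < y) sequentially"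
    proof eventually_elim
      case (elim n)
      have "1 \<le> real n powr (1 / 4)" using elim by (intro ge_one_powr_ge_zero) auto
      then have N1: "1 \<le> N n" unfolding N_def by linarith
      have "(operator_norm_mat (ginibre n \<omega> ^\<^sub>m k) ^ 2) ^ N n \<le> Re (trace_word n (periods k (N n)) \<omega>)"
        unfolding power_mult[symmetric] trace_word_def
        by (rule operator_norm_mat_power_le_trace[OF ginibre_carrier N1])
      also have "\<dots> < y ^ N n" using elim by (auto simp: A_def)
      finally show ?case by (rule power_less_imp_less_base) (use y g in simp)
    qed
  qed
qed

text \<open>
  For a fixed \<open>m\<close> with Fuss-Catalan number at least \<open>y'^m\<close>, where \<open>y < y' < \<gamma>^2\<close>, the normalized
  trace has mean at least \<open>y'^m\<close> and almost surely does not fall below \<open>y^m\<close> infinitely often.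
\<close>
lemma eventually_operator_norm_greater:
  assumes k: "1 \<le> k" and y: "0 < y" "y < gamma_squared k"
  shows "AE \<omega> in M. eventually (\<lambda>n. y < operator_norm_mat (ginibre n \<omega> ^\<^sub>m k) ^ 2) sequentially"
proof -
  define y' where "y' = (y + gamma_squared k) / 2"
  have y': "0 < y'" "y < y'" "y' < gamma_squared k" using y by (auto simp: y'_def)
  obtain m where m: "1 \<le> m" "y' ^ m \<le> fuss k 0 m" using fuss_growth[OF k y'(1,3)] by blast
  define \<delta> where "\<delta> = y' ^ m - y ^ m"
  have \<delta>: "0 < \<delta>" using y y' m by (simp add: \<delta>_def power_strict_mono)
  define w where "w = periods k m"
  define V where "V n \<omega> = Re (trace_word n w \<omega>) / real n" for n \<omega>
  define A where "A n = (if n = 0 then {} else {\<omega> \<in> space M. \<delta> \<le> \<bar>V n \<omega> - expectation (V n)\<bar>})" for n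
  have sets: "A n \<in> sets M" for n
  proof (cases "n = 0")
    case False
    then have [measurable]: "(\<lambda>\<omega>. Re (trace_word n w \<omega>)) \<in> borel_measurable M"
      by (intro measurable_trace_word) auto
    show ?thesis using False by (simp add: A_def V_def)
  qed (simp add: A_def)
  define E where "E = 2 * real (length w) ^ 2 / \<delta> ^ 2 + 1"
  define C :: real where "C = 1 + 2 * 8 ^ (3 * length w)"
  have EC: "0 < E" "0 < C"
    unfolding E_def C_def by (intro add_nonneg_pos add_pos_pos; simp)+
  have "eventually (\<lambda>n. E * (sqrt (real n) + C) / real n ^ 2 \<le> real n powr (-5 / 4)) sequentially"
    using EC by real_asymp
  moreover have "eventually (\<lambda>n. 16 * (3 * length w) ^ 3 + 1 \<le> n) sequentially" by (rule eventually_ge_at_top)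
  ultimately have small: "eventually (\<lambda>n. prob (A n) \<le> real n powr (-5 / 4)) sequentially"
  proof eventually_elim
    case (elim n)
    then have n: "1 \<le> n" "16 * (3 * length w) ^ 3 \<le> n" by auto
    note var = variance_trace_le[OF n w_def, folded V_def]
    have "prob (A n) \<le> variance (V n) / \<delta> ^ 2"
      using Chebyshev_inequality[of "V n" \<delta>] var(1,2) \<delta> n by (simp add: A_def borel_measurable_integrable)
    also have "\<dots> \<le> 2 * real (length w) ^ 2 * (sqrt n + C) / real n ^ 2 / \<delta> ^ 2"
      using var(4) by (intro divide_right_mono) (auto simp: C_def add.assoc)
    also have "\<dots> = (2 * real (length w) ^ 2 / \<delta> ^ 2) * (sqrt n + C) / real n ^ 2" by simp
    also have "\<dots> \<le> E * (sqrt n + C) / real n ^ 2"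
      using EC by (intro divide_right_mono mult_right_mono) (auto simp: E_def)
    finally show ?case using elim by simp
  qed
  have "summable (\<lambda>n. prob (A n))"
  proof (rule summable_comparison_test_ev)
    show "eventually (\<lambda>n. norm (prob (A n)) \<le> real n powr (-5 / 4)) sequentially" using small by simp
    show "summable (\<lambda>n. real n powr (-5 / 4))" by (simp add: summable_real_powr_iff)
  qed
  then have "AE \<omega> in M. eventually (\<lambda>n. \<omega> \<in> space M - A n) sequentially"
    using sets by (intro borel_cantelli_AE1) (auto simp: emeasure_eq_measure)
  then show ?thesis
  proof (rule AE_mp, intro AE_I2 impI)
    fix \<omega> assume \<omega>: "eventually (\<lambda>n. \<omega> \<in> space M - A n) sequentially"
    have "eventually (\<lambda>n. 16 * (3 * length w) ^ 3 + 1 \<le> n) sequentially" by (rule eventually_ge_at_top)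
    with \<omega> show "eventually (\<lambda>n. y < operator_norm_mat (ginibre n \<omega> ^\<^sub>m k) ^ 2) sequentially"
    proof eventually_elim
      case (elim n)
      then have n: "1 \<le> n" "16 * (3 * length w) ^ 3 \<le> n" by auto
      have "y' ^ m \<le> trace_moment n w"
        using fuss_le_trace_moment[OF n(1), of 0 k m] m by (simp add: w_def fuss_word_0)
      also have "trace_moment n w = expectation (V n)"
        using variance_trace_le(3)[OF n w_def] by (simp add: V_def[abs_def])
      finally have "y' ^ m \<le> expectation (V n)" .
      moreover have "\<bar>V n \<omega> - expectation (V n)\<bar> < \<delta>" using elim n by (auto simp: A_def)
      ultimately have "y ^ m < V n \<omega>" unfolding \<delta>_def by linarith
      also have "V n \<omega> \<le> (operator_norm_mat (ginibre n \<omega> ^\<^sub>m k) ^ 2) ^ m"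
        using trace_le_operator_norm_power[OF ginibre_carrier, of n \<omega> k m] n
        by (simp add: V_def w_def trace_word_def power_mult[symmetric] field_simps)
      finally show ?case by (rule power_less_imp_less_base) simp
    qed
  qed
qed

theorem operator_norm_ginibre_power_tendsto:
  assumes k: "1 \<le> k"
  shows "AE \<omega> in M. (\<lambda>n. operator_norm_mat (ginibre n \<omega> ^\<^sub>m k)) \<longlonglongrightarrow> sqrt (gamma_squared k)"
proof -
  have g: "2 \<le> gamma_squared k" by (rule gamma_squared_ge_2[OF k])
  have "AE \<omega> in M. \<forall>i::nat. eventually (\<lambda>n. operator_norm_mat (ginibre n \<omega> ^\<^sub>m k) ^ 2 < gamma_squared k + inverse (real (Suc i))) sequentially"
    unfolding AE_all_countable by (intro allI eventually_operator_norm_less k) simp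
  moreover have "AE \<omega> in M. \<forall>i::nat. eventually (\<lambda>n. gamma_squared k - inverse (real (Suc i)) < operator_norm_mat (ginibre n \<omega> ^\<^sub>m k) ^ 2) sequentially"
  proof (unfold AE_all_countable, intro allI eventually_operator_norm_greater k)
    fix i
    have "inverse (real (Suc i)) \<le> 1" by (simp add: field_simps)
    then show "0 < gamma_squared k - inverse (real (Suc i))" using g by linarith
  qed simp
  ultimately show ?thesis
  proof eventually_elim
    case (elim \<omega>)
    let ?f = "\<lambda>n. operator_norm_mat (ginibre n \<omega> ^\<^sub>m k)"
    have "(\<lambda>n. ?f n ^ 2) \<longlonglongrightarrow> gamma_squared k"
    proof (rule order_tendstoI)
      fix a assume "a < gamma_squared k"
      then obtain i where "inverse (real (Suc i)) < gamma_squared k - a" using reals_Archimedean[of "gamma_squared k - a"] by auto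
      then have "a \<le> gamma_squared k - inverse (real (Suc i))" by simp
      then show "eventually (\<lambda>n. a < ?f n ^ 2) sequentially"
        using elim(2) by (auto elim!: eventually_mono[OF spec[of _ i]])
    next
      fix a assume "gamma_squared k < a"
      then obtain i where "inverse (real (Suc i)) < a - gamma_squared k" using reals_Archimedean[of "a - gamma_squared k"] by auto
      then have "gamma_squared k + inverse (real (Suc i)) \<le> a" by simp
      then show "eventually (\<lambda>n. ?f n ^ 2 < a) sequentially"
        using elim(1) by (auto elim!: eventually_mono[OF spec[of _ i]])
    qed
    then have "(\<lambda>n. sqrt (?f n ^ 2)) \<longlonglongrightarrow> sqrt (gamma_squared k)" by (rule tendsto_real_sqrt)
    then show ?case by (simp add: operator_norm_mat_nonneg)
  qed
qed

end

theorem corollary1p2: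
  fixes M :: "'a measure"
    and g :: "nat \<Rightarrow> nat \<Rightarrow> 'a \<Rightarrow> complex"
    and k :: nat
  assumes "prob_space M"
    and "prob_space.indep_vars M (\<lambda>_. borel) (\<lambda>(i, j). g i j) ({1..} \<times> {1..})"
    and "\<And>i j. 1 \<le> i \<Longrightarrow> 1 \<le> j \<Longrightarrow> prob_space.std_complex_gaussian M (g i j)"
    and "1 \<le> k"
  shows "AE \<omega> in M.
    (\<lambda>n. operator_norm_mat (normalized_mat (\<lambda>i j. g i j \<omega>) n ^\<^sub>m k))
      \<longlonglongrightarrow> sqrt (real ((k + 1) ^ (k + 1)) / real (k ^ k))"
proof -
  interpret prob_space M by (rule assms(1))
  interpret gaussian_array M g by unfold_locales (use assms(2,3) in auto)
  show ?thesis
    using operator_norm_ginibre_power_tendsto[OF assms(4)]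
    unfolding ginibre_def gamma_squared_def .
qed

end
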